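(* Let $n = 2^{d+s+t} + 2^{d+s} + 2^d - 3$ with $d, s, t$ non-negative integers. If $d \geqslant 6$ and $s, t \geqslant 4$, then $$\dim \mathrm{Ker}\big((\widetilde{Sq}^0_* )_{(5,n)}\big) = (2^3-1)(2^4-1)(2^5-1) = 3255.$$
   Context: $P_k = \mathbb F_2[x_1,\dots,x_k]$ is the graded polynomial algebra with each $x_i$ of degree 1, a module over the mod-2 Steenrod algebra $\mathcal A$ (action of the Steenrod squares $Sq^i$ determined by the usual axioms and the Cartan formula). $\mathcal A^+$ is the augmentation ideal of $\mathcal A$, and $QP_k = P_k/\mathcal A^+P_k = \mathbb F_2\otimes_{\mathcal A}P_k$; $(QP_k)_n$ is its degree-$n$ part. Kameko's squaring operation: let $\varphi: P_k\to P_k$ be the $\mathbb F_2$-linear map with $\varphi(x) = y$ if the monomial $x$ equals $x_1x_2\cdots x_k y^2$, and $\varphi(x)=0$ otherwise. For $n$ with $n-k$ even, $\varphi$ induces a homomorphism $(\widetilde{Sq}^0_* )_{(k,n)}: (QP_k)_n \to (QP_k)_{(n-k)/2}$. *)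

theory Defs
  imports Main HOL.Vector_Spaces "HOL-Library.Z2" "HOL-Library.Function_Algebras"
begin

text \<open>Polynomials over F_2 in k variables: a monomial x_1^(e_1)...x_k^(e_k) is
  represented by its exponent list e (length k); a polynomial is its coefficient
  function (nat list => bit).  Scalar multiplication over the field bit = F_2.\<close>

definition scaleF2 :: "bit \<Rightarrow> (nat list \<Rightarrow> bit) \<Rightarrow> (nat list \<Rightarrow> bit)" where
  "scaleF2 c f = (\<lambda>x. c * f x)"

definition dimF2 :: "(nat list \<Rightarrow> bit) set \<Rightarrow> nat" where
  "dimF2 V = vector_space.dim scaleF2 V"

definition spanF2 :: "(nat list \<Rightarrow> bit) set \<Rightarrow> (nat list \<Rightarrow> bit) set" where
  "spanF2 V = module.span scaleF2 V"

definition mons :: "nat \<Rightarrow> nat \<Rightarrow> nat list set" where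
  "mons k n = {e. length e = k \<and> sum_list e = n}"

definition Pdeg :: "nat \<Rightarrow> nat \<Rightarrow> (nat list \<Rightarrow> bit) set" where
  "Pdeg k n = {f. \<forall>e. f e \<noteq> 0 \<longrightarrow> e \<in> mons k n}"

text \<open>Sq^i applied to the monomial x^e (Cartan formula together with
  Sq^c(x^a) = binom(a,c) x^(a+c) in one variable): the set of monomials occurring
  with coefficient 1; distinct splittings give distinct monomials.\<close>
definition sqmon :: "nat \<Rightarrow> nat list \<Rightarrow> nat list set" where
  "sqmon i e = {e'. length e' = length e \<and> sum_list e' = sum_list e + i \<and>
      (\<forall>j<length e. e ! j \<le> e' ! j \<and> odd ((e ! j) choose (e' ! j - e ! j)))}"

definition Sq :: "nat \<Rightarrow> (nat list \<Rightarrow> bit) \<Rightarrow> (nat list \<Rightarrow> bit)" where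
  "Sq i f = (\<lambda>m. \<Sum>e \<in> {e. length e = length m \<and> sum_list e + i = sum_list m}.
                   (if m \<in> sqmon i e then f e else 0))"

text \<open>(A^+ P_k)_n: the degree-n hit polynomials, spanned by Sq^i f with i > 0
  (A^+ is generated as an algebra by the Sq^i, i > 0).\<close>
definition hit :: "nat \<Rightarrow> nat \<Rightarrow> (nat list \<Rightarrow> bit) set" where
  "hit k n = spanF2 {Sq i f | i f d. 0 < i \<and> d + i = n \<and> f \<in> Pdeg k d}"

text \<open>Kameko's map phi: phi(x_1...x_k y^2) = y, other monomials to 0.
  Coefficient of y in phi(f) is the coefficient of x^(2y+1) in f.\<close>
definition kphi :: "nat \<Rightarrow> (nat list \<Rightarrow> bit) \<Rightarrow> (nat list \<Rightarrow> bit)" where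
  "kphi k f = (\<lambda>y. if length y = k then f (map (\<lambda>a. 2 * a + 1) y) else 0)"

text \<open>dim Ker((Sq^0_*)_(k,n)) on (QP_k)_n = (P_k)_n / (A^+P_k)_n: the kernel is the
  image in the quotient of {f in (P_k)_n. phi f hit}; its dimension is
  dim(span(K \<union> hit)) - dim(hit).\<close>
definition kameko_ker_dim :: "nat \<Rightarrow> nat \<Rightarrow> nat" where
  "kameko_ker_dim k n =
     dimF2 (spanF2 ({f \<in> Pdeg k n. kphi k f \<in> hit k ((n - k) div 2)} \<union> hit k n))
     - dimF2 (hit k n)"

end

theory Submission
  imports Defs "HOL-Library.Poly_Mapping" "HOL-Library.FuncSet" "HOL-Library.Multiset"
    "HOL-Library.Cardinality"
begin

text \<open>
  Dually, the kernel consists of the linear forms \<open>L\<close> on degree \<open>n\<close> that are invariant under the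
  total square, modulo those that only see monomials with all exponents odd. Write a monomial as a
  word \<open>X\<^bsub>I\<^sub>0\<^esub> (X\<^bsub>I\<^sub>1\<^esub> (X\<^bsub>I\<^sub>2\<^esub> \<cdots>)\<^sup>2)\<^sup>2\<close>, where \<open>I\<^sub>k\<close> collects the variables whose exponent has binary
  digit \<open>k\<close>. The least weight sequence \<open>|I\<^sub>0|, |I\<^sub>1|, \<dots>\<close> on which \<open>L\<close> can be nonzero is
  \<open>3\<^sup>d 2\<^sup>s 1\<^sup>t\<close>, and invariance yields exchange relations between adjacent letters. On five variables
  these imply that the values on words of this weight determine all values on words starting with
  three variables, and that the words of this weight are spanned, modulo the relations, by
  polynomials indexed by flags \<open>V\<^sub>1 \<subset> V\<^sub>2 \<subset> V\<^sub>3\<close> in the space of linear forms \<open>F_2^5\<close>; there are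
  \<open>31 \<cdot> 15 \<cdot> 7\<close> of these. Conversely every flag gives an invariant form, the coefficient of the spike
  with exponents \<open>2\<^bsup>d+s+t\<^esup> - 1, 2\<^bsup>d+s\<^esup> - 1, 2\<^sup>d - 1\<close> after the corresponding linear substitution, and
  these forms are dual to the flag polynomials.
\<close>

declare add_bit_eq_xor [simp del] mult_bit_eq_and [simp del]

subsection \<open>Polynomials over the field of two elements\<close>

type_synonym 'i pol = "('i \<Rightarrow> nat) \<Rightarrow>\<^sub>0 bit"

abbreviation lookup :: "('a \<Rightarrow>\<^sub>0 'b::zero) \<Rightarrow> 'a \<Rightarrow> 'b" where
  "lookup \<equiv> Poly_Mapping.lookup"

abbreviation keys :: "('a \<Rightarrow>\<^sub>0 'b::zero) \<Rightarrow> 'a set" where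
  "keys \<equiv> Poly_Mapping.keys"

abbreviation mon :: "'a \<Rightarrow> 'a \<Rightarrow>\<^sub>0 bit" where
  "mon e \<equiv> Poly_Mapping.single e 1"

definition X :: "'i set \<Rightarrow> 'i pol" where
  "X I = mon (\<lambda>i. of_bool (i \<in> I))"

lemma bit_add_self [simp]: "(x::bit) + x = 0"
  by (cases x) auto

lemma bit_add_eq_0_iff: "(x::bit) + y = 0 \<longleftrightarrow> x = y"
  by (cases x; cases y) auto

lemma pol_add_self [simp]: "(p :: 'a \<Rightarrow>\<^sub>0 bit) + p = 0"
  by (rule poly_mapping_eqI) (simp add: lookup_add)

lemma pol_2_eq_0: "(2 :: 'i pol) = 0"
  by (simp flip: one_add_one)

lemma of_nat_pol: "(of_nat m :: 'i pol) = of_bool (odd m)"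
  by (cases "even m") (auto elim!: evenE oddE simp: pol_2_eq_0)

lemma sum_mon_keys: "(\<Sum>e\<in>keys p. mon e) = (p :: 'a \<Rightarrow>\<^sub>0 bit)"
proof (rule poly_mapping_eqI)
  fix k
  have "(\<Sum>e\<in>keys p. lookup (mon e) k) = (\<Sum>e\<in>keys p. if e = k then 1 else 0)"
    by (intro sum.cong) (auto simp: lookup_single)
  then show "lookup (\<Sum>e\<in>keys p. mon e) k = lookup p k"
    by (auto simp: lookup_sum in_keys_iff)
qed

lemma pol_square_add: "(p + q)\<^sup>2 = p\<^sup>2 + (q :: 'i pol)\<^sup>2"
  by (simp add: power2_sum pol_2_eq_0)

lemma pol_square_sum: "(\<Sum>i\<in>A. f i)\<^sup>2 = (\<Sum>i\<in>A. (f i :: 'i pol)\<^sup>2)"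
  by (induction A rule: infinite_finite_induct) (auto simp: pol_square_add)

lemma pol_power_2_power_add: "(p + q :: 'i pol) ^ (2 ^ k) = p ^ (2 ^ k) + q ^ (2 ^ k)"
  by (induction k) (simp_all add: power_mult pol_square_add mult.commute[of 2])

lemma mon_mult: "mon e * mon f = mon (e + f)"
  by (simp add: mult_single)

lemma mon_square: "(mon e)\<^sup>2 = mon (e + e)"
  by (simp add: power2_eq_square mon_mult)

lemma X_empty: "X {} = 1"
  by (simp add: X_def zero_fun_def[symmetric])

lemma X_insert: "i \<notin> I \<Longrightarrow> X (insert i I) = X {i} * X I"
  by (auto simp: X_def mon_mult intro!: arg_cong[where f = mon])

lemma X_eq_prod: "finite I \<Longrightarrow> X I = (\<Prod>i\<in>I. X {i})"
proof (induction I rule: finite_induct)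
  case (insert i I)
  then show ?case by (simp add: X_insert[OF insert.hyps(2)])
qed (simp add: X_empty)

lemma var_power: "X {i} ^ n = mon (\<lambda>j. if j = i then n else 0)"
  by (induction n) (auto simp: X_def mon_mult zero_fun_def[symmetric] intro!: arg_cong[where f = mon])

lemma var_power_mult_mon: "X {i} ^ n * mon f = mon (\<lambda>j. (if j = i then n else 0) + f j)"
  by (auto simp: var_power mon_mult fun_eq_iff intro!: arg_cong[where f = mon])

lemma mon_eq_prod: "(mon e :: 'i::finite pol) = (\<Prod>i\<in>UNIV. X {i} ^ e i)"
proof -
  have "(\<Prod>i\<in>A. X {i} ^ e i) = mon (\<lambda>i. if i \<in> A then e i else 0)" if "finite A" for A
    using that
    by (induction A rule: finite_induct)
      (auto simp: var_power mon_mult zero_fun_def[symmetric] intro!: arg_cong[where f = mon])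
  from this[of UNIV] show ?thesis by simp
qed

lemma var_mult_X: "X {i} * X I = (if i \<in> I then X (I - {i}) * (X {i})\<^sup>2 else X (insert i I))"
proof (cases "i \<in> I")
  case True
  then have "X I = X {i} * X (I - {i})"
    using X_insert[of i "I - {i}"] by (simp add: insert_absorb)
  with True show ?thesis by (simp add: power2_eq_square mult_ac)
qed (simp add: X_insert[of i I])

lemma var_mult_X_square:
  "X {i} * (X J * h\<^sup>2) = (if i \<in> J then X (J - {i}) * (X {i} * h)\<^sup>2 else X (insert i J) * h\<^sup>2)"
proof -
  have "X {i} * (X J * h\<^sup>2) = (X {i} * X J) * h\<^sup>2" by (simp add: mult.assoc)
  then show ?thesis unfolding var_mult_X by (simp add: power_mult_distrib mult.assoc)
qed

lemma X_mult_square_mon: "X I * (mon f)\<^sup>2 = mon (\<lambda>i. of_bool (i \<in> I) + 2 * f i)"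
  by (auto simp: X_def mon_square mon_mult fun_eq_iff intro!: arg_cong[where f = mon])

lemma mon_eq_X_mult_square: "mon e = X {i. odd (e i)} * (mon (\<lambda>i. e i div 2))\<^sup>2"
proof -
  have "of_bool (odd n) + 2 * (n div 2) = n" for n :: nat
    by (metis add.commute mod_2_eq_odd mult_div_mod_eq)
  then show ?thesis by (simp add: X_mult_square_mon)
qed

lemma odd_keys_X_mult_square:
  assumes "e \<in> keys (X T * q\<^sup>2)"
  shows "{i. odd (e i)} = T"
proof -
  have "X T * q\<^sup>2 = (\<Sum>f\<in>keys q. X T * (mon f)\<^sup>2)"
    by (subst (1) sum_mon_keys[of q, symmetric]) (simp add: pol_square_sum sum_distrib_left)
  then have "e \<in> (\<Union>f\<in>keys q. keys (X T * (mon f)\<^sup>2))"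
    using assms keys_sum[of "\<lambda>f. X T * (mon f)\<^sup>2" "keys q"] by auto
  then obtain f where "e = (\<lambda>i. of_bool (i \<in> T) + 2 * f i)" by (auto simp: X_mult_square_mon)
  then show ?thesis by auto
qed

definition deg :: "('i::finite \<Rightarrow> nat) \<Rightarrow> nat" where
  "deg e = (\<Sum>i\<in>UNIV. e i)"

lemma deg_add: "deg (\<lambda>i. e i + f i) = deg e + deg f"
  by (simp add: deg_def sum.distrib)

lemma deg_strict_mono: "(\<And>i. f i \<le> f' i) \<Longrightarrow> f \<noteq> f' \<Longrightarrow> deg f < deg f'"
  unfolding deg_def by (rule sum_strict_mono_ex1) (auto simp: fun_eq_iff le_less)

lemma deg_of_bool: "deg (\<lambda>i. of_bool (i \<in> I)) = card I"
  by (simp add: deg_def of_bool_def sum.If_cases)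

lemma deg_X_mult_square: "deg (\<lambda>i. of_bool (i \<in> I) + 2 * f i) = card I + 2 * deg f"
  unfolding deg_add deg_of_bool by (simp add: deg_def sum_distrib_left)

lemma deg_var_power_mult: "deg (\<lambda>j. (if j = i then n else 0) + f j) = n + deg f"
  by (simp add: deg_def sum.distrib)

definition homogeneous :: "nat \<Rightarrow> 'i::finite pol \<Rightarrow> bool" where
  "homogeneous n p \<longleftrightarrow> (\<forall>e\<in>keys p. deg e = n)"

lemma homogeneous_mult: "homogeneous m p \<Longrightarrow> homogeneous n q \<Longrightarrow> homogeneous (m + n) (p * q)"
  unfolding homogeneous_def
proof
  fix e assume p: "\<forall>e\<in>keys p. deg e = m" and q: "\<forall>e\<in>keys q. deg e = n" and "e \<in> keys (p * q)"
  then obtain a b where "e = a + b" "a \<in> keys p" "b \<in> keys q" using keys_mult[of p q] by blast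
  with p q show "deg e = m + n" by (simp add: deg_def sum.distrib)
qed

lemma homogeneous_1: "homogeneous 0 (1 :: 'i::finite pol)"
  by (simp add: homogeneous_def deg_def)

lemma homogeneous_power: "homogeneous m p \<Longrightarrow> homogeneous (k * m) (p ^ k)"
  by (induction k) (auto simp: homogeneous_1 intro: homogeneous_mult)

lemma homogeneous_prod:
  "(\<And>i. i \<in> A \<Longrightarrow> homogeneous (k i) (f i)) \<Longrightarrow> homogeneous (\<Sum>i\<in>A. k i) (\<Prod>i\<in>A. f i)"
  by (induction A rule: infinite_finite_induct) (auto simp: homogeneous_1 intro: homogeneous_mult)

lemma homogeneous_sum:
  "(\<And>i. i \<in> A \<Longrightarrow> homogeneous n (f i)) \<Longrightarrow> homogeneous n (\<Sum>i\<in>A. f i)"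
  unfolding homogeneous_def using keys_sum[of f A] by blast

lemma homogeneous_var: "homogeneous 1 (X {i})"
  using deg_of_bool[of "{i}"] by (simp add: homogeneous_def X_def)

subsection \<open>Additive maps and substitution\<close>

definition additive_ext :: "('a \<Rightarrow> 'b::ab_group_add) \<Rightarrow> ('a \<Rightarrow>\<^sub>0 bit) \<Rightarrow> 'b" where
  "additive_ext \<phi> p = (\<Sum>e\<in>keys p. \<phi> e)"

lemma additive_ext_mon [simp]: "additive_ext \<phi> (mon e) = \<phi> e"
  by (simp add: additive_ext_def)

lemma additive_additive_ext:
  assumes "\<And>x::'b::ab_group_add. x + x = 0"
  shows "additive (additive_ext \<phi> :: _ \<Rightarrow> 'b)"
proof
  fix p q :: "'a \<Rightarrow>\<^sub>0 bit"
  define F where "F = keys p \<union> keys q"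
  have ext: "additive_ext \<phi> r = (\<Sum>e\<in>F. if lookup r e = 0 then 0 else \<phi> e)" if "keys r \<subseteq> F" for r
    unfolding additive_ext_def using that
    by (intro sum.mono_neutral_cong_left) (auto simp: in_keys_iff F_def)
  have "additive_ext \<phi> (p + q) = (\<Sum>e\<in>F. if lookup (p + q) e = 0 then 0 else \<phi> e)"
    by (rule ext) (auto simp: F_def dest: subsetD[OF keys_add])
  also have "\<dots> = (\<Sum>e\<in>F. (if lookup p e = 0 then 0 else \<phi> e) + (if lookup q e = 0 then 0 else \<phi> e))"
    using assms by (intro sum.cong) (auto simp: lookup_add)
  also have "\<dots> = additive_ext \<phi> p + additive_ext \<phi> q"
    by (subst (1 2) ext) (auto simp: F_def sum.distrib)
  finally show "additive_ext \<phi> (p + q) = additive_ext \<phi> p + additive_ext \<phi> q" .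
qed

lemma additive_eq_sum_keys:
  assumes "additive L"
  shows "L p = (\<Sum>e\<in>keys p. L (mon e))"
  using additive.sum[OF assms, of mon "keys p"] by (simp add: sum_mon_keys)

lemma additive_pol_eqI:
  assumes "additive f" "additive g" "\<And>e. f (mon e) = g (mon e)"
  shows "f p = g p"
  by (simp only: additive_eq_sum_keys[OF assms(1), of p] additive_eq_sum_keys[OF assms(2), of p] assms(3))

lemma additive_pol_eq_0I:
  assumes "additive (L :: 'i pol \<Rightarrow> bit)" "\<And>e. L (mon e) = 0"
  shows "L p = 0"
  by (simp add: additive_eq_sum_keys[OF assms(1), of p] assms(2))

lemma additive_mult_square:
  assumes "additive L"
  shows "additive (\<lambda>g :: 'i pol. L (p * (q * g)\<^sup>2))"
  by (rule additive.intro) (simp add: distrib_left pol_square_add additive.add[OF assms])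

lemma additive_square:
  assumes "additive L"
  shows "additive (\<lambda>g :: 'i pol. L (p * g\<^sup>2))"
  using additive_mult_square[OF assms, of p 1] by simp

definition subst :: "('i::finite \<Rightarrow> 'j pol) \<Rightarrow> 'i pol \<Rightarrow> 'j pol" where
  "subst y = additive_ext (\<lambda>e. \<Prod>i\<in>UNIV. y i ^ e i)"

lemma additive_subst: "additive (subst y)"
  unfolding subst_def by (rule additive_additive_ext) simp

lemmas subst_add = additive.add[OF additive_subst]

lemma subst_mon: "subst y (mon e) = (\<Prod>i\<in>UNIV. y i ^ e i)"
  by (simp add: subst_def)

lemma subst_mult: "subst y (p * q) = subst y p * subst y q"
proof -
  have "subst y (mon e * q) = subst y (mon e) * subst y q" for e q
    by (rule additive_pol_eqI[where p = q])
      (auto intro!: additive.intro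
        simp: distrib_left subst_add mon_mult subst_mon power_add prod.distrib)
  then show ?thesis
    by (intro additive_pol_eqI[where p = p and f = "\<lambda>p. subst y (p * q)" and g = "\<lambda>p. subst y p * subst y q"])
      (auto intro!: additive.intro simp: distrib_right subst_add)
qed

lemma subst_1: "subst y 1 = 1"
  using subst_mon[of y 0] by simp

lemma subst_power: "subst y (p ^ n) = subst y p ^ n"
  by (induction n) (auto simp: subst_1 subst_mult)

lemma subst_prod: "subst y (\<Prod>i\<in>A. f i) = (\<Prod>i\<in>A. subst y (f i))"
  by (induction A rule: infinite_finite_induct) (auto simp: subst_1 subst_mult)

lemma subst_var: "subst y (X {i}) = y i"
proof -
  have "subst y (X {i}) = (\<Prod>j\<in>UNIV. if j = i then y j else 1)"
    unfolding X_def subst_mon by (intro prod.cong) auto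
  then show ?thesis by simp
qed

lemma subst_X: "subst y (X I) = (\<Prod>i\<in>I. y i)"
  using X_eq_prod[of I] by (simp add: subst_prod subst_var)

lemma subst_subst: "subst y (subst z p) = subst (\<lambda>i. subst y (z i)) p"
  by (rule additive_pol_eqI[where p = p])
    (auto intro!: additive.intro simp: subst_add subst_mon subst_prod subst_power)

subsection \<open>The total Steenrod square\<close>

text \<open>The total square \<open>1 + Sq\<^sup>1 + Sq\<^sup>2 + \<cdots>\<close> is the algebra map \<open>x \<mapsto> x + x\<^sup>2\<close>.\<close>
definition St :: "'i::finite pol \<Rightarrow> 'i pol" where
  "St = subst (\<lambda>i. X {i} + (X {i})\<^sup>2)"

lemma additive_St: "additive St"
  by (simp add: St_def additive_subst)

lemmas St_add = additive.add[OF additive_St]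
  and St_mult = subst_mult[of "\<lambda>i. X {i} + (X {i})\<^sup>2", folded St_def]
  and St_power = subst_power[of "\<lambda>i. X {i} + (X {i})\<^sup>2", folded St_def]
  and St_mon = subst_mon[of "\<lambda>i. X {i} + (X {i})\<^sup>2", folded St_def]
  and St_var = subst_var[of "\<lambda>i. X {i} + (X {i})\<^sup>2", folded St_def]

lemma St_X: "St (X I) = (\<Sum>A\<in>Pow I. X (I - A) * (X A)\<^sup>2)"
proof -
  have "St (X I) = (\<Prod>i\<in>I. (X {i})\<^sup>2 + X {i})"
    by (simp add: St_def subst_X add.commute)
  also have "\<dots> = (\<Sum>A\<in>Pow I. (\<Prod>i\<in>A. (X {i})\<^sup>2) * (\<Prod>i\<in>I - A. X {i}))"
    by (rule prod_add) simp
  also have "\<dots> = (\<Sum>A\<in>Pow I. X (I - A) * (X A)\<^sup>2)"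
  proof (rule sum.cong[OF refl])
    fix A
    show "(\<Prod>i\<in>A. (X {i})\<^sup>2) * (\<Prod>i\<in>I - A. X {i}) = X (I - A) * (X A)\<^sup>2"
      by (simp add: X_eq_prod[of A] X_eq_prod[of "I - A"] prod_power_distrib mult.commute)
  qed
  finally show ?thesis .
qed

lemma St_X_mult_square: "St (X I * g\<^sup>2) = (\<Sum>A\<in>Pow I. X (I - A) * (X A * St g)\<^sup>2)"
  by (simp add: St_mult St_power St_X sum_distrib_right power_mult_distrib mult.assoc)

lemma var_add_square_power:
  "(X {i} + (X {i})\<^sup>2) ^ n = (\<Sum>c\<le>n. of_bool (odd (n choose c)) * X {i} ^ (n + c))"
proof -
  have "(X {i} + (X {i})\<^sup>2) ^ n = (\<Sum>c\<le>n. of_nat (n choose c) * ((X {i})\<^sup>2) ^ c * X {i} ^ (n - c))"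
    by (subst add.commute, rule binomial_ring)
  also have "\<dots> = (\<Sum>c\<le>n. of_bool (odd (n choose c)) * X {i} ^ (n + c))"
    by (intro sum.cong refl)
      (auto simp: of_nat_pol simp flip: power_mult power_add intro!: arg_cong[where f = "power _"])
  finally show ?thesis .
qed

lemma St_mon_eq_sum:
  "St (mon f) = (\<Sum>g\<in>PiE UNIV (\<lambda>i. {..f i}).
     of_bool (\<forall>i. odd (f i choose g i)) * mon (\<lambda>i. f i + g i))"
proof -
  have "St (mon f) = (\<Prod>i\<in>UNIV. \<Sum>c\<in>{..f i}. of_bool (odd (f i choose c)) * X {i} ^ (f i + c))"
    by (simp add: St_mon var_add_square_power)
  also have "\<dots> = (\<Sum>g\<in>PiE UNIV (\<lambda>i. {..f i}).
      \<Prod>i\<in>UNIV. of_bool (odd (f i choose g i)) * X {i} ^ (f i + g i))"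
    by (rule prod_sum_PiE) auto
  also have "\<dots> = (\<Sum>g\<in>PiE UNIV (\<lambda>i. {..f i}).
      of_bool (\<forall>i. odd (f i choose g i)) * mon (\<lambda>i. f i + g i))"
  proof (rule sum.cong[OF refl])
    fix g
    have "(\<Prod>i\<in>UNIV. of_bool (odd (f i choose g i)) :: 'a pol) = of_bool (\<forall>i. odd (f i choose g i))"
      by (cases "\<forall>i. odd (f i choose g i)") (auto intro!: prod_zero)
    then show "(\<Prod>i\<in>UNIV. of_bool (odd (f i choose g i)) * X {i} ^ (f i + g i)) =
      of_bool (\<forall>i. odd (f i choose g i)) * mon (\<lambda>i. f i + g i)"
      by (simp add: prod.distrib mon_eq_prod[of "\<lambda>i. f i + g i"])
  qed
  finally show ?thesis .
qed

lemma lookup_St_mon: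
  "lookup (St (mon f)) f' = of_bool (\<forall>i. f i \<le> f' i \<and> odd (f i choose (f' i - f i)))"
proof -
  let ?G = "PiE (UNIV :: 'a set) (\<lambda>i. {..f i})" and ?d = "\<lambda>i. f' i - f i"
  let ?P = "\<lambda>g. \<forall>i. odd (f i choose g i)"
  have "lookup (St (mon f)) f' = (\<Sum>g\<in>?G. lookup (of_bool (?P g) * mon (\<lambda>i. f i + g i)) f')"
    by (simp add: St_mon_eq_sum lookup_sum)
  also have "\<dots> = (\<Sum>g\<in>?G. if g = ?d then of_bool (?P g \<and> (\<forall>i. f i \<le> f' i)) else 0)"
  proof (rule sum.cong[OF refl])
    fix g
    have "(\<lambda>i. f i + g i) = f' \<longleftrightarrow> g = ?d \<and> (\<forall>i. f i \<le> f' i)"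
      by (auto simp: fun_eq_iff) (metis diff_add_inverse, metis le_add1)
    then show "lookup (of_bool (?P g) * mon (\<lambda>i. f i + g i)) f' =
      (if g = ?d then of_bool (?P g \<and> (\<forall>i. f i \<le> f' i)) else 0)"
      by (auto simp: lookup_single when_def)
  qed
  also have "\<dots> = (if ?d \<in> ?G then of_bool (?P ?d \<and> (\<forall>i. f i \<le> f' i)) else 0)"
    by (simp add: finite_PiE)
  also have "\<dots> = of_bool (?P ?d \<and> (\<forall>i. f i \<le> f' i))"
  proof -
    have "?d \<in> ?G" if "?P ?d"
      using that by (auto simp: PiE_def Pi_def) (metis binomial_eq_0 even_zero not_le)
    then show ?thesis by auto
  qed
  finally show ?thesis by (auto intro!: arg_cong[where f = of_bool])
qed

lemma keys_St_mon:
  assumes "f' \<in> keys (St (mon f))"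
  shows "f' = f \<or> deg f < deg f'" "f' = (\<lambda>i. 2 * f i) \<or> deg f' < 2 * deg f"
proof -
  have le: "f i \<le> f' i" and odd: "odd (f i choose (f' i - f i))" for i
    using assms by (auto simp: in_keys_iff lookup_St_mon)
  show "f' = f \<or> deg f < deg f'"
    using deg_strict_mono[of f f'] le by blast
  have "f' i \<le> 2 * f i" for i
    using odd[of i] by (cases "f i < f' i - f i") (auto simp: binomial_eq_0)
  then show "f' = (\<lambda>i. 2 * f i) \<or> deg f' < 2 * deg f"
    using deg_strict_mono[of f' "\<lambda>i. 2 * f i"] deg_add[of f f] by (auto simp: mult_2)
qed

lemma additive_St_mon_lowest:
  assumes "additive (L :: 'i::finite pol \<Rightarrow> bit)"
    and "\<And>f'. deg f < deg f' \<Longrightarrow> L (mon f') = 0"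
  shows "L (St (mon f)) = L (mon f)"
proof -
  have "f \<in> keys (St (mon f))" by (simp add: in_keys_iff lookup_St_mon)
  then have "(\<Sum>f'\<in>keys (St (mon f)). L (mon f')) = (\<Sum>f'\<in>{f}. L (mon f'))"
    using keys_St_mon(1)[of _ f] assms(2) by (intro sum.mono_neutral_right) auto
  then show ?thesis by (simp add: additive_eq_sum_keys[OF assms(1), of "St (mon f)"])
qed

lemma additive_St_mon_highest:
  assumes "additive (L :: 'i::finite pol \<Rightarrow> bit)"
    and "\<And>f'. deg f' < 2 * deg f \<Longrightarrow> L (mon f') = 0"
  shows "L (St (mon f)) = L ((mon f)\<^sup>2)"
proof -
  have "(\<lambda>i. 2 * f i) \<in> keys (St (mon f))" by (simp add: in_keys_iff lookup_St_mon)
  then have "(\<Sum>f'\<in>keys (St (mon f)). L (mon f')) = (\<Sum>f'\<in>{\<lambda>i. 2 * f i}. L (mon f'))"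
    using keys_St_mon(2)[of _ f] assms(2) by (intro sum.mono_neutral_right) auto
  moreover have "(mon f)\<^sup>2 = mon (\<lambda>i. 2 * f i)"
    using X_mult_square_mon[of "{}" f] by (simp add: X_empty)
  ultimately show ?thesis by (simp add: additive_eq_sum_keys[OF assms(1), of "St (mon f)"])
qed

subsection \<open>Functionals annihilated by the positive Steenrod squares\<close>

text \<open>Invariance under the total square and concentration in degree \<open>N\<close> together say that \<open>L\<close>
  vanishes on the hit polynomials of degree \<open>N\<close>.\<close>
definition A_annihilated :: "nat \<Rightarrow> ('i::finite pol \<Rightarrow> bit) \<Rightarrow> bool" where
  "A_annihilated N L \<longleftrightarrow>
     additive L \<and> (\<forall>f. L (St f) = L f) \<and> (\<forall>e. deg e \<noteq> N \<longrightarrow> L (mon e) = 0)"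

lemma A_annihilatedD:
  assumes "A_annihilated N L"
  shows "additive L" "L (St f) = L f" "deg e \<noteq> N \<Longrightarrow> L (mon e) = 0"
  using assms by (auto simp: A_annihilated_def)

lemma A_annihilated_parity:
  assumes "A_annihilated N L" "odd (card I + N)"
  shows "L (X (I :: 'a::finite set) * g\<^sup>2) = 0"
proof (rule additive_pol_eq_0I[OF additive_square[OF A_annihilatedD(1)[OF assms(1)]]])
  fix f :: "'a \<Rightarrow> nat"
  have "card I + 2 * deg f \<noteq> N" using assms(2) by auto
  then show "L (X I * (mon f)\<^sup>2) = 0"
    using A_annihilatedD(3)[OF assms(1)] by (simp add: X_mult_square_mon deg_X_mult_square)
qed

lemma A_annihilated_square:
  assumes "A_annihilated N L" "N > 0"
  shows "L (g\<^sup>2) = 0"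
proof -
  note L = A_annihilatedD(1)[OF assms(1)] and degree = A_annihilatedD(3)[OF assms(1)]
  have "additive (\<lambda>g. L (g\<^sup>2))"
    using additive_square[OF L, of 1] by simp
  then show ?thesis
  proof (rule additive_pol_eq_0I)
    fix f
    show "L ((mon f)\<^sup>2) = 0"
    proof (cases "2 * deg f = N")
      case True
      then have "L ((mon f)\<^sup>2) = L (St (mon f))"
        by (intro additive_St_mon_highest[OF L, symmetric] degree) simp
      also have "\<dots> = L (mon f)" by (rule A_annihilatedD(2)[OF assms(1)])
      also have "\<dots> = 0" using True assms(2) by (intro degree) simp
      finally show ?thesis .
    next
      case False
      then show ?thesis
        using degree X_mult_square_mon[of "{}" f] deg_X_mult_square[of "{}" f] by (simp add: X_empty)
    qed
  qed
qed

lemma A_annihilated_var_power_mult_St: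
  assumes L: "A_annihilated N L" and "2 ^ k + deg f \<noteq> N"
  shows "L (X {i} ^ (2 ^ k) * St (mon f)) = L (X {i} ^ (2 ^ Suc k) * St (mon f))"
proof -
  note add = A_annihilatedD(1)[OF L]
  have "St (X {i} ^ (2 ^ k) * mon f) = (X {i} ^ (2 ^ k) + X {i} ^ (2 ^ Suc k)) * St (mon f)"
    by (simp add: St_mult St_power St_var pol_power_2_power_add power_mult)
  then have "L (X {i} ^ (2 ^ k) * St (mon f)) + L (X {i} ^ (2 ^ Suc k) * St (mon f))
      = L (X {i} ^ (2 ^ k) * mon f)"
    by (metis A_annihilatedD(2)[OF L] additive.add[OF add] distrib_right)
  also have "\<dots> = 0"
    using assms(2) A_annihilatedD(3)[OF L] by (simp add: var_power_mult_mon deg_var_power_mult)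
  finally show ?thesis by (simp only: bit_add_eq_0_iff)
qed

text \<open>Moving the square off \<open>g\<close> turns \<open>x \<cdot> g\<^sup>2\<close> into \<open>x \<cdot> St g\<close>, then \<open>x\<^sup>2 \<cdot> St g\<close>, \<open>x\<^sup>4 \<cdot> St g\<close>, and so
  on; the process can only stop at a nonzero value when \<open>deg g + 1\<close> is a power of two.\<close>
lemma A_annihilated_var_mult_square:
  assumes L: "A_annihilated (2 * D + 1) L" and D: "\<And>k. D + 1 \<noteq> 2 ^ k"
  shows "L (X {i} * g\<^sup>2) = 0"
proof (rule additive_pol_eq_0I[OF additive_square[OF A_annihilatedD(1)[OF L]]])
  fix f
  note degree = A_annihilatedD(3)[OF L]
  have additive_mult: "additive (\<lambda>p. L (q * p))" for q
    by (rule additive.intro) (simp add: distrib_left additive.add[OF A_annihilatedD(1)[OF L]])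
  show "L (X {i} * (mon f)\<^sup>2) = 0"
  proof (cases "deg f = D")
    case False
    then have "deg (\<lambda>j. of_bool (j \<in> {i}) + 2 * f j) \<noteq> 2 * D + 1"
      unfolding deg_X_mult_square by simp
    then show ?thesis unfolding X_mult_square_mon by (rule degree)
  next
    case True
    define k where "k = 2 * D + 1"
    have "L (X {i} * (mon f)\<^sup>2) = L (X {i} * St (mon f))"
    proof (rule additive_St_mon_highest[OF additive_mult, symmetric])
      fix f' :: "'a \<Rightarrow> nat" assume "deg f' < 2 * deg f"
      then show "L (X {i} * mon f') = 0"
        using var_power_mult_mon[of i 1 f'] deg_var_power_mult[of i 1 f'] True degree by simp
    qed
    also have "\<dots> = L (X {i} ^ (2 ^ k) * St (mon f))"
    proof (induction k)
      case (Suc k)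
      have "2 ^ k + deg f \<noteq> 2 * D + 1" using D[of k] True by simp
      then show ?case using A_annihilated_var_power_mult_St[OF L] Suc.IH by metis
    qed simp
    also have "\<dots> = 0"
    proof (rule additive_pol_eq_0I[OF additive_mult])
      fix f'
      have "2 * D + 1 < (2::nat) ^ k" unfolding k_def by (rule less_exp)
      then show "L (X {i} ^ (2 ^ k) * mon f') = 0"
        unfolding var_power_mult_mon by (intro degree) (simp add: deg_var_power_mult)
    qed
    finally show ?thesis .
  qed
qed

lemma A_annihilated_quotient:
  assumes L: "A_annihilated (card I + 2 * M) L"
    and low: "\<And>J g. card J < card I \<Longrightarrow> L (X J * g\<^sup>2) = 0"
  shows "A_annihilated M (\<lambda>g. L (X I * g\<^sup>2))"
  unfolding A_annihilated_def
proof (intro conjI allI impI additive_square[OF A_annihilatedD(1)[OF L]])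
  fix g
  have "L (X I * g\<^sup>2) = (\<Sum>A\<in>Pow I. L (X (I - A) * (X A * St g)\<^sup>2))"
    by (simp flip: A_annihilatedD(2)[OF L, of "X I * g\<^sup>2"]
        add: St_X_mult_square additive.sum[OF A_annihilatedD(1)[OF L]])
  also have "\<dots> = (\<Sum>A\<in>{{}}. L (X (I - A) * (X A * St g)\<^sup>2))"
  proof (rule sum.mono_neutral_right)
    show "\<forall>A\<in>Pow I - {{}}. L (X (I - A) * (X A * St g)\<^sup>2) = 0"
    proof
      fix A assume "A \<in> Pow I - {{}}"
      then have "card (I - A) < card I" by (intro psubset_card_mono) auto
      then show "L (X (I - A) * (X A * St g)\<^sup>2) = 0" by (rule low)
    qed
  qed auto
  finally show "L (X I * (St g)\<^sup>2) = L (X I * g\<^sup>2)" by (simp add: X_empty)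
next
  fix e :: "'a \<Rightarrow> nat" assume "deg e \<noteq> M"
  then show "L (X I * (mon e)\<^sup>2) = 0"
    using A_annihilatedD(3)[OF L] by (simp add: X_mult_square_mon deg_X_mult_square)
qed

subsection \<open>Minimal weight vectors\<close>

fun weight_degree :: "nat list \<Rightarrow> nat" where
  "weight_degree [] = 0"
| "weight_degree (a # \<omega>) = a + 2 * weight_degree \<omega>"

fun word :: "'i set list \<Rightarrow> 'i pol \<Rightarrow> 'i pol" where
  "word [] g = g"
| "word (I # ws) g = X I * (word ws g)\<^sup>2"

lemma word_append: "word (u @ w) g = word u (word w g)"
  by (induction u) auto

lemma additive_word:
  assumes "additive L"
  shows "additive (\<lambda>g. L (word ws g))"
  using assms
proof (induction ws arbitrary: L)
  case (Cons I ws)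
  then show ?case using Cons.IH[OF additive_square[OF Cons.prems]] by simp
qed simp

fun minimal_weight :: "nat list \<Rightarrow> ('i::finite pol \<Rightarrow> bit) \<Rightarrow> bool" where
  "minimal_weight [] L \<longleftrightarrow> A_annihilated 0 L"
| "minimal_weight (a # \<omega>) L \<longleftrightarrow> A_annihilated (weight_degree (a # \<omega>)) L
     \<and> (\<forall>J g. card J < a \<longrightarrow> L (X J * g\<^sup>2) = 0)
     \<and> (\<forall>I. card I = a \<longrightarrow> minimal_weight \<omega> (\<lambda>g. L (X I * g\<^sup>2)))"

lemma minimal_weight_A_annihilated: "minimal_weight \<omega> L \<Longrightarrow> A_annihilated (weight_degree \<omega>) L"
  by (cases \<omega>) simp_all

lemma minimal_weight_additive: "minimal_weight \<omega> L \<Longrightarrow> additive L"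
  using minimal_weight_A_annihilated A_annihilatedD(1) by blast

lemma minimal_weight_low: "minimal_weight (a # \<omega>) L \<Longrightarrow> card J < a \<Longrightarrow> L (X J * g\<^sup>2) = 0"
  by simp

lemma minimal_weight_tl: "minimal_weight (a # \<omega>) L \<Longrightarrow> card I = a \<Longrightarrow> minimal_weight \<omega> (\<lambda>g. L (X I * g\<^sup>2))"
  by simp

lemma minimal_weight_word:
  assumes "minimal_weight (map card ws @ \<omega>) L"
  shows "minimal_weight \<omega> (\<lambda>g. L (word ws g))"
  using assms
proof (induction ws arbitrary: L)
  case (Cons I ws)
  then show ?case using Cons.IH[of "\<lambda>g. L (X I * g\<^sup>2)"] by simp
qed simp

lemma A_annihilated_0_eq_0I:
  assumes "A_annihilated 0 L" "L 1 = 0"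
  shows "L g = 0"
proof (rule additive_pol_eq_0I[OF A_annihilatedD(1)[OF assms(1)]])
  fix e :: "'a \<Rightarrow> nat"
  show "L (mon e) = 0"
  proof (cases "deg e = 0")
    case True
    then have "e = 0" by (auto simp: deg_def fun_eq_iff)
    then show ?thesis using assms(2) by simp
  qed (rule A_annihilatedD(3)[OF assms(1)])
qed

lemma minimal_weight_eq_0I:
  assumes L: "minimal_weight (a # \<omega>) L"
    and zero: "\<And>K h. a \<le> card K \<Longrightarrow> even (card K + a) \<Longrightarrow> L (word [K] h) = 0"
  shows "L g = 0"
proof (rule additive_pol_eq_0I[OF minimal_weight_additive[OF L]])
  fix e :: "'a \<Rightarrow> nat"
  let ?K = "{i. odd (e i)}" and ?h = "mon (\<lambda>i. e i div 2)"
  consider (low) "card ?K < a" | (parity) "odd (card ?K + weight_degree (a # \<omega>))"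
    | (other) "a \<le> card ?K" "even (card ?K + a)" by fastforce
  then have "L (X ?K * ?h\<^sup>2) = 0"
  proof cases
    case low
    then show ?thesis by (rule minimal_weight_low[OF L])
  next
    case parity
    then show ?thesis by (rule A_annihilated_parity[OF minimal_weight_A_annihilated[OF L]])
  next
    case other
    then show ?thesis using zero[of ?K ?h] by simp
  qed
  then show "L (mon e) = 0" by (simp flip: mon_eq_X_mult_square)
qed

lemma minimal_weight_ConsI:
  assumes L: "A_annihilated (weight_degree (a # \<omega>)) L"
    and low: "\<And>J g. card J < a \<Longrightarrow> L (X J * g\<^sup>2) = 0"
    and tl: "\<And>M :: 'i::finite pol \<Rightarrow> bit. A_annihilated (weight_degree \<omega>) M \<Longrightarrow> minimal_weight \<omega> M"
  shows "minimal_weight (a # \<omega>) (L :: 'i pol \<Rightarrow> bit)"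
proof -
  have "minimal_weight \<omega> (\<lambda>g. L (X I * g\<^sup>2))" if "card I = a" for I
    using that L low by (intro tl A_annihilated_quotient) auto
  then show ?thesis using L low by simp
qed

declare minimal_weight.simps [simp del]

definition flag_weight :: "nat \<Rightarrow> nat \<Rightarrow> nat \<Rightarrow> nat list" where
  "flag_weight d s t = replicate d 3 @ replicate s 2 @ replicate t 1"

lemma weight_degree_flag_weight:
  "weight_degree (flag_weight d s t) + 3 = 2 ^ (d + s + t) + 2 ^ (d + s) + 2 ^ d"
proof -
  have ones: "weight_degree (replicate t 1) + 1 = 2 ^ t" by (induction t) auto
  have "weight_degree (replicate s 2 @ replicate t 1) + 2 = 2 ^ (s + t) + 2 ^ s"
    using ones by (induction s) auto
  then show ?thesis unfolding flag_weight_def by (induction d) auto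
qed

lemma flag_weight_degree_ne_power_2:
  assumes "0 < s" "0 < t"
  shows "weight_degree (flag_weight d s t) + 2 \<noteq> 2 ^ k"
proof
  define w where "w = weight_degree (flag_weight d s t)"
  assume "weight_degree (flag_weight d s t) + 2 = 2 ^ k"
  then have k: "w + 2 = 2 ^ k" by (simp add: w_def)
  have w: "w + 3 = 2 ^ (d + s + t) + 2 ^ (d + s) + 2 ^ d"
    unfolding w_def by (rule weight_degree_flag_weight)
  show False
  proof (cases d)
    case 0
    then have eq: "2 ^ k = 2 ^ s * (2 ^ t + 1 :: nat)" using k w by (simp add: power_add)
    have "(2::nat) ^ s < 2 ^ s * (2 ^ t + 1)" by simp
    then have "s < k" unfolding eq[symmetric] by simp
    then have "2 ^ (k - s) = (2 ^ t + 1 :: nat)" using eq by (simp add: power_diff)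
    moreover have "even ((2::nat) ^ (k - s))" using \<open>s < k\<close> by simp
    ultimately show False using \<open>0 < t\<close> by simp
  next
    case (Suc d')
    then have "even (w + 3)" unfolding w by simp
    then have "odd ((2::nat) ^ k)" unfolding k[symmetric] by simp
    then have "k = 0" by (cases k) auto
    with k show False by simp
  qed
qed

lemma minimal_weight_ones:
  "A_annihilated (weight_degree (replicate t 1)) L \<Longrightarrow> minimal_weight (replicate t 1) L"
proof (induction t arbitrary: L)
  case (Suc t)
  have "L (X J * g\<^sup>2) = 0" if "card J < 1" for J g
    using Suc.prems that by (intro A_annihilated_parity[of _ L]) auto
  then show ?case using Suc minimal_weight_ConsI[of 1 "replicate t 1" L] by simp
qed (simp add: minimal_weight.simps)

lemma minimal_weight_twos_ones:
  "A_annihilated (weight_degree (replicate s 2 @ replicate t 1)) L \<Longrightarrow>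
   minimal_weight (replicate s 2 @ replicate t 1) L"
proof (induction s arbitrary: L)
  case (Suc s)
  let ?\<omega> = "replicate s 2 @ replicate t (1::nat)"
  have L: "A_annihilated (weight_degree (2 # ?\<omega>)) L" using Suc.prems by simp
  have "L (X J * g\<^sup>2) = 0" if "card J < 2" for J g
  proof (cases "J = {}")
    case True
    then show ?thesis using A_annihilated_square[OF L] by (simp add: X_empty)
  next
    case False
    then have "card J = 1" using that by (simp add: less_2_cases_iff)
    then show ?thesis by (intro A_annihilated_parity[OF L]) simp
  qed
  then show ?case using Suc.IH minimal_weight_ConsI[OF L] by simp
qed (simp add: minimal_weight_ones del: One_nat_def)

lemma minimal_weight_flag_weight:
  assumes "0 < s" "0 < t"
  shows "A_annihilated (weight_degree (flag_weight d s t)) L \<Longrightarrow> minimal_weight (flag_weight d s t) L"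
proof (induction d arbitrary: L)
  case 0
  then show ?case by (simp add: flag_weight_def minimal_weight_twos_ones del: One_nat_def)
next
  case (Suc d)
  let ?\<omega> = "flag_weight d s t"
  have eq: "flag_weight (Suc d) s t = 3 # ?\<omega>" by (simp add: flag_weight_def)
  have L: "A_annihilated (weight_degree (3 # ?\<omega>)) L" using Suc.prems by (simp only: eq)
  have "L (X J * g\<^sup>2) = 0" if "card J < 3" for J g
  proof (cases "card J = 1")
    case True
    then obtain i where "J = {i}" by (rule card_1_singletonE)
    moreover have "L (X {i} * g\<^sup>2) = 0"
    proof (rule A_annihilated_var_mult_square)
      show "A_annihilated (2 * (weight_degree ?\<omega> + 1) + 1) L" using L by (simp add: numeral_3_eq_3)
      show "weight_degree ?\<omega> + 1 + 1 \<noteq> 2 ^ k" for k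
        using flag_weight_degree_ne_power_2[OF assms] by simp
    qed
    ultimately show ?thesis by simp
  next
    case False
    then have "even (card J)" using that by presburger
    then show ?thesis by (intro A_annihilated_parity[OF L]) simp
  qed
  then show ?case unfolding eq using Suc.IH by (intro minimal_weight_ConsI[OF L]) auto
qed

subsection \<open>Exchange relations\<close>

definition exchange_rel :: "nat \<Rightarrow> nat \<Rightarrow> ('i set \<Rightarrow> 'i set \<Rightarrow> bit) \<Rightarrow> bool" where
  "exchange_rel a b \<Psi> \<longleftrightarrow> (\<forall>I J. card I = Suc a \<longrightarrow> Suc (card J) = b \<longrightarrow>
     (\<Sum>i\<in>I - J. \<Psi> (I - {i}) (insert i J)) = 0)"

lemma var_exchange_St:
  assumes L: "minimal_weight (a # \<omega>) L" and I: "card I = Suc a"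
  shows "(\<Sum>i\<in>I. L (X (I - {i}) * (X {i} * St g)\<^sup>2)) = 0"
proof -
  note Ann = minimal_weight_A_annihilated[OF L]
  let ?t = "\<lambda>A. L (X (I - A) * (X A * St g)\<^sup>2)"
  have odd: "L (X I * h\<^sup>2) = 0" for h
    by (rule A_annihilated_parity[OF Ann]) (simp add: I)
  have "0 = (\<Sum>A\<in>Pow I. ?t A)"
    using odd[of g] A_annihilatedD(2)[OF Ann, of "X I * g\<^sup>2"]
    by (simp add: St_X_mult_square additive.sum[OF A_annihilatedD(1)[OF Ann]])
  also have "\<dots> = (\<Sum>A\<in>(\<lambda>i. {i}) ` I. ?t A)"
  proof (rule sum.mono_neutral_right)
    show "\<forall>A\<in>Pow I - (\<lambda>i. {i}) ` I. ?t A = 0"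
    proof
      fix A assume A: "A \<in> Pow I - (\<lambda>i. {i}) ` I"
      show "?t A = 0"
      proof (cases "A = {}")
        case True
        then show ?thesis using odd by (simp add: X_empty)
      next
        case False
        have "card A \<noteq> 1" using A by (auto simp: card_1_singleton_iff)
        moreover have "card A \<noteq> 0" using False by simp
        moreover have "card A \<le> Suc a" using A I card_mono[of I A] by simp
        moreover have "card (I - A) = Suc a - card A" using A I by (simp add: card_Diff_subset)
        ultimately have "card (I - A) < a" by linarith
        then show ?thesis by (rule minimal_weight_low[OF L])
      qed
    qed
  qed auto
  also have "\<dots> = (\<Sum>i\<in>I. ?t {i})"
    by (subst sum.reindex) (auto simp: inj_on_def)
  finally show ?thesis by simp
qed

lemma var_exchange:
  assumes L: "minimal_weight (a # \<omega>) L" and I: "card I = Suc a"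
  shows "(\<Sum>i\<in>I. L (X (I - {i}) * (X {i} * g)\<^sup>2)) = 0"
proof (rule additive_pol_eq_0I)
  note Ann = minimal_weight_A_annihilated[OF L]
  let ?M = "\<lambda>g. \<Sum>i\<in>I. L (X (I - {i}) * (X {i} * g)\<^sup>2)"
  show add: "additive ?M"
    by (rule additive.intro)
      (simp only: additive.add[OF additive_mult_square[OF A_annihilatedD(1)[OF Ann]]] sum.distrib)
  fix f
  have degree: "?M (mon f') = 0" if "deg f' + 1 \<noteq> weight_degree \<omega>" for f'
  proof (rule sum.neutral, rule ballI)
    fix i assume "i \<in> I"
    let ?h = "\<lambda>j. (if j = i then 1 else 0) + f' j"
    have "X {i} * mon f' = mon ?h" using var_power_mult_mon[of i 1 f'] by simp
    moreover have "deg ?h = Suc (deg f')" using deg_var_power_mult[of i 1 f'] by simp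
    ultimately show "L (X (I - {i}) * (X {i} * mon f')\<^sup>2) = 0"
      using \<open>i \<in> I\<close> that I
      by (simp only: X_mult_square_mon) (intro A_annihilatedD(3)[OF Ann], simp only: deg_X_mult_square, simp)
  qed
  show "?M (mon f) = 0"
  proof (cases "deg f + 1 = weight_degree \<omega>")
    case True
    then have "?M (St (mon f)) = ?M (mon f)"
      by (intro additive_St_mon_lowest[OF add] degree) simp
    then show ?thesis using var_exchange_St[OF L I, of "mon f"] by simp
  qed (rule degree)
qed

lemma exchange:
  assumes "minimal_weight (a # \<omega>) L" "card I = Suc a"
    and low: "\<And>T K h. card T = a \<Longrightarrow> Suc (card K) = card J \<Longrightarrow> L (word [T, K] h) = 0"
  shows "(\<Sum>i\<in>I - J. L (word [I - {i}, insert i J] h)) = 0"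
proof -
  have "0 = (\<Sum>i\<in>I. L (X (I - {i}) * (X {i} * (X J * h\<^sup>2))\<^sup>2))"
    using var_exchange[OF assms(1,2)] by simp
  also have "\<dots> = (\<Sum>i\<in>I - J. L (X (I - {i}) * (X {i} * (X J * h\<^sup>2))\<^sup>2))"
  proof (rule sum.mono_neutral_right)
    show "\<forall>i\<in>I - (I - J). L (X (I - {i}) * (X {i} * (X J * h\<^sup>2))\<^sup>2) = 0"
    proof
      fix i assume i: "i \<in> I - (I - J)"
      then have "card (I - {i}) = a" using assms(2) by simp
      moreover have "Suc (card (J - {i})) = card J" using i by (intro card_Suc_Diff1) auto
      ultimately show "L (X (I - {i}) * (X {i} * (X J * h\<^sup>2))\<^sup>2) = 0"
        using i low[of "I - {i}" "J - {i}" "X {i} * h"] by (auto simp: var_mult_X_square)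
    qed
  qed auto
  also have "\<dots> = (\<Sum>i\<in>I - J. L (word [I - {i}, insert i J] h))"
    by (intro sum.cong refl) (auto simp: var_mult_X_square)
  finally show ?thesis by simp
qed

lemma exchange_rel_word:
  assumes L: "minimal_weight (a # b # \<omega>) L"
  shows "exchange_rel a b (\<lambda>A B. L (word [A, B] h))"
  unfolding exchange_rel_def
proof (intro allI impI exchange[OF L])
  fix I J T K :: "'a set" and h
  assume "Suc (card J) = b" "card T = a" "Suc (card K) = card J"
  then show "L (word [T, K] h) = 0"
    using minimal_weight_low[OF minimal_weight_tl[OF L, of T], of K] by simp
qed

lemma exchange_rel_word_two_above:
  assumes L: "minimal_weight (a # \<omega>) L"
    and "\<And>T K h. card T = a \<Longrightarrow> card K = b \<Longrightarrow> L (word [T, K] h) = 0"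
  shows "exchange_rel a (b + 2) (\<lambda>A B. L (word [A, B] h))"
  unfolding exchange_rel_def using assms by (intro allI impI exchange[OF L]) auto

lemma exchange_relD:
  assumes "exchange_rel a b \<Psi>" "card I = Suc a" "Suc (card J) = b"
  shows "(\<Sum>i\<in>I - J. \<Psi> (I - {i}) (insert i J)) = 0"
  using assms by (simp add: exchange_rel_def)

lemma exchange_rel_single:
  assumes rel: "exchange_rel a b (\<Psi> :: 'i::finite set \<Rightarrow> _)" and "card A = a" and J: "Suc (card J) = b"
    and x: "x \<notin> A" "x \<notin> J"
    and zero: "\<And>i. i \<in> A \<Longrightarrow> i \<notin> J \<Longrightarrow> \<Psi> (insert x A - {i}) (insert i J) = 0"
  shows "\<Psi> A (insert x J) = 0"
proof -
  have "card (insert x A) = Suc a" using assms(2) x by simp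
  then have "0 = (\<Sum>i\<in>insert x A - J. \<Psi> (insert x A - {i}) (insert i J))"
    using exchange_relD[OF rel _ J] by simp
  also have "\<dots> = (\<Sum>i\<in>{x}. \<Psi> (insert x A - {i}) (insert i J))"
    using x zero by (intro sum.mono_neutral_right) auto
  finally show ?thesis using x by simp
qed

lemma exchange_rel_pair:
  assumes rel: "exchange_rel a b (\<Psi> :: 'i::finite set \<Rightarrow> _)"
    and P: "Suc (card P) = a" and J: "Suc (card J) = b"
    and x: "x \<notin> P" "x \<notin> J" and y: "y \<notin> P" "y \<notin> J"
    and zero: "\<And>i. i \<in> P \<Longrightarrow> i \<notin> J \<Longrightarrow> \<Psi> (insert x (insert y P) - {i}) (insert i J) = 0"
  shows "\<Psi> (insert x P) (insert y J) = \<Psi> (insert y P) (insert x J)"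
proof (cases "x = y")
  case False
  let ?I = "insert x (insert y P)"
  have "card ?I = Suc a" using P x y False by simp
  then have "0 = (\<Sum>i\<in>?I - J. \<Psi> (?I - {i}) (insert i J))"
    using exchange_relD[OF rel _ J] by simp
  also have "\<dots> = (\<Sum>i\<in>{x, y}. \<Psi> (?I - {i}) (insert i J))"
    using x y zero by (intro sum.mono_neutral_right) auto
  also have "\<dots> = \<Psi> (insert y P) (insert x J) + \<Psi> (insert x P) (insert y J)"
  proof -
    have "?I - {x} = insert y P" "?I - {y} = insert x P" using x y False by auto
    then show ?thesis using False by simp
  qed
  finally show ?thesis by (metis bit_add_eq_0_iff)
qed simp

lemma exchange_rel_swap:
  assumes "exchange_rel a a (\<Psi> :: 'i::finite set \<Rightarrow> _)" "Suc (card K) = a" "x \<notin> K" "y \<notin> K"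
  shows "\<Psi> (insert x K) (insert y K) = \<Psi> (insert y K) (insert x K)"
  using assms by (intro exchange_rel_pair) auto

text \<open>The relation comes from \<open>var_exchange\<close> applied to a square factor containing all of \<open>I\<close>.\<close>
lemma word_square:
  assumes L: "minimal_weight (a # a # a # \<omega>) L"
    and K: "Suc (card K) = a" and xy: "x \<noteq> y" "x \<notin> K" "y \<notin> K"
  shows "L (word [insert x K, insert x K, insert y K] h) = L (word [insert y K, insert y K, insert x K] h)"
proof -
  define I where "I = insert x (insert y K)"
  have I: "card I = Suc a" using K xy by (simp add: I_def)
  have low: "L (word [I - {i}, I - {i}] (X {i} * (X K * h\<^sup>2))) = 0" if i: "i \<in> K" for i
  proof -
    have "minimal_weight (a # \<omega>) (\<lambda>g. L (word [I - {i}, I - {i}] g))"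
      using i I L by (intro minimal_weight_word) (simp add: I_def)
    moreover have "card (K - {i}) < a" using K card_mono[of K "K - {i}"] by auto
    ultimately have "L (word [I - {i}, I - {i}] (X (K - {i}) * (X {i} * h)\<^sup>2)) = 0"
      by (rule minimal_weight_low)
    then show ?thesis using i by (simp only: var_mult_X_square if_True)
  qed
  have "0 = (\<Sum>i\<in>I. L (X (I - {i}) * (X {i} * (X I * (X K * h\<^sup>2)\<^sup>2))\<^sup>2))"
    using var_exchange[OF L I] by simp
  also have "\<dots> = (\<Sum>i\<in>I. L (word [I - {i}, I - {i}] (X {i} * (X K * h\<^sup>2))))"
    by (rule sum.cong[OF refl]) (simp add: var_mult_X_square)
  also have "\<dots> = (\<Sum>i\<in>{x, y}. L (word [I - {i}, I - {i}] (X {i} * (X K * h\<^sup>2))))"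
    using low by (intro sum.mono_neutral_right) (auto simp: I_def)
  also have "\<dots> = (\<Sum>i\<in>{x, y}. L (word [I - {i}, I - {i}, insert i K] h))"
    by (rule sum.cong[OF refl]) (use xy in \<open>auto simp: var_mult_X_square\<close>)
  finally have "L (word [I - {x}, I - {x}, insert x K] h) + L (word [I - {y}, I - {y}, insert y K] h) = 0"
    using xy(1) by simp
  moreover have "I - {x} = insert y K" "I - {y} = insert x K" using xy by (auto simp: I_def)
  ultimately show ?thesis by (metis bit_add_eq_0_iff)
qed

subsection \<open>Words over a clique of letters\<close>

context
  fixes C :: "'a set" and n :: nat and f :: "'a list \<Rightarrow> 'b"
  assumes swap: "\<And>u x y v. set (u @ x # y # v) \<subseteq> C \<Longrightarrow> length (u @ x # y # v) = n \<Longrightarrow>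
      f (u @ x # y # v) = f (u @ y # x # v)"
begin

lemma move_to_front:
  assumes "set (p @ w\<^sub>1 @ x # w\<^sub>2) \<subseteq> C" "length (p @ w\<^sub>1 @ x # w\<^sub>2) = n"
  shows "f (p @ w\<^sub>1 @ x # w\<^sub>2) = f (p @ x # w\<^sub>1 @ w\<^sub>2)"
  using assms
proof (induction w\<^sub>1 arbitrary: p)
  case (Cons y w\<^sub>1)
  have "f (p @ (y # w\<^sub>1) @ x # w\<^sub>2) = f (p @ y # x # w\<^sub>1 @ w\<^sub>2)"
    using Cons.IH[of "p @ [y]"] Cons.prems by simp
  also have "\<dots> = f (p @ x # y # w\<^sub>1 @ w\<^sub>2)" using Cons.prems by (intro swap) auto
  finally show ?case by simp
qed simp

lemma mset_invariant_append:
  assumes "mset u = mset w" "set (p @ u) \<subseteq> C" "length (p @ u) = n"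
  shows "f (p @ u) = f (p @ w)"
  using assms
proof (induction u arbitrary: p w)
  case (Cons x u)
  then have "x \<in> set w" by (metis list.set_intros(1) mset_eq_setD)
  then obtain w\<^sub>1 w\<^sub>2 where w: "w = w\<^sub>1 @ x # w\<^sub>2" by (meson split_list)
  then have u: "mset u = mset (w\<^sub>1 @ w\<^sub>2)" using Cons.prems(1) by simp
  note mset_eq_length[OF u] mset_eq_setD[OF u]
  then have "f (p @ x # w\<^sub>1 @ w\<^sub>2) = f (p @ w)"
    using Cons.prems unfolding w by (intro move_to_front[symmetric]) auto
  then show ?case using Cons.IH[OF u, of "p @ [x]"] Cons.prems by simp
qed simp

lemma mset_invariant: "mset u = mset w \<Longrightarrow> set u \<subseteq> C \<Longrightarrow> length u = n \<Longrightarrow> f u = f w"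
  using mset_invariant_append[of u w "[]"] by simp

context
  assumes square: "\<And>x y v. set (x # x # y # v) \<subseteq> C \<Longrightarrow> length (x # x # y # v) = n \<Longrightarrow>
      f (x # x # y # v) = f (y # y # x # v)"
begin

lemma replace_repeated_letter:
  assumes "x \<in> set m" "c \<in> set m" "set m \<subseteq> C" "Suc (length m) = n"
  shows "f (x # m) = f (c # m)"
proof (cases "x = c")
  case False
  obtain m\<^sub>1 m\<^sub>2 where m: "m = m\<^sub>1 @ x # m\<^sub>2" using assms(1) by (meson split_list)
  then have "c \<in> set (m\<^sub>1 @ m\<^sub>2)" using assms(2) False by auto
  then obtain v\<^sub>1 v\<^sub>2 where m12: "m\<^sub>1 @ m\<^sub>2 = v\<^sub>1 @ c # v\<^sub>2" by (meson split_list)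
  define v where "v = v\<^sub>1 @ v\<^sub>2"
  have "mset m = add_mset x (mset (m\<^sub>1 @ m\<^sub>2))" by (simp add: m)
  also have "\<dots> = mset (x # c # v)" unfolding m12 by (simp add: v_def)
  finally have v: "mset m = mset (x # c # v)" .
  note len = mset_eq_length[OF v] and set = mset_eq_setD[OF v]
  have "f (x # m) = f (x # x # c # v)" using assms v by (intro mset_invariant) auto
  also have "\<dots> = f (c # c # x # v)" using assms len set by (intro square) auto
  also have "\<dots> = f (c # m)" using assms v len set by (intro mset_invariant) auto
  finally show ?thesis .
qed simp

lemma replace_repeated_letters:
  assumes "set (p @ q) \<subseteq> set ds" "length (p @ q @ ds) = n" "c \<in> set ds" "set ds \<subseteq> C"
  shows "f (p @ q @ ds) = f (p @ replicate (length q) c @ ds)"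
  using assms
proof (induction q arbitrary: p)
  case (Cons x q)
  have "f (p @ (x # q) @ ds) = f (x # (p @ q @ ds))" using Cons.prems by (intro mset_invariant) auto
  also have "\<dots> = f (c # (p @ q @ ds))" using Cons.prems by (intro replace_repeated_letter) auto
  also have "\<dots> = f ((p @ [c]) @ q @ ds)" using Cons.prems by (intro mset_invariant) auto
  also have "\<dots> = f ((p @ [c]) @ replicate (length q) c @ ds)" using Cons.prems by (intro Cons.IH) auto
  finally show ?case by simp
qed simp

lemma set_invariant:
  assumes "set u = set w" "length u = n" "length w = n" "set u \<subseteq> C"
  shows "f u = f w"
proof (cases u)
  case Nil
  then show ?thesis using assms(1) by simp
next
  case (Cons c u')
  define ds where "ds = remdups u"
  have ds: "set ds = set u" "c \<in> set ds" by (auto simp: ds_def Cons)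
  have canonical: "f v = f (replicate (n - length ds) c @ ds)" if "set v = set u" "length v = n" for v
  proof -
    have "mset ds \<subseteq># mset v"
      using that(1) set_eq_iff_mset_remdups_eq[of v u] mset_remdups_subset_eq[of v] by (simp add: ds_def)
    then obtain M where M: "mset v = M + mset ds" by (metis subset_mset.diff_add)
    obtain q where "mset q = M" using ex_mset by blast
    then have q: "mset v = mset (q @ ds)" using M by simp
    note len = mset_eq_length[OF q] and set = mset_eq_setD[OF q]
    have "f (q @ ds) = f (replicate (length q) c @ ds)"
      using replace_repeated_letters[of "[]" q ds c] that len set assms(4) ds by auto
    moreover have "f v = f (q @ ds)" by (rule mset_invariant[OF q]) (use that assms(4) in auto)
    moreover have "length q = n - length ds" using len that(2) by simp
    ultimately show ?thesis by simp
  qed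
  show ?thesis using canonical[of u] canonical[of w] assms(1-3) by simp
qed

end

end

definition clique :: "nat \<Rightarrow> 'i set set \<Rightarrow> bool" where
  "clique a C \<longleftrightarrow> (\<forall>A\<in>C. card A = a) \<and> (\<forall>A\<in>C. \<forall>B\<in>C. A \<noteq> B \<longrightarrow> card (A \<union> B) = Suc a)"

lemma cliqueE:
  assumes "clique a (C :: 'i::finite set set)" "A \<in> C" "B \<in> C" "A \<noteq> B"
  obtains x y K where "A = insert x K" "B = insert y K" "x \<noteq> y" "x \<notin> K" "y \<notin> K" "Suc (card K) = a"
proof -
  have a: "card A = a" "card B = a" "card (A \<union> B) = Suc a"
    using assms by (auto simp: clique_def)
  have "card (A \<union> B) + card (A \<inter> B) = card A + card B"
    using card_Un_Int[of A B] by simp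
  with a have K: "Suc (card (A \<inter> B)) = a" by simp
  have "card (A - B) = 1" "card (B - A) = 1"
    using K a by (simp_all add: card_Diff_subset_Int Int_commute)
  then obtain x y where "A - B = {x}" "B - A = {y}" by (auto simp: card_1_singleton_iff)
  then show ?thesis using K by (intro that[of x "A \<inter> B" y]) auto
qed

lemma map_card_replicate: "(\<forall>A\<in>set w. card A = a) \<Longrightarrow> map card w = replicate (length w) a"
  by (induction w) auto

lemma clique_swap:
  assumes C: "clique a C" and "A \<in> C" "B \<in> C" and rel: "exchange_rel a a (\<Psi> :: 'i::finite set \<Rightarrow> _)"
  shows "\<Psi> A B = \<Psi> B A"
proof (cases "A = B")
  case False
  obtain x y K where "A = insert x K" "B = insert y K" "x \<notin> K" "y \<notin> K" "Suc (card K) = a"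
    using cliqueE[OF assms(1-3) False] by metis
  then show ?thesis using exchange_rel_swap[OF rel] by simp
qed simp

lemma clique_square:
  assumes C: "clique a C" and "A \<in> C" "B \<in> C" and L: "minimal_weight (a # a # a # \<omega>) L"
  shows "L (word [A, A, B] h) = L (word [B, B, A] h)"
proof (cases "A = B")
  case False
  obtain x y K where "A = insert x K" "B = insert y K" "x \<noteq> y" "x \<notin> K" "y \<notin> K" "Suc (card K) = a"
    using cliqueE[OF assms(1-3) False] by metis
  then show ?thesis using word_square[OF L] by simp
qed simp

lemma clique_word_cong:
  assumes C: "clique a C" and u: "set u \<subseteq> C" and eq: "set u = set w" "length u = length w"
    and L: "minimal_weight (replicate (length u) a @ \<omega>) L"
  shows "L (word u h) = L (word w h)"
proof (rule set_invariant[of C "length u" "\<lambda>u. L (word u h)"])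
  have cards: "map card v = replicate (length v) a" if "set v \<subseteq> C" for v
    using that C by (intro map_card_replicate) (auto simp: clique_def)
  fix v A B v' assume v: "set (v @ A # B # v') \<subseteq> C" "length (v @ A # B # v') = length u"
  have "replicate (length u) a = map card v @ a # a # replicate (length v') a"
    using v cards[of v] by (simp flip: replicate_add replicate_Suc)
  then have "minimal_weight (a # a # replicate (length v') a @ \<omega>) (\<lambda>g. L (word v g))"
    using L by (intro minimal_weight_word) simp
  then show "L (word (v @ A # B # v') h) = L (word (v @ B # A # v') h)"
    using clique_swap[OF C _ _ exchange_rel_word, of A B _ "\<lambda>g. L (word v g)" "word v' h"] v(1)
    by (simp add: word_append)
next
  fix A B v assume v: "set (A # A # B # v) \<subseteq> C" "length (A # A # B # v) = length u"
  then have "minimal_weight (a # a # a # replicate (length v) a @ \<omega>) L"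
    using L by (simp flip: v(2))
  then show "L (word (A # A # B # v) h) = L (word (B # B # A # v) h)"
    using clique_square[OF C, of A B _ L "word v h"] v(1) by simp
qed (use u eq in auto)

lemma clique_insert_singletons:
  assumes "finite F"
  shows "clique (Suc (card F)) ((\<lambda>a. insert a F) ` (- F))"
  using assms by (auto simp: clique_def card_insert_if insert_commute)

definition listing :: "nat \<Rightarrow> 'a set \<Rightarrow> 'a list" where
  "listing n S = (SOME xs. set xs = S \<and> length xs = n)"

lemma listing:
  assumes "finite S" "S \<noteq> {}" "card S \<le> n"
  shows set_listing: "set (listing n S) = S" and length_listing: "length (listing n S) = n"
proof -
  obtain ys where ys: "set ys = S" "distinct ys" using finite_distinct_list[OF assms(1)] by blast
  then have "ys \<noteq> []" "length ys = card S" using assms(2) by (auto simp: distinct_card)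
  then have "set (replicate (n - card S) (hd ys) @ ys) = S"
      "length (replicate (n - card S) (hd ys) @ ys) = n"
    using ys assms(3) by (auto simp: set_replicate_conv_if)
  then have "\<exists>xs. set xs = S \<and> length xs = n" by blast
  from someI_ex[OF this] show "set (listing n S) = S" "length (listing n S) = n"
    by (auto simp: listing_def)
qed

subsection \<open>Consequences of the exchange relations on five letters\<close>

class CARD_5 = finite +
  assumes CARD_5: "CARD('a) = 5"

lemma card_Compl_finite: "card (- (A :: 'i::finite set)) = CARD('i) - card A"
  by (simp add: Compl_eq_Diff_UNIV card_Diff_subset)

lemma ex_notin:
  assumes "card (A :: 'i::finite set) + length xs < CARD('i)"
  obtains x where "x \<notin> A" "x \<notin> set xs"
proof -
  have "card (A \<union> set xs) < CARD('i)"
    using card_Un_le[of A "set xs"] card_length[of xs] assms by linarith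
  then have "A \<union> set xs \<noteq> UNIV" by auto
  then show ?thesis using that by auto
qed

lemma card_4_eq_Compl:
  assumes "card (K :: 'i::CARD_5 set) = 4"
  obtains k where "K = - {k}"
proof -
  have "card (- K) = 1" using assms by (simp add: card_Compl_finite CARD_5)
  then obtain k where "- K = {k}" by (rule card_1_singletonE)
  then show ?thesis using that[of k] by auto
qed

lemma card_3_eq_Compl:
  assumes "card (K :: 'i::CARD_5 set) = 3" "c \<notin> K"
  obtains m where "m \<noteq> c" "K = - {m, c}"
proof -
  have "card (- insert c K) = 1" using assms by (simp add: card_Compl_finite CARD_5)
  then obtain m where "- insert c K = {m}" by (rule card_1_singletonE)
  then show ?thesis using assms(2) by (intro that[of m]) auto
qed

lemma card_Compl_singleton [simp]: "card (- {k :: 'i::CARD_5}) = 4"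
  by (simp add: card_Compl_finite CARD_5)

lemma card_Compl_doubleton [simp]: "k \<noteq> l \<Longrightarrow> card (- {k, l :: 'i::CARD_5}) = 3"
  by (simp add: card_Compl_finite CARD_5)

lemma card_subset_Compl_singleton:
  assumes "S \<subseteq> - {i :: 'i::CARD_5}"
  shows "card S \<le> 4" and "S \<noteq> - {i} \<Longrightarrow> card S \<le> 3"
proof -
  show "card S \<le> 4" using card_mono[OF finite assms] by simp
  assume "S \<noteq> - {i}"
  with assms have "S \<subset> - {i}" by auto
  from psubset_card_mono[OF finite this] show "card S \<le> 3" by simp
qed

text \<open>The lemmas \<open>exchange_rel_a_b\<close> describe the functions satisfying the exchange relation between
  letters of cardinalities \<open>a\<close> and \<open>b\<close>; each \<open>vanish\<close> lemma lists the cardinalities of consecutive letters.\<close>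

lemma exchange_rel_4_outside:
  assumes rel: "exchange_rel a 4 (\<Psi> :: 'i::CARD_5 set \<Rightarrow> _)" and "a \<le> 3" "card B = a" "k \<notin> B"
  shows "\<Psi> B (- {k}) = 0"
proof -
  obtain x where x: "x \<notin> B" "x \<noteq> k" using ex_notin[of B "[k]"] assms by (auto simp: CARD_5)
  have "\<Psi> B (insert x (- {x, k})) = 0"
    by (rule exchange_rel_single[OF rel]) (use assms x in auto)
  moreover have "insert x (- {x, k}) = - {k}" using x by auto
  ultimately show ?thesis by simp
qed

lemma exchange_rel_4_shift:
  assumes rel: "exchange_rel a 4 (\<Psi> :: 'i::CARD_5 set \<Rightarrow> _)"
    and P: "Suc (card P) = a" "k \<notin> P" "l \<notin> P"
  shows "\<Psi> (insert k P) (- {k}) = \<Psi> (insert l P) (- {l})"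
proof (cases "k = l")
  case False
  have "\<Psi> (insert k P) (insert l (- {k, l})) = \<Psi> (insert l P) (insert k (- {k, l}))"
    using P False by (intro exchange_rel_pair[OF rel]) auto
  moreover have "insert l (- {k, l}) = - {k}" "insert k (- {k, l}) = - {l}" using False by auto
  ultimately show ?thesis by simp
qed simp

lemma vanish_a_2_4:
  assumes rel_AB: "\<And>K. card K = 4 \<Longrightarrow> exchange_rel a 2 (\<lambda>A B. \<Phi> A B (K :: 'i::CARD_5 set))"
    and rel_BK: "\<And>A. card A = a \<Longrightarrow> exchange_rel 2 4 (\<Phi> A)"
    and "a \<le> 3" "card A = a" "card B = 2" "card K = 4"
  shows "\<Phi> A B K = 0"
proof -
  obtain k where K: "K = - {k}" using card_4_eq_Compl[OF \<open>card K = 4\<close>] .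
  have outside: "\<Phi> A B (- {k}) = 0" if "card A = a" "card B = 2" "k \<notin> B" for A B k
    using exchange_rel_4_outside[OF rel_BK[OF that(1)]] that by simp
  show ?thesis
  proof (cases "k \<in> B")
    case False
    then show ?thesis unfolding K using assms by (intro outside)
  next
    case True
    then obtain p where B: "B = {k, p}" "p \<noteq> k"
      using assms(5) by (auto simp: card_2_iff insert_commute)
    obtain q where q: "q \<notin> A" "q \<noteq> p" using ex_notin[of A "[p]"] assms by (auto simp: CARD_5)
    have "\<Phi> A B K = \<Phi> A {q, p} (- {q})"
      unfolding B K using B q assms by (intro exchange_rel_4_shift[OF rel_BK]) auto
    also have "\<dots> = 0"
    proof (rule exchange_rel_single[OF rel_AB])
      show "\<Phi> (insert q A - {i}) {i, p} (- {q}) = 0" if "i \<in> A" "i \<notin> {p}" for i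
        using that q assms by (intro outside) auto
    qed (use q assms in auto)
    finally show ?thesis .
  qed
qed

lemma vanish_3_3_4_disjoint:
  assumes rel_AB: "\<And>K. card K = 4 \<Longrightarrow> exchange_rel 3 3 (\<lambda>A B. \<Phi> A B (K :: 'i::CARD_5 set))"
    and rel_BK: "\<And>A. card A = 3 \<Longrightarrow> exchange_rel 3 4 (\<Phi> A)"
    and "p \<noteq> r" "k \<noteq> p" "k \<noteq> r"
  shows "\<Phi> (- {r, p}) {k, r, p} (- {k}) = 0"
proof -
  have "\<exists>x. \<forall>k. k \<notin> {i, p} \<longrightarrow> \<Phi> (- {i, p}) (insert k {i, p}) (- {k}) = x" if "i \<noteq> p" for i
  proof -
    obtain l where l: "l \<notin> {i, p}" using ex_notin[of "{}" "[i, p]"] by (auto simp: CARD_5)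
    show ?thesis
      by (intro exI[of _ "\<Phi> (- {i, p}) (insert l {i, p}) (- {l})"] allI impI exchange_rel_4_shift[OF rel_BK])
        (use that l in auto)
  qed
  then obtain G where G: "\<And>i k. i \<noteq> p \<Longrightarrow> k \<notin> {i, p} \<Longrightarrow> \<Phi> (- {i, p}) {k, i, p} (- {k}) = G i"
    by metis
  have total: "G k = (\<Sum>i\<in>- {p}. G i)" if "k \<noteq> p" for k
  proof -
    have "0 = (\<Sum>i\<in>- {p} - {k, p}. \<Phi> (- {p} - {i}) (insert i {k, p}) (- {k}))"
      using exchange_relD[OF rel_AB[OF card_Compl_singleton], of "- {p}" "{k, p}" k] that by simp
    also have "\<dots> = (\<Sum>i\<in>- {p} - {k}. G i)"
    proof (rule sum.cong)
      fix i assume i: "i \<in> - {p} - {k}"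
      then have "- {p} - {i} = - {i, p}" "insert i {k, p} = {k, i, p}" by auto
      then show "\<Phi> (- {p} - {i}) (insert i {k, p}) (- {k}) = G i" using G[of i k] i that by (simp only:) auto
    qed auto
    finally have "(\<Sum>i\<in>- {p} - {k}. G i) = 0" ..
    then show ?thesis using that by (simp add: sum.remove[of "- {p}" k])
  qed
  have "(\<Sum>i\<in>- {p}. G i) = (\<Sum>j\<in>- {p}. \<Sum>i\<in>- {p}. G i)"
    by (rule sum.cong[OF refl], rule total) simp
  also have "\<dots> = 0" by simp
  finally have "G r = 0" using total[of r] assms by simp
  then show ?thesis using G[of r k] assms by simp
qed

lemma vanish_3_3_4:
  assumes rel_AB: "\<And>K. card K = 4 \<Longrightarrow> exchange_rel 3 3 (\<lambda>A B. \<Phi> A B (K :: 'i::CARD_5 set))"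
    and rel_BK: "\<And>A. card A = 3 \<Longrightarrow> exchange_rel 3 4 (\<Phi> A)"
    and "card A = 3" "card B = 3" "card K = 4"
  shows "\<Phi> A B K = 0"
proof -
  obtain k where K: "K = - {k}" using card_4_eq_Compl[OF \<open>card K = 4\<close>] .
  have outside: "\<Phi> A B (- {k}) = 0" if "card A = 3" "card B = 3" "k \<notin> B" for A B k
    using exchange_rel_4_outside[OF rel_BK[OF that(1)]] that by simp
  show ?thesis
  proof (cases "k \<in> B")
    case False
    then show ?thesis unfolding K using assms by (intro outside)
  next
    case True
    define P where "P = B - {k}"
    have P: "B = insert k P" "k \<notin> P" "card P = 2" using True assms(4) by (auto simp: P_def)
    show ?thesis
    proof (cases "A \<union> P = UNIV")
      case False
      then obtain q where q: "q \<notin> A" "q \<notin> P" by auto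
      have "\<Phi> A B K = \<Phi> A (insert q P) (- {q})"
        unfolding P K using P q assms by (intro exchange_rel_4_shift[OF rel_BK]) auto
      also have "\<dots> = 0"
      proof (rule exchange_rel_single[OF rel_AB])
        show "\<Phi> (insert q A - {i}) (insert i P) (- {q}) = 0" if "i \<in> A" "i \<notin> P" for i
          using that q P assms by (intro outside) auto
      qed (use q P assms in auto)
      finally show ?thesis .
    next
      case True
      then have "- P \<subseteq> A" by auto
      moreover have "card (- P) = card A" using P assms by (simp add: card_Compl_finite CARD_5)
      ultimately have "A = - P" by (metis card_subset_eq finite)
      moreover obtain r p where "P = {r, p}" "p \<noteq> r" using P(3) by (auto simp: card_2_iff)
      ultimately show ?thesis
        using vanish_3_3_4_disjoint[OF rel_AB rel_BK, of p r k] P by (auto simp: K)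
    qed
  qed
qed

lemma exchange_rel_1_3_inside:
  assumes rel: "exchange_rel 1 3 (\<Psi> :: 'i::CARD_5 set \<Rightarrow> _)" and K: "card K = 3" "c \<in> K"
  shows "\<Psi> {c} K = 0"
proof -
  have "card (K - {c}) = 2" using K by simp
  then obtain x where x: "x \<in> K" "x \<noteq> c" by (auto simp: card_2_iff)
  have "\<Psi> {c} (insert x (K - {x})) = 0"
    by (rule exchange_rel_single[OF rel]) (use K x in auto)
  then show ?thesis using x by (simp add: insert_absorb)
qed

lemma exchange_rel_1_3_shift:
  assumes rel: "exchange_rel 1 3 (\<Psi> :: 'i::CARD_5 set \<Rightarrow> _)" and "c \<noteq> m" "c' \<noteq> m"
  shows "\<Psi> {c} (- {m, c}) = \<Psi> {c'} (- {m, c'})"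
proof (cases "c = c'")
  case False
  then have "Suc (card (- {m, c, c'})) = 3" using assms(2,3) by (simp add: card_Compl_finite CARD_5)
  then have "\<Psi> (insert c {}) (insert c' (- {m, c, c'})) = \<Psi> (insert c' {}) (insert c (- {m, c, c'}))"
    by (intro exchange_rel_pair[OF rel]) auto
  moreover have "insert c' (- {m, c, c'}) = - {m, c}" "insert c (- {m, c, c'}) = - {m, c'}"
    using False assms by auto
  ultimately show ?thesis by simp
qed simp

lemma vanish_1_1_3_outside:
  assumes rel_BC: "\<And>K. card K = 3 \<Longrightarrow> exchange_rel 1 1 (\<lambda>B C. \<Phi> B C (K :: 'i::CARD_5 set))"
    and rel_CK: "\<And>B. card B = 1 \<Longrightarrow> exchange_rel 1 3 (\<Phi> B)"
    and "b \<noteq> m" "c \<noteq> m"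
  shows "\<Phi> {b} {c} (- {m, c}) = 0"
proof -
  obtain x where x: "x \<noteq> b" "x \<noteq> m" using ex_notin[of "{}" "[b, m]"] by (auto simp: CARD_5)
  have "\<Phi> {b} {c} (- {m, c}) = \<Phi> {b} {x} (- {m, x})"
    using x assms(3,4) by (intro exchange_rel_1_3_shift[OF rel_CK]) auto
  also have "\<dots> = \<Phi> {x} {b} (- {m, x})"
    using exchange_rel_swap[OF rel_BC, of "- {m, x}" "{}" b x] x by simp
  also have "\<dots> = 0" using x assms(3) by (intro exchange_rel_1_3_inside[OF rel_CK]) auto
  finally show ?thesis .
qed

lemma vanish_a_1_1_3:
  assumes rel_AB: "\<And>C K. card C = 1 \<Longrightarrow> card K = 3 \<Longrightarrow> exchange_rel a 1 (\<lambda>A B. \<Phi> A B C (K :: 'i::CARD_5 set))"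
    and rel_BC: "\<And>A K. card A = a \<Longrightarrow> card K = 3 \<Longrightarrow> exchange_rel 1 1 (\<lambda>B C. \<Phi> A B C K)"
    and rel_CK: "\<And>A B. card A = a \<Longrightarrow> card B = 1 \<Longrightarrow> exchange_rel 1 3 (\<Phi> A B)"
    and "a \<le> 4" "card A = a" "card B = 1" "card C = 1" "card K = 3"
  shows "\<Phi> A B C K = 0"
proof -
  obtain b c where B: "B = {b}" and C: "C = {c}" using assms by (auto simp: card_1_singleton_iff)
  have outside: "\<Phi> A {b} {c} (- {m, c}) = 0" if "card A = a" "b \<noteq> m" "c \<noteq> m" for A b c m
    by (rule vanish_1_1_3_outside[of "\<Phi> A", OF rel_BC rel_CK]) (use that in auto)
  have fresh: "\<Phi> A {x} {c} (- {x, c}) = 0" if "card A = a" "x \<notin> A" "x \<noteq> c" for A x c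
  proof -
    have "\<Phi> A (insert x {}) {c} (- {x, c}) = 0"
    proof (rule exchange_rel_single[OF rel_AB])
      show "\<Phi> (insert x A - {i}) {i} {c} (- {x, c}) = 0" if "i \<in> A" for i
        using that \<open>x \<notin> A\<close> \<open>x \<noteq> c\<close> \<open>card A = a\<close> by (intro outside) auto
    qed (use that in auto)
    then show ?thesis by simp
  qed
  show ?thesis
  proof (cases "c \<in> K")
    case True
    then show ?thesis unfolding C using assms by (intro exchange_rel_1_3_inside[OF rel_CK])
  next
    case False
    then obtain m where K: "m \<noteq> c" "K = - {m, c}" using card_3_eq_Compl[OF assms(8)] by metis
    obtain x where x: "x \<notin> A" using ex_notin[of A "[]"] assms by (auto simp: CARD_5)
    consider (b_ne_m) "b \<noteq> m" | (m_fresh) "b = m" "x = m" | (m_not_fresh) "b = m" "x \<noteq> m" by blast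
    then show ?thesis
    proof cases
      case b_ne_m
      then show ?thesis unfolding B C K using K assms by (intro outside) auto
    next
      case m_fresh
      then show ?thesis unfolding B C K using K x assms by (auto intro: fresh)
    next
      case m_not_fresh
      have "\<Phi> A B C K = \<Phi> A {m} {x} (- {m, x})"
        unfolding B C K m_not_fresh using K m_not_fresh assms by (intro exchange_rel_1_3_shift[OF rel_CK]) auto
      also have "\<dots> = \<Phi> A {x} {m} (- {x, m})"
        using exchange_rel_swap[OF rel_BC, of A "- {m, x}" "{}" m x] m_not_fresh assms by (simp add: insert_commute)
      also have "\<dots> = 0" using x m_not_fresh assms by (intro fresh)
      finally show ?thesis .
    qed
  qed
qed

lemma vanish_2_1_3_outside:
  assumes rel_BC: "\<And>K. card K = 3 \<Longrightarrow> exchange_rel 2 1 (\<lambda>B C. \<Phi> B C (K :: 'i::CARD_5 set))"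
    and rel_CK: "\<And>B. card B = 2 \<Longrightarrow> exchange_rel 1 3 (\<Phi> B)"
    and B: "card B = 2" and m: "m \<notin> B" "c \<noteq> m"
  shows "\<Phi> B {c} (- {m, c}) = 0"
proof -
  obtain x where x: "x \<notin> B" "x \<noteq> m" using ex_notin[of B "[m]"] B by (auto simp: CARD_5)
  have "\<Phi> B {c} (- {m, c}) = \<Phi> B (insert x {}) (- {m, x})"
    by (rule exchange_rel_1_3_shift[OF rel_CK[OF B]]) (use x m in auto)
  also have "\<dots> = 0"
  proof (rule exchange_rel_single[OF rel_BC])
    show "\<Phi> (insert x B - {i}) {i} (- {m, x}) = 0" if "i \<in> B" for i
      using that x m B by (intro exchange_rel_1_3_inside[OF rel_CK]) auto
  qed (use x m B in auto)
  finally show ?thesis .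
qed

lemma exchange_2_1_3_shift:
  assumes rel_BC: "\<And>K. card K = 3 \<Longrightarrow> exchange_rel 2 1 (\<lambda>B C. \<Phi> B C (K :: 'i::CARD_5 set))"
    and rel_CK: "\<And>B. card B = 2 \<Longrightarrow> exchange_rel 1 3 (\<Phi> B)"
    and "r \<notin> {m, l}" "c \<noteq> m" "c' \<noteq> l"
  shows "\<Phi> {m, r} {c} (- {m, c}) = \<Phi> {l, r} {c'} (- {l, c'})"
proof (cases "l = m")
  case True
  then show ?thesis using assms(3-5) by (auto intro!: exchange_rel_1_3_shift[OF rel_CK])
next
  case False
  have "\<Phi> {m, r} {c} (- {m, c}) = \<Phi> {m, r} {l} (- {m, l})"
    using False assms(3-5) by (intro exchange_rel_1_3_shift[OF rel_CK]) auto
  also have "\<dots> = \<Phi> {l, r} {m} (- {m, l})"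
    by (rule exchange_rel_pair[OF rel_BC])
      (use False assms(3-5) in \<open>auto intro!: exchange_rel_1_3_inside[OF rel_CK]\<close>)
  also have "\<dots> = \<Phi> {l, r} {m} (- {l, m})" by (simp add: insert_commute)
  also have "\<dots> = \<Phi> {l, r} {c'} (- {l, c'})"
    using False assms(3-5) by (intro exchange_rel_1_3_shift[OF rel_CK]) auto
  finally show ?thesis .
qed

lemma vanish_a_2_1_3:
  assumes rel_AB: "\<And>C K. card C = 1 \<Longrightarrow> card K = 3 \<Longrightarrow> exchange_rel a 2 (\<lambda>A B. \<Phi> A B C (K :: 'i::CARD_5 set))"
    and rel_BC: "\<And>A K. card A = a \<Longrightarrow> card K = 3 \<Longrightarrow> exchange_rel 2 1 (\<lambda>B C. \<Phi> A B C K)"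
    and rel_CK: "\<And>A B. card A = a \<Longrightarrow> card B = 2 \<Longrightarrow> exchange_rel 1 3 (\<Phi> A B)"
    and "a \<le> 3" "card A = a" "card B = 2" "card C = 1" "card K = 3"
  shows "\<Phi> A B C K = 0"
proof -
  have outside: "\<Phi> A B {c} (- {m, c}) = 0"
    if "card A = a" "card B = 2" "m \<notin> B" "c \<noteq> m" for A B c m
    by (rule vanish_2_1_3_outside[of "\<Phi> A", OF rel_BC rel_CK]) (use that in auto)
  obtain c where C: "C = {c}" using assms by (auto simp: card_1_singleton_iff)
  show ?thesis
  proof (cases "c \<in> K")
    case True
    then show ?thesis unfolding C using assms by (intro exchange_rel_1_3_inside[OF rel_CK])
  next
    case False
    then obtain m where K: "m \<noteq> c" "K = - {m, c}" using card_3_eq_Compl[OF assms(8)] by metis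
    show ?thesis
    proof (cases "m \<in> B")
      case False
      then show ?thesis unfolding C K using K assms by (intro outside) auto
    next
      case True
      then obtain r where B: "B = {m, r}" "r \<noteq> m"
        using assms(6) by (auto simp: card_2_iff insert_commute)
      obtain l where l: "l \<notin> A" "l \<noteq> r" using ex_notin[of A "[r]"] assms by (auto simp: CARD_5)
      obtain c' where c': "c' \<noteq> l" using ex_notin[of "{}" "[l]"] by (auto simp: CARD_5)
      have "\<Phi> A B C K = \<Phi> A {l, r} {c'} (- {l, c'})"
        unfolding B C K
        by (rule exchange_2_1_3_shift[of "\<Phi> A", OF rel_BC rel_CK]) (use K B l c' assms(5) in auto)
      also have "\<dots> = 0"
      proof (rule exchange_rel_single[OF rel_AB])
        show "\<Phi> (insert l A - {i}) {i, r} {c'} (- {l, c'}) = 0" if "i \<in> A" "i \<notin> {r}" for i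
          using that l c' assms by (intro outside) auto
      qed (use l c' assms in auto)
      finally show ?thesis .
    qed
  qed
qed

lemma exchange_rel_2_3_inside:
  assumes rel: "exchange_rel 2 3 (\<Psi> :: 'i::CARD_5 set \<Rightarrow> _)" and "card C = 2" "card K = 3" "C \<subseteq> K"
  shows "\<Psi> C K = 0"
proof -
  have "C \<noteq> K" using assms by auto
  then obtain x where x: "x \<in> K" "x \<notin> C" using assms by auto
  have "\<Psi> C (insert x (K - {x})) = 0"
    by (rule exchange_rel_single[OF rel]) (use assms x in auto)
  then show ?thesis using x by (simp add: insert_absorb)
qed

lemma exchange_rel_2_3_shift:
  assumes rel: "exchange_rel 2 3 (\<Psi> :: 'i::CARD_5 set \<Rightarrow> _)"
    and "j \<noteq> q" "y \<notin> {j, q}" "z \<notin> {j, q}"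
  shows "\<Psi> {y, j} (- {y, q}) = \<Psi> {z, j} (- {z, q})"
proof (cases "y = z")
  case False
  then have "card {q, y, z} = 3" using assms by auto
  then have "Suc (card (- {q, y, z})) = 3" by (simp add: card_Compl_finite CARD_5)
  then have "\<Psi> (insert y {j}) (insert z (- {q, y, z})) = \<Psi> (insert z {j}) (insert y (- {q, y, z}))"
    using assms False by (intro exchange_rel_pair[OF rel]) auto
  moreover have "insert z (- {q, y, z}) = - {y, q}" "insert y (- {q, y, z}) = - {z, q}"
    using False assms by auto
  ultimately show ?thesis by simp
qed simp

lemma exchange_rel_2_3_triangle:
  assumes rel: "exchange_rel 2 3 (\<Psi> :: 'i::CARD_5 set \<Rightarrow> _)" and D: "distinct [x, y, z]"
    and "\<Psi> {x, z} (- {x, z}) = 0" "\<Psi> {y, z} (- {y, z}) = 0"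
  shows "\<Psi> {x, y} (- {x, y}) = 0"
proof -
  have "Suc (card (- {x, y, z})) = 3" using D by (simp add: card_Compl_finite CARD_5)
  then have "\<Psi> {x, y} (insert z (- {x, y, z})) = 0"
  proof (rule exchange_rel_single[OF rel, rotated])
    have sets: "insert x (- {x, y, z}) = - {y, z}" "insert y (- {x, y, z}) = - {x, z}"
      "insert z {x, y} - {x} = {y, z}" "insert z {x, y} - {y} = {x, z}" using D by auto
    show "\<Psi> (insert z {x, y} - {i}) (insert i (- {x, y, z})) = 0" if "i \<in> {x, y}" for i
    proof -
      from that consider "i = x" | "i = y" by blast
      then show ?thesis by cases (simp_all only: sets assms(3,4))
    qed
  qed (use D in auto)
  moreover have "insert z (- {x, y, z}) = - {x, y}" using D by auto
  ultimately show ?thesis by simp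
qed

text \<open>The values \<open>\<Phi> B {y, j} (- {y, q})\<close> do not depend on \<open>y\<close>; for fixed \<open>B\<close> they are the entries
  \<open>(j, q)\<close> of a matrix.\<close>
lemma vanish_2_2_3_off_diagonal_outside:
  assumes rel_BC: "\<And>K. card K = 3 \<Longrightarrow> exchange_rel 2 2 (\<lambda>B C. \<Phi> B C (K :: 'i::CARD_5 set))"
    and rel_CK: "\<And>B. card B = 2 \<Longrightarrow> exchange_rel 2 3 (\<Phi> B)"
    and B: "card B = 2" and q: "q \<notin> B" "j \<noteq> q" "y \<notin> {j, q}"
  shows "\<Phi> B {y, j} (- {y, q}) = 0"
proof -
  obtain p where p: "p \<notin> B" "p \<noteq> j" "p \<noteq> q" using ex_notin[of B "[j, q]"] B by (auto simp: CARD_5)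
  have "\<Phi> B {y, j} (- {y, q}) = \<Phi> B (insert p {j}) (- {p, q})"
    using q p by (intro exchange_rel_2_3_shift[OF rel_CK[OF B]]) auto
  also have "\<dots> = 0"
  proof (rule exchange_rel_single[OF rel_BC])
    show "\<Phi> (insert p B - {i}) {i, j} (- {p, q}) = 0" if "i \<in> B" "i \<notin> {j}" for i
      using that B q p by (intro exchange_rel_2_3_inside[OF rel_CK]) auto
  qed (use B p q in auto)
  finally show ?thesis .
qed

lemma exchange_2_2_3_shift:
  assumes rel_BC: "\<And>K. card K = 3 \<Longrightarrow> exchange_rel 2 2 (\<lambda>B C. \<Phi> B C (K :: 'i::CARD_5 set))"
    and rel_CK: "\<And>B. card B = 2 \<Longrightarrow> exchange_rel 2 3 (\<Phi> B)"
    and r: "r \<notin> {q, p}" and j: "j \<notin> {q, p}" and "y \<notin> {j, q}" "z \<notin> {j, p}"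
  shows "\<Phi> {q, r} {y, j} (- {y, q}) = \<Phi> {p, r} {z, j} (- {z, p})"
proof (cases "p = q")
  case True
  then show ?thesis using assms(3-6) by (auto intro!: exchange_rel_2_3_shift[OF rel_CK])
next
  case False
  have "\<Phi> {q, r} {y, j} (- {y, q}) = \<Phi> {q, r} {p, j} (- {p, q})"
    using assms(3-6) False by (intro exchange_rel_2_3_shift[OF rel_CK]) auto
  also have "\<dots> = \<Phi> {p, r} {q, j} (- {p, q})"
  proof (rule exchange_rel_pair[OF rel_BC])
    show "\<Phi> (insert q {p, r} - {i}) {i, j} (- {p, q}) = 0" if "i \<in> {r}" "i \<notin> {j}" for i
      using that r j False by (intro exchange_rel_2_3_inside[OF rel_CK]) auto
  qed (use r j False in auto)
  also have "\<dots> = \<Phi> {p, r} {q, j} (- {q, p})" by (simp add: insert_commute)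
  also have "\<dots> = \<Phi> {p, r} {z, j} (- {z, p})"
    using assms(3-6) False by (intro exchange_rel_2_3_shift[OF rel_CK]) auto
  finally show ?thesis .
qed

lemma vanish_2_2_2_3_off_diagonal:
  assumes rel_AB: "\<And>C K. card C = 2 \<Longrightarrow> card K = 3 \<Longrightarrow> exchange_rel 2 2 (\<lambda>A B. \<Phi> A B C (K :: 'i::CARD_5 set))"
    and rel_BC: "\<And>A K. card A = 2 \<Longrightarrow> card K = 3 \<Longrightarrow> exchange_rel 2 2 (\<lambda>B C. \<Phi> A B C K)"
    and rel_CK: "\<And>A B. card A = 2 \<Longrightarrow> card B = 2 \<Longrightarrow> exchange_rel 2 3 (\<Phi> A B)"
    and "card A = 2" "card B = 2" "j \<noteq> q" "y \<notin> {j, q}"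
  shows "\<Phi> A B {y, j} (- {y, q}) = 0"
proof -
  have outside: "\<Phi> A B {y, j} (- {y, q}) = 0"
    if "card A = 2" "card B = 2" "q \<notin> B" "j \<noteq> q" "y \<notin> {j, q}" for A B j q y
    by (rule vanish_2_2_3_off_diagonal_outside[of "\<Phi> A", OF rel_BC rel_CK]) (use that in auto)
  show ?thesis
  proof (cases "q \<in> B")
    case False
    then show ?thesis using assms by (intro outside)
  next
    case True
    then obtain r where B: "B = {q, r}" "r \<noteq> q" using assms(5) by (auto simp: card_2_iff insert_commute)
    obtain p where p: "p \<notin> A" "p \<noteq> j" "p \<noteq> r"
      using ex_notin[of A "[j, r]"] assms(4) by (auto simp: CARD_5)
    obtain z where z: "z \<notin> {j, p}" using ex_notin[of "{}" "[j, p]"] by (auto simp: CARD_5)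
    have "\<Phi> A B {y, j} (- {y, q}) = \<Phi> A {p, r} {z, j} (- {z, p})"
      unfolding B
      by (rule exchange_2_2_3_shift[of "\<Phi> A", OF rel_BC rel_CK]) (use B p z assms(4,6,7) in auto)
    also have "\<dots> = 0"
    proof (rule exchange_rel_single[OF rel_AB])
      show "\<Phi> (insert p A - {i}) {i, r} {z, j} (- {z, p}) = 0" if "i \<in> A" "i \<notin> {r}" for i
        using that assms p z by (intro outside) auto
    qed (use assms p z in auto)
    finally show ?thesis .
  qed
qed

lemma vanish_2_2_2_3:
  assumes rel_AB: "\<And>C K. card C = 2 \<Longrightarrow> card K = 3 \<Longrightarrow> exchange_rel 2 2 (\<lambda>A B. \<Phi> A B C (K :: 'i::CARD_5 set))"
    and rel_BC: "\<And>A K. card A = 2 \<Longrightarrow> card K = 3 \<Longrightarrow> exchange_rel 2 2 (\<lambda>B C. \<Phi> A B C K)"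
    and rel_CK: "\<And>A B. card A = 2 \<Longrightarrow> card B = 2 \<Longrightarrow> exchange_rel 2 3 (\<Phi> A B)"
    and AB: "card A = 2" "card B = 2" and CK: "card C = 2" "card K = 3"
  shows "\<Phi> A B C K = 0"
proof -
  have off: "\<Phi> A B {y, j} (- {y, q}) = 0" if "card B = 2" "j \<noteq> q" "y \<notin> {j, q}" for B j q y
    by (rule vanish_2_2_2_3_off_diagonal[of \<Phi>, OF rel_AB rel_BC rel_CK AB(1)]) (use that in auto)
  have diagonal: "\<Phi> A B {q, j} (- {q, j}) = 0" if "q \<notin> B" "j \<noteq> q" for j q
  proof (rule exchange_rel_single[OF rel_BC])
    show "\<Phi> A (insert q B - {i}) {i, j} (- {q, j}) = 0" if "i \<in> B" "i \<notin> {j}" for i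
      using off[of "insert q B - {i}" i j q] off[of "insert q B - {i}" i q j] that \<open>q \<notin> B\<close> \<open>j \<noteq> q\<close> AB
      by (auto simp: insert_commute)
  qed (use that AB in auto)
  obtain x y where C: "C = {x, y}" "x \<noteq> y" using CK by (auto simp: card_2_iff)
  consider (subset) "C \<subseteq> K" | (only_y) "x \<notin> K" "y \<in> K"
    | (only_x) "x \<in> K" "y \<notin> K" | (disjoint) "x \<notin> K" "y \<notin> K" using C by blast
  then show ?thesis
  proof cases
    case subset
    then show ?thesis by (intro exchange_rel_2_3_inside[OF rel_CK] AB CK)
  next
    case only_y
    then obtain q where "q \<noteq> x" "K = - {q, x}" using card_3_eq_Compl[OF CK(2)] by metis
    then show ?thesis using off[OF AB(2), of y q x] only_y C by (auto simp: insert_commute)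
  next
    case only_x
    then obtain q where "q \<noteq> y" "K = - {q, y}" using card_3_eq_Compl[OF CK(2)] by metis
    then show ?thesis using off[OF AB(2), of x q y] only_x C by (auto simp: insert_commute)
  next
    case disjoint
    then obtain q where "q \<noteq> x" "K = - {q, x}" using card_3_eq_Compl[OF CK(2)] by metis
    with disjoint C have K: "K = - {x, y}" by auto
    obtain z where z: "z \<notin> B" "z \<noteq> x" "z \<noteq> y"
      using ex_notin[of B "[x, y]"] AB by (auto simp: CARD_5)
    show ?thesis
      unfolding C K
      by (rule exchange_rel_2_3_triangle[OF rel_CK[OF AB], of x y z])
        (use z C diagonal[of z x] diagonal[of z y] in \<open>auto simp: insert_commute\<close>)
  qed
qed

subsection \<open>Words of minimal weight determine the functional\<close>

lemma vanish_above_two: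
  assumes L: "minimal_weight (a\<^sub>1 # a\<^sub>2 # 2 # \<omega>) (L :: 'i::CARD_5 pol \<Rightarrow> bit)"
    and a: "(a\<^sub>1, a\<^sub>2) \<in> {(3, 3), (3, 2), (2, 2)}"
    and two: "\<And>A B T h. card A = a\<^sub>1 \<Longrightarrow> card B = a\<^sub>2 \<Longrightarrow> card T = 2 \<Longrightarrow> L (word [A, B, T] h) = 0"
    and card: "card A = a\<^sub>1" "card B = a\<^sub>2" "card K = 4"
  shows "L (word [A, B, K] h) = 0"
proof -
  let ?\<Phi> = "\<lambda>A B K. L (word [A, B, K] h)"
  have rel_AB: "exchange_rel a\<^sub>1 a\<^sub>2 (\<lambda>A B. ?\<Phi> A B K)" for K
    using exchange_rel_word[OF L, of "word [K] h"] by simp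
  have rel_BK: "exchange_rel a\<^sub>2 4 (?\<Phi> A)" if "card A = a\<^sub>1" for A
    using exchange_rel_word_two_above[OF minimal_weight_tl[OF L that], of 2 h] two[OF that] by simp
  from a consider (threes) "a\<^sub>1 = 3" "a\<^sub>2 = 3" | (twos) "a\<^sub>1 \<le> 3" "a\<^sub>2 = 2" by auto
  then show ?thesis
  proof cases
    case threes
    then show ?thesis using vanish_3_3_4[of ?\<Phi> A B K] rel_AB rel_BK card by blast
  next
    case twos
    then show ?thesis using vanish_a_2_4[of a\<^sub>1 ?\<Phi> A B K] rel_AB rel_BK card by blast
  qed
qed

lemma vanish_above_one:
  assumes L: "minimal_weight (a\<^sub>1 # a\<^sub>2 # a\<^sub>3 # 1 # \<omega>) (L :: 'i::CARD_5 pol \<Rightarrow> bit)"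
    and a: "(a\<^sub>1, a\<^sub>2, a\<^sub>3) \<in> {(2, 2, 2), (2, 2, 1), (2, 1, 1), (1, 1, 1)}"
    and one: "\<And>A B C T h. card A = a\<^sub>1 \<Longrightarrow> card B = a\<^sub>2 \<Longrightarrow> card C = a\<^sub>3 \<Longrightarrow> card T = 1 \<Longrightarrow>
      L (word [A, B, C, T] h) = 0"
    and card: "card A = a\<^sub>1" "card B = a\<^sub>2" "card C = a\<^sub>3" "card K = 3"
  shows "L (word [A, B, C, K] h) = 0"
proof -
  let ?\<Phi> = "\<lambda>A B C K. L (word [A, B, C, K] h)"
  note tl = minimal_weight_tl[OF L] and tl2 = minimal_weight_tl[OF minimal_weight_tl[OF L]]
  have rel_AB: "exchange_rel a\<^sub>1 a\<^sub>2 (\<lambda>A B. ?\<Phi> A B C K)" for C K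
    using exchange_rel_word[OF L, of "word [C, K] h"] by simp
  have rel_BC: "exchange_rel a\<^sub>2 a\<^sub>3 (\<lambda>B C. ?\<Phi> A B C K)" if "card A = a\<^sub>1" for A K
    using exchange_rel_word[OF tl[OF that], of "word [K] h"] by simp
  have rel_CK: "exchange_rel a\<^sub>3 3 (?\<Phi> A B)" if "card A = a\<^sub>1" "card B = a\<^sub>2" for A B
    using exchange_rel_word_two_above[OF tl2[OF that], of 1 h] one[OF that] by (simp add: numeral_3_eq_3)
  from a consider (twos) "a\<^sub>1 = 2" "a\<^sub>2 = 2" "a\<^sub>3 = 2" | (two_one) "a\<^sub>1 \<le> 3" "a\<^sub>2 = 2" "a\<^sub>3 = 1"
    | (ones) "a\<^sub>1 \<le> 4" "a\<^sub>2 = 1" "a\<^sub>3 = 1" by auto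
  then show ?thesis
  proof cases
    case twos
    then show ?thesis using vanish_2_2_2_3[of ?\<Phi> A B C K] rel_AB rel_BC rel_CK card by blast
  next
    case two_one
    then show ?thesis using vanish_a_2_1_3[of a\<^sub>1 ?\<Phi> A B C K] rel_AB rel_BC rel_CK card by blast
  next
    case ones
    then show ?thesis using vanish_a_1_1_3[of a\<^sub>1 ?\<Phi> A B C K] rel_AB rel_BC rel_CK card by blast
  qed
qed

lemma vanish_UNIV:
  assumes L: "minimal_weight (a # \<omega>) (L :: 'i::CARD_5 pol \<Rightarrow> bit)"
    and three: "\<And>A T h. card A = a \<Longrightarrow> card T = 3 \<Longrightarrow> L (word [A, T] h) = 0"
    and A: "card A = a" "A \<noteq> UNIV"
  shows "L (word [A, UNIV] h) = 0"
proof -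
  have rel: "exchange_rel a 5 (\<lambda>A K. L (word [A, K] h))"
    using exchange_rel_word_two_above[OF L, of 3 h] three by simp
  obtain x where "x \<notin> A" using A(2) by auto
  have "L (word [A, insert x (- {x})] h) = 0"
    by (rule exchange_rel_single[OF rel]) (use \<open>x \<notin> A\<close> A in auto)
  moreover have "insert x (- {x}) = UNIV" by auto
  ultimately show ?thesis by simp
qed

lemma nth_flag_weight:
  "k < d + s + t \<Longrightarrow> flag_weight d s t ! k = (if k < d then 3 else if k < d + s then 2 else 1)"
  by (auto simp: flag_weight_def nth_append)

lemma length_flag_weight: "length (flag_weight d s t) = d + s + t"
  by (simp add: flag_weight_def)

lemma flag_weight_cases:
  assumes eq: "\<alpha> @ b # \<omega> = flag_weight d s t" and "\<alpha> \<noteq> []" "2 \<le> d" "3 \<le> s"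
  obtains (three) \<alpha>' where "b = 3" "\<alpha> = \<alpha>' @ [3]"
  | (two) \<alpha>' a\<^sub>1 a\<^sub>2 where "b = 2" "\<alpha> = \<alpha>' @ [a\<^sub>1, a\<^sub>2]" "(a\<^sub>1, a\<^sub>2) \<in> {(3, 3), (3, 2), (2, 2)}"
  | (one) \<alpha>' a\<^sub>1 a\<^sub>2 a\<^sub>3 where "b = 1" "\<alpha> = \<alpha>' @ [a\<^sub>1, a\<^sub>2, a\<^sub>3]"
      "(a\<^sub>1, a\<^sub>2, a\<^sub>3) \<in> {(2, 2, 2), (2, 2, 1), (2, 1, 1), (1, 1, 1)}"
proof -
  have len: "length \<alpha> + length \<omega> + 1 = d + s + t"
    using arg_cong[OF eq, of length] by (simp add: length_flag_weight)
  have nth: "(\<alpha> @ b # \<omega>) ! k = (if k < d then 3 else if k < d + s then 2 else 1)"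
    if "k < length (\<alpha> @ b # \<omega>)" for k
    using that nth_flag_weight[of k d s t] unfolding eq length_flag_weight by blast
  have b: "b = (if length \<alpha> < d then 3 else if length \<alpha> < d + s then 2 else 1)"
    using nth[of "length \<alpha>"] by simp
  obtain \<alpha>\<^sub>1 a\<^sub>3 where \<alpha>_snoc: "\<alpha> = \<alpha>\<^sub>1 @ [a\<^sub>3]" using \<open>\<alpha> \<noteq> []\<close> by (metis rev_exhaust)
  consider (among_threes) "length \<alpha> < d" | (after_threes) "d \<le> length \<alpha>" by linarith
  then show ?thesis
  proof cases
    case among_threes
    then show ?thesis using three b \<alpha>_snoc nth[of "length \<alpha>\<^sub>1"] by (simp add: nth_append)
  next
    case after_threes
    then obtain \<alpha>\<^sub>2 a\<^sub>2 where \<alpha>\<^sub>1_snoc: "\<alpha>\<^sub>1 = \<alpha>\<^sub>2 @ [a\<^sub>2]" using \<open>2 \<le> d\<close> \<alpha>_snoc by (cases \<alpha>\<^sub>1 rule: rev_cases) auto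
    have letters: "a\<^sub>2 = (if length \<alpha>\<^sub>2 < d then 3 else if length \<alpha>\<^sub>2 < d + s then 2 else 1)"
      "a\<^sub>3 = (if Suc (length \<alpha>\<^sub>2) < d then 3 else if Suc (length \<alpha>\<^sub>2) < d + s then 2 else 1)"
      using nth[of "length \<alpha>\<^sub>2"] nth[of "Suc (length \<alpha>\<^sub>2)"] by (simp_all add: \<alpha>_snoc \<alpha>\<^sub>1_snoc nth_append)
    show ?thesis
    proof (cases "length \<alpha> < d + s")
      case True
      then show ?thesis using after_threes b letters \<alpha>_snoc \<alpha>\<^sub>1_snoc by (intro two[of \<alpha>\<^sub>2 a\<^sub>2 a\<^sub>3]) auto
    next
      case False
      then obtain \<alpha>\<^sub>3 a\<^sub>1 where \<alpha>\<^sub>2_snoc: "\<alpha>\<^sub>2 = \<alpha>\<^sub>3 @ [a\<^sub>1]"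
        using \<open>3 \<le> s\<close> \<alpha>_snoc \<alpha>\<^sub>1_snoc by (cases \<alpha>\<^sub>2 rule: rev_cases) auto
      have "a\<^sub>1 = (if length \<alpha>\<^sub>3 < d then 3 else if length \<alpha>\<^sub>3 < d + s then 2 else 1)"
        using nth[of "length \<alpha>\<^sub>3"] by (simp add: \<alpha>_snoc \<alpha>\<^sub>1_snoc \<alpha>\<^sub>2_snoc nth_append)
      then show ?thesis
        using after_threes False b letters \<alpha>_snoc \<alpha>\<^sub>1_snoc \<alpha>\<^sub>2_snoc \<open>3 \<le> s\<close> by (intro one[of \<alpha>\<^sub>3 a\<^sub>1 a\<^sub>2 a\<^sub>3]) auto
    qed
  qed
qed

context
  fixes \<alpha> \<omega> :: "nat list" and b d s t :: nat and L :: "'i::CARD_5 pol \<Rightarrow> bit"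
  assumes eq: "\<alpha> @ b # \<omega> = flag_weight d s t" "\<alpha> \<noteq> []" "2 \<le> d" "3 \<le> s"
    and L: "minimal_weight (\<alpha> @ b # \<omega>) L"
    and next_letter: "\<And>ws T h. map card ws = \<alpha> \<Longrightarrow> card T = b \<Longrightarrow> L (word (ws @ [T]) h) = 0"
begin

lemma vanish_next_letter_3:
  assumes "b \<noteq> 2" and ws: "map card ws = \<alpha>" and K: "card K = 3"
  shows "L (word (ws @ [K]) h) = 0"
  using eq
proof (cases rule: flag_weight_cases)
  case (one \<alpha>' a\<^sub>1 a\<^sub>2 a\<^sub>3)
  then obtain us A B C where us: "ws = us @ [A, B, C]" "map card us = \<alpha>'"
      and card: "card A = a\<^sub>1" "card B = a\<^sub>2" "card C = a\<^sub>3"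
    using ws by (auto simp: map_eq_append_conv)
  have M: "minimal_weight (a\<^sub>1 # a\<^sub>2 # a\<^sub>3 # 1 # \<omega>) (\<lambda>g. L (word us g))"
    using L one by (intro minimal_weight_word) (simp add: us)
  have "L (word us (word [A, B, C, K] h)) = 0"
  proof (rule vanish_above_one[OF M one(3)])
    show "L (word us (word [A, B, C, T] h)) = 0"
      if "card A = a\<^sub>1" "card B = a\<^sub>2" "card C = a\<^sub>3" "card T = 1" for A B C T h
      using next_letter[of "us @ [A, B, C]" T h] that us one by (simp add: word_append)
  qed (use card K in auto)
  then show ?thesis by (simp add: us word_append)
qed (use assms next_letter in auto)

lemma vanish_next_letter_4:
  assumes "b = 2" and ws: "map card ws = \<alpha>" and K: "card K = 4"
  shows "L (word (ws @ [K]) h) = 0"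
  using eq
proof (cases rule: flag_weight_cases)
  case (two \<alpha>' a\<^sub>1 a\<^sub>2)
  then obtain us A B where us: "ws = us @ [A, B]" "map card us = \<alpha>'"
      and card: "card A = a\<^sub>1" "card B = a\<^sub>2"
    using ws by (auto simp: map_eq_append_conv)
  have M: "minimal_weight (a\<^sub>1 # a\<^sub>2 # 2 # \<omega>) (\<lambda>g. L (word us g))"
    using L two by (intro minimal_weight_word) (simp add: us)
  have "L (word us (word [A, B, K] h)) = 0"
  proof (rule vanish_above_two[OF M two(3)])
    show "L (word us (word [A, B, T] h)) = 0" if "card A = a\<^sub>1" "card B = a\<^sub>2" "card T = 2" for A B T h
      using next_letter[of "us @ [A, B]" T h] that us two by (simp add: word_append)
  qed (use card K in auto)
  then show ?thesis by (simp add: us word_append)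
qed (use assms in auto)

lemma vanish_next_letter_UNIV:
  assumes "b \<noteq> 2" and ws: "map card ws = \<alpha>"
  shows "L (word (ws @ [UNIV]) h) = 0"
proof -
  obtain us A where us: "ws = us @ [A]" using ws \<open>\<alpha> \<noteq> []\<close> by (cases ws rule: rev_cases) auto
  have "card A \<in> set \<alpha>" unfolding ws[symmetric] us by simp
  then have "card A \<in> set (flag_weight d s t)" unfolding eq(1)[symmetric] by simp
  then have A: "A \<noteq> UNIV" using CARD_5[where 'a = 'i] by (auto simp: flag_weight_def)
  have "minimal_weight (card A # b # \<omega>) (\<lambda>g. L (word us g))"
    using L ws us by (intro minimal_weight_word) auto
  then have "L (word us (word [A, UNIV] h)) = 0"
  proof (rule vanish_UNIV[OF _ _ refl A])
    show "L (word us (word [B, T] h)) = 0" if "card B = card A" "card T = 3" for B T h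
      using vanish_next_letter_3[OF \<open>b \<noteq> 2\<close>, of "us @ [B]" T h] that ws us by (simp add: word_append)
  qed
  then show ?thesis by (simp add: us word_append)
qed

lemma vanish_on_prefix:
  assumes ws: "map card ws = \<alpha>"
  shows "L (word ws g) = 0"
proof (rule minimal_weight_eq_0I[where L = "\<lambda>g. L (word ws g)"])
  show "minimal_weight (b # \<omega>) (\<lambda>g. L (word ws g))"
    using L by (intro minimal_weight_word) (simp add: ws)
  fix K :: "'i set" and h assume K: "b \<le> card K" "even (card K + b)"
  have "card K \<le> 5" using card_mono[of UNIV K] by (simp add: CARD_5)
  moreover from eq have "b = 1 \<or> b = 2 \<or> b = 3" by (rule flag_weight_cases) simp_all
  ultimately have "card K = b \<or> b \<noteq> 2 \<and> card K = 3 \<or> b \<noteq> 2 \<and> card K = 5 \<or> b = 2 \<and> card K = 4"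
    using K by presburger
  then consider (minimal) "card K = b" | (three) "b \<noteq> 2" "card K = 3"
    | (five) "b \<noteq> 2" "card K = 5" | (four) "b = 2" "card K = 4" by blast
  then have "L (word (ws @ [K]) h) = 0"
  proof cases
    case minimal
    then show ?thesis by (rule next_letter[OF ws])
  next
    case three
    then show ?thesis using vanish_next_letter_3 ws by simp
  next
    case five
    then have "K = UNIV" using CARD_5[where 'a = 'i] by (metis card_subset_eq finite subset_UNIV)
    then show ?thesis using vanish_next_letter_UNIV ws five by simp
  next
    case four
    then show ?thesis using vanish_next_letter_4 ws by simp
  qed
  then show "L (word ws (word [K] h)) = 0" by (simp add: word_append)
qed

end

lemma minimal_words_determine:
  assumes eq: "\<alpha> @ \<omega> = flag_weight d s t" "\<alpha> \<noteq> []" "2 \<le> d" "3 \<le> s"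
    and L: "minimal_weight (flag_weight d s t) (L :: 'i::CARD_5 pol \<Rightarrow> bit)"
    and min: "\<And>ws. map card ws = flag_weight d s t \<Longrightarrow> L (word ws 1) = 0"
    and "map card ws = \<alpha>"
  shows "L (word ws g) = 0"
  using assms(1,2,7)
proof (induction \<omega> arbitrary: \<alpha> ws g)
  case Nil
  have "minimal_weight [] (\<lambda>g. L (word ws g))"
    using L Nil by (intro minimal_weight_word) simp
  from minimal_weight_A_annihilated[OF this] have "A_annihilated 0 (\<lambda>g. L (word ws g))" by simp
  then show ?case
    by (rule A_annihilated_0_eq_0I[where L = "\<lambda>g. L (word ws g)"]) (use min Nil in auto)
next
  case (Cons b \<omega>)
  show ?case
  proof (rule vanish_on_prefix[OF Cons.prems(1,2) eq(3,4)])
    show "minimal_weight (\<alpha> @ b # \<omega>) L" using L Cons.prems(1) by simp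
    show "L (word (ws @ [T]) h) = 0" if "map card ws = \<alpha>" "card T = b" for ws T h
      using that Cons.prems by (intro Cons.IH[of "\<alpha> @ [b]"]) auto
  qed (rule Cons.prems)
qed

subsection \<open>Contraction relations\<close>

text \<open>\<open>\<Psi>\<close> vanishes on the image of the contraction with the linear form that is \<open>1\<close> on the letters
  in \<open>v\<close>.\<close>
definition koszul_rel :: "nat \<Rightarrow> 'i set \<Rightarrow> ('i set \<Rightarrow> bit) \<Rightarrow> bool" where
  "koszul_rel a v \<Psi> \<longleftrightarrow> (\<forall>I. card I = Suc a \<longrightarrow> (\<Sum>i\<in>I \<inter> v. \<Psi> (I - {i})) = 0)"

text \<open>Contraction commutes with the exchange map up to the contraction of the first factor.\<close>
lemma koszul_rel_exchange:
  fixes \<Psi> :: "'i::finite set \<Rightarrow> 'i set \<Rightarrow> bit"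
  assumes rel: "exchange_rel a b \<Psi>" and second: "\<And>A. card A = a \<Longrightarrow> koszul_rel b v (\<Psi> A)"
    and B: "card B = b"
  shows "koszul_rel a v (\<lambda>A. \<Psi> A B)"
  unfolding koszul_rel_def
proof (intro allI impI)
  fix I :: "'i set" assume I: "card I = Suc a"
  let ?f = "\<lambda>x. \<Psi> (I - {x}) B" and ?g = "\<lambda>x y. \<Psi> (I - {x}) (insert x (B - {y}))"
  have contract: "of_bool (x \<in> v) * ?f x = (\<Sum>y\<in>B \<inter> v. ?g x y)" if x: "x \<in> I - B" for x
  proof -
    have "card (insert x B) = Suc b" "card (I - {x}) = a" using x B I by auto
    then have "0 = (\<Sum>y\<in>insert x B \<inter> v. \<Psi> (I - {x}) (insert x B - {y}))"
      using second by (simp add: koszul_rel_def)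
    also have "\<dots> = of_bool (x \<in> v) * ?f x + (\<Sum>y\<in>B \<inter> v. \<Psi> (I - {x}) (insert x B - {y}))"
      using x by (simp add: Int_insert_left)
    also have "(\<Sum>y\<in>B \<inter> v. \<Psi> (I - {x}) (insert x B - {y})) = (\<Sum>y\<in>B \<inter> v. ?g x y)"
      using x by (intro sum.cong refl arg_cong[where f = "\<Psi> (I - {x})"]) auto
    finally show ?thesis by (metis bit_add_eq_0_iff)
  qed
  have exchange: "(\<Sum>x\<in>I - B. ?g x y) = of_bool (y \<in> I) * ?f y" if y: "y \<in> B" for y
  proof -
    have "Suc (card (B - {y})) = b" using y B card_Suc_Diff1[of B y] by simp
    then have "(\<Sum>x\<in>I - (B - {y}). ?g x y) = 0" by (rule exchange_relD[OF rel I])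
    moreover have "I - (B - {y}) = (if y \<in> I then insert y (I - B) else I - B)" using y by auto
    ultimately have "of_bool (y \<in> I) * ?f y + (\<Sum>x\<in>I - B. ?g x y) = 0"
      using y by (auto simp: insert_absorb split: if_splits)
    then show ?thesis by (metis bit_add_eq_0_iff)
  qed
  have "(\<Sum>x\<in>(I - B) \<inter> v. ?f x) = (\<Sum>x\<in>I - B. of_bool (x \<in> v) * ?f x)"
    by (rule sum.mono_neutral_cong_left) auto
  also have "\<dots> = (\<Sum>x\<in>I - B. \<Sum>y\<in>B \<inter> v. ?g x y)" by (rule sum.cong[OF refl contract])
  also have "\<dots> = (\<Sum>y\<in>B \<inter> v. \<Sum>x\<in>I - B. ?g x y)" by (rule sum.swap)
  also have "\<dots> = (\<Sum>y\<in>B \<inter> v. of_bool (y \<in> I) * ?f y)" by (intro sum.cong refl exchange) simp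
  also have "\<dots> = (\<Sum>x\<in>I \<inter> B \<inter> v. ?f x)" by (rule sum.mono_neutral_cong_right) auto
  finally have "(\<Sum>x\<in>(I - B) \<inter> v. ?f x) + (\<Sum>x\<in>I \<inter> B \<inter> v. ?f x) = 0" by simp
  moreover have "I \<inter> v = (I - B) \<inter> v \<union> I \<inter> B \<inter> v" by auto
  ultimately show "(\<Sum>x\<in>I \<inter> v. ?f x) = 0"
    by (simp add: sum.union_disjoint disjoint_iff)
qed

lemma koszul_rel_vanish:
  fixes \<Psi> :: "'i::finite set \<Rightarrow> bit"
  assumes k: "koszul_rel a v \<Psi>" and i: "i \<in> v" and F: "F \<inter> v = {}" "F \<subseteq> A" and A: "card A = a"
    and zero: "\<And>A. card A = a \<Longrightarrow> insert i F \<subseteq> A \<Longrightarrow> \<Psi> A = 0"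
  shows "\<Psi> A = 0"
proof (cases "i \<in> A")
  case True
  then show ?thesis using A F by (intro zero) auto
next
  case False
  then have "0 = (\<Sum>x\<in>insert i A \<inter> v. \<Psi> (insert i A - {x}))"
    using k A by (simp add: koszul_rel_def)
  also have "\<dots> = (\<Sum>x\<in>{i}. \<Psi> (insert i A - {x}))"
    using i F A False by (intro sum.mono_neutral_right) (auto intro!: zero)
  finally show ?thesis using False by simp
qed

lemma koszul_rel_sum:
  "(\<And>x. x \<in> C \<Longrightarrow> koszul_rel a v (\<Psi> x)) \<Longrightarrow> koszul_rel a v (\<lambda>A. \<Sum>x\<in>C. \<Psi> x A)"
  unfolding koszul_rel_def by (auto simp: sum.swap[of _ C])

definition exchange_words :: "nat list \<Rightarrow> ('i set list \<Rightarrow> bit) \<Rightarrow> bool" where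
  "exchange_words \<alpha> \<Theta> \<longleftrightarrow> (\<forall>u w a b. map card u @ a # b # map card w = \<alpha> \<longrightarrow>
     exchange_rel a b (\<lambda>A B. \<Theta> (u @ A # B # w)))"

definition koszul_words :: "nat list \<Rightarrow> 'i set \<Rightarrow> ('i set list \<Rightarrow> bit) \<Rightarrow> bool" where
  "koszul_words \<alpha> v \<Theta> \<longleftrightarrow> (\<forall>u w a. map card u @ a # map card w = \<alpha> \<longrightarrow>
     koszul_rel a v (\<lambda>A. \<Theta> (u @ A # w)))"

lemma exchange_wordsD:
  "exchange_words \<alpha> \<Theta> \<Longrightarrow> map card u @ a # b # map card w = \<alpha> \<Longrightarrow>
   exchange_rel a b (\<lambda>A B. \<Theta> (u @ A # B # w))"
  by (simp add: exchange_words_def)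

lemma koszul_wordsD:
  "koszul_words \<alpha> v \<Theta> \<Longrightarrow> map card u @ a # map card w = \<alpha> \<Longrightarrow> koszul_rel a v (\<lambda>A. \<Theta> (u @ A # w))"
  by (simp add: koszul_words_def)

lemma exchange_words_word:
  assumes "minimal_weight (\<alpha> @ \<omega>) L"
  shows "exchange_words \<alpha> (\<lambda>ws. L (word ws h))"
  unfolding exchange_words_def
proof (intro allI impI)
  fix u w :: "'a set list" and a b assume "map card u @ a # b # map card w = \<alpha>"
  then have "minimal_weight (a # b # map card w @ \<omega>) (\<lambda>g. L (word u g))"
    using assms by (intro minimal_weight_word) auto
  from exchange_rel_word[OF this, of "word w h"]
  show "exchange_rel a b (\<lambda>A B. L (word (u @ A # B # w) h))" by (simp add: word_append)
qed

lemma koszul_wordsI: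
  assumes exch: "exchange_words \<alpha> (\<Theta> :: 'i::finite set list \<Rightarrow> bit)"
    and last: "\<And>u a. map card u @ [a] = \<alpha> \<Longrightarrow> koszul_rel a v (\<lambda>A. \<Theta> (u @ [A]))"
  shows "koszul_words \<alpha> v \<Theta>"
  unfolding koszul_words_def
proof (intro allI impI)
  show "koszul_rel a v (\<lambda>A. \<Theta> (u @ A # w))" if "map card u @ a # map card w = \<alpha>" for u w a
    using that
  proof (induction w arbitrary: u a)
    case Nil
    then show ?case using last by simp
  next
    case (Cons B w)
    show ?case
    proof (rule koszul_rel_exchange[where \<Psi> = "\<lambda>A B. \<Theta> (u @ A # B # w)"])
      show "exchange_rel a (card B) (\<lambda>A B. \<Theta> (u @ A # B # w))"
        using Cons.prems by (intro exchange_wordsD[OF exch]) simp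
      show "koszul_rel (card B) v (\<lambda>B. \<Theta> (u @ A # B # w))" if "card A = a" for A
        using Cons.IH[of "u @ [A]" "card B"] Cons.prems that by simp
    qed simp
  qed
qed

lemma koszul_words_vanish:
  assumes k: "koszul_words \<alpha> v (\<Theta> :: 'i::finite set list \<Rightarrow> bit)" and i: "i \<in> v" and F: "F \<inter> v = {}"
    and zero: "\<And>w. map card w = \<alpha> \<Longrightarrow> \<forall>A\<in>set w. insert i F \<subseteq> A \<Longrightarrow> \<Theta> w = 0"
    and w: "map card w = \<alpha>" "\<forall>A\<in>set w. F \<subseteq> A"
  shows "\<Theta> w = 0"
proof -
  have "\<Theta> (u @ w) = 0"
    if "map card (u @ w) = \<alpha>" "\<forall>A\<in>set u. F \<subseteq> A" "\<forall>A\<in>set w. insert i F \<subseteq> A" for u w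
    using that
  proof (induction u arbitrary: w rule: rev_induct)
    case Nil
    then show ?case by (simp add: zero)
  next
    case (snoc A u)
    have "koszul_rel (card A) v (\<lambda>A. \<Theta> (u @ A # w))"
      using snoc.prems(1) by (intro koszul_wordsD[OF k]) simp
    then have "\<Theta> (u @ A # w) = 0"
    proof (rule koszul_rel_vanish[OF _ i F _ refl])
      show "\<Theta> (u @ B # w) = 0" if "card B = card A" "insert i F \<subseteq> B" for B
        using snoc.IH[of "B # w"] snoc.prems that by simp
    qed (use snoc.prems in simp)
    then show ?case by simp
  qed
  from this[of w "[]"] show ?thesis using w by simp
qed

subsection \<open>Sums over supersets\<close>

lemma sum_supersets_insert:
  fixes f :: "'i::finite set \<Rightarrow> bit"
  assumes "x \<in> \<Omega>"
  shows "(\<Sum>R\<in>{v..\<Omega>}. f (insert x R)) = of_bool (x \<in> v) * (\<Sum>S\<in>{v..\<Omega>}. f S)"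
proof (cases "x \<in> v")
  case True
  then show ?thesis by (auto simp: insert_absorb subset_iff intro!: sum.cong arg_cong[where f = f])
next
  case False
  define T where "T = {R \<in> {v..\<Omega>}. x \<notin> R}"
  have "{v..\<Omega>} = T \<union> insert x ` T"
  proof (intro equalityI subsetI)
    fix R assume R: "R \<in> {v..\<Omega>}"
    show "R \<in> T \<union> insert x ` T"
    proof (cases "x \<in> R")
      case True
      then have "R = insert x (R - {x})" "R - {x} \<in> T"
        using R \<open>x \<notin> v\<close> by (auto simp: T_def)
      then show ?thesis by blast
    qed (use R in \<open>auto simp: T_def\<close>)
  qed (use assms in \<open>auto simp: T_def\<close>)
  moreover have "T \<inter> insert x ` T = {}" "inj_on (insert x) T" by (auto simp: T_def inj_on_def)
  ultimately have "(\<Sum>R\<in>{v..\<Omega>}. f (insert x R)) = (\<Sum>R\<in>T. f (insert x R)) + (\<Sum>R\<in>T. f (insert x R))"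
    by (simp add: sum.union_disjoint sum.reindex)
  then show ?thesis using False by simp
qed

lemma superset_sums_eq_0_imp:
  fixes f :: "'i::finite set \<Rightarrow> bit"
  assumes "\<And>v. v \<noteq> {} \<Longrightarrow> v \<subseteq> \<Omega> \<Longrightarrow> (\<Sum>S\<in>{v..\<Omega>}. f S) = 0" and "S \<noteq> {}" "S \<subseteq> \<Omega>"
  shows "f S = 0"
  using assms(2,3)
proof (induction "card (\<Omega> - S)" arbitrary: S rule: less_induct)
  case less
  have "0 = (\<Sum>S'\<in>{S..\<Omega>}. f S')" using assms(1)[of S] less.prems by simp
  also have "\<dots> = f S + (\<Sum>S'\<in>{S..\<Omega>} - {S}. f S')"
    using less.prems by (intro sum.remove) auto
  also have "(\<Sum>S'\<in>{S..\<Omega>} - {S}. f S') = 0"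
  proof (rule sum.neutral, rule ballI)
    fix S' assume S': "S' \<in> {S..\<Omega>} - {S}"
    then have "card (\<Omega> - S') < card (\<Omega> - S)" by (intro psubset_card_mono) auto
    then show "f S' = 0" using less S' by auto
  qed
  finally show ?case by simp
qed

lemma sum_supersets_of_bool_subset:
  fixes w :: "'i::finite set"
  assumes "v \<subseteq> \<Omega>"
  shows "(\<Sum>S\<in>{v..\<Omega>}. of_bool (S \<subseteq> w) :: bit) = of_bool (v = w \<inter> \<Omega>)"
proof (cases "w \<inter> \<Omega> \<subseteq> v")
  case True
  then have "\<not> S \<subseteq> w" if "S \<in> {v..\<Omega>} - {v}" for S using that by auto
  then have "(\<Sum>S\<in>{v..\<Omega>}. of_bool (S \<subseteq> w) :: bit) = (\<Sum>S\<in>{v}. of_bool (S \<subseteq> w))"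
    using assms by (intro sum.mono_neutral_right ballI) simp_all
  moreover have "v \<subseteq> w \<longleftrightarrow> v = w \<inter> \<Omega>" using True assms by auto
  ultimately show ?thesis by simp
next
  case False
  then obtain x where x: "x \<in> w" "x \<in> \<Omega>" "x \<notin> v" by auto
  have "(\<Sum>S\<in>{v..\<Omega>}. of_bool (S \<subseteq> w) :: bit) = (\<Sum>S\<in>{v..\<Omega>}. of_bool (insert x S \<subseteq> w))"
    using x by (intro sum.cong) auto
  also have "\<dots> = 0" using sum_supersets_insert[OF x(2), of "\<lambda>S. of_bool (S \<subseteq> w)" v] x by simp
  finally show ?thesis using False by auto
qed

subsection \<open>Star words\<close>

definition star :: "'i set \<Rightarrow> 'i list \<Rightarrow> 'i set list" where
  "star F us = map (\<lambda>a. insert a F) us"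

lemma star_Cons: "star F (a # us) = insert a F # star F us"
  by (simp add: star_def)

lemma length_star [simp]: "length (star F us) = length us"
  by (simp add: star_def)

lemma map_card_star:
  "finite F \<Longrightarrow> set us \<inter> F = {} \<Longrightarrow> map card (star F us) = replicate (length us) (Suc (card F))"
  by (induction us) (auto simp: star_def)

lemma last_star: "us \<noteq> [] \<Longrightarrow> last (star F us) = insert (last us) F"
  by (simp add: star_def last_map)

lemma star_word_cong:
  fixes F :: "'i::finite set"
  assumes L: "minimal_weight (replicate (length us) (Suc (card F)) @ \<omega>) L"
    and "set us = set us'" "length us = length us'" "set us \<inter> F = {}"
  shows "L (word (star F us) h) = L (word (star F us') h)"
  using assms
  by (intro clique_word_cong[OF clique_insert_singletons[of F]]) (auto simp: star_def)

lemma eq_starI: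
  assumes "map card ws = replicate n (Suc (card F))" "\<forall>A\<in>set ws. F \<subseteq> A"
  obtains us where "ws = star F us" "length us = n" "set us \<inter> F = {}"
proof -
  have "\<exists>us. ws = star F us \<and> length us = n \<and> set us \<inter> F = {}"
    using assms
  proof (induction ws arbitrary: n)
    case (Cons A ws)
    then obtain n' where n: "n = Suc n'" by (cases n) auto
    with Cons obtain us where us: "ws = star F us" "length us = n'" "set us \<inter> F = {}" by fastforce
    have A: "card A = Suc (card F)" "F \<subseteq> A" using Cons.prems n by auto
    then have "finite F" by (metis card_eq_0_iff finite_subset nat.distinct(1))
    then have "card (A - F) = 1" using A by (simp add: card_Diff_subset)
    then obtain a where "A - F = {a}" by (rule card_1_singletonE)
    then have "A = insert a F" "a \<notin> F" using A(2) by auto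
    then show ?case using us n by (intro exI[of _ "a # us"]) (auto simp: star_Cons)
  qed (auto simp: star_def)
  then show ?thesis using that by blast
qed

text \<open>The passage to \<open>listing\<close> makes the word a function of its set of letters.\<close>
lemma star_word_listing:
  fixes F :: "'i::finite set"
  assumes L: "minimal_weight (replicate (length us) (Suc (card F)) @ \<omega>) L"
    and us: "set us \<inter> F = {}" "us \<noteq> []"
  shows "L (word (star F us) h) = L (word (star F (listing (length us) (set us))) h)"
proof -
  have "set (listing (length us) (set us)) = set us" "length (listing (length us) (set us)) = length us"
    using listing[of "set us" "length us"] us(2) by (auto simp: card_length)
  then show ?thesis using us by (intro star_word_cong[OF L]) auto
qed

subsection \<open>Separating the line of a flag\<close>

definition line_poly :: "nat \<Rightarrow> 'i::finite set \<Rightarrow> 'i pol" where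
  "line_poly t v = (\<Sum>S\<in>{v..<UNIV}. word (star {} (listing t S)) 1)"

definition line_value :: "nat \<Rightarrow> ('i pol \<Rightarrow> bit) \<Rightarrow> 'i set \<Rightarrow> 'i set \<Rightarrow> bit" where
  "line_value t L J S = (if S = UNIV then 0 else L (word (J # star {} (listing t S)) 1))"

definition line_defect :: "nat \<Rightarrow> ('i pol \<Rightarrow> bit) \<Rightarrow> 'i set \<Rightarrow> 'i \<Rightarrow> bit" where
  "line_defect t L I m = (\<Sum>i\<in>I. line_value t L (I - {i}) (insert i (- {m})))"

definition missing :: "'i set \<Rightarrow> 'i" where
  "missing J = (SOME m. m \<notin> J)"

lemma missing_notin: "J \<noteq> UNIV \<Longrightarrow> missing J \<notin> J"
  unfolding missing_def by (rule someI_ex) auto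

text \<open>The word on all letters is left out of \<open>line_poly\<close>, because it need not exist. The relations
  force its value to be that of \<open>line_poly t {m}\<close> for any \<open>m\<close> outside the preceding letter \<open>J\<close>.\<close>
definition line_tail :: "nat \<Rightarrow> 'i::finite set \<Rightarrow> 'i set \<Rightarrow> 'i pol" where
  "line_tail t J v = line_poly t v + line_poly t {missing J}"

context
  fixes t :: nat and L :: "'i::CARD_5 pol \<Rightarrow> bit"
  assumes t: "4 \<le> t" and L: "minimal_weight (2 # replicate t 1) L"
begin

lemma sum_line_value: "(\<Sum>S\<in>{v..UNIV}. line_value t L J S) = L (word [J] (line_poly t v))"
proof -
  have "L (word [J] (line_poly t v)) = (\<Sum>S\<in>{v..<UNIV}. L (word [J] (word (star {} (listing t S)) 1)))"
    unfolding line_poly_def by (rule additive.sum[OF additive_word[OF minimal_weight_additive[OF L]]])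
  also have "\<dots> = (\<Sum>S\<in>{v..UNIV}. line_value t L J S)"
    by (rule sum.mono_neutral_cong_left) (auto simp: line_value_def)
  finally show ?thesis by simp
qed

lemma line_value_insert:
  assumes "card J = 2" "R \<noteq> {}" "card R \<le> 3"
  shows "L (word (J # {x} # star {} (listing (t - 1) R)) 1) = line_value t L J (insert x R)"
proof -
  let ?us = "x # listing (t - 1) R"
  have us: "set ?us = insert x R" "length ?us = t"
    using listing[of R "t - 1"] assms t by auto
  have "card (insert x R) \<le> 4" using assms(3) by (simp add: card_insert_if)
  then have "insert x R \<noteq> UNIV" using CARD_5[where 'a = 'i] by auto
  moreover have "minimal_weight (replicate (length ?us) (Suc (card ({} :: 'i set))) @ []) (\<lambda>g. L (word [J] g))"
    using minimal_weight_tl[OF L assms(1)] us(2) by simp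
  from star_word_listing[OF this, of 1]
  have "L (word [J] (word (star {} ?us) 1)) = L (word [J] (word (star {} (listing t (insert x R))) 1))"
    unfolding us by simp
  ultimately show ?thesis by (simp add: line_value_def star_Cons)
qed

lemma sum_line_value_exchange:
  assumes I: "card I = 3" and R: "R \<noteq> {}" "card R \<le> 3"
  shows "(\<Sum>i\<in>I. line_value t L (I - {i}) (insert i R)) = 0"
proof -
  have "minimal_weight (2 # 1 # replicate (t - 1) 1) L" using L t by (cases t) auto
  from exchange_relD[OF exchange_rel_word[OF this], of I "{}" "word (star {} (listing (t - 1) R)) 1"] I
  have "(\<Sum>i\<in>I. L (word ((I - {i}) # {i} # star {} (listing (t - 1) R)) 1)) = 0" by simp
  moreover have "(\<Sum>i\<in>I. L (word ((I - {i}) # {i} # star {} (listing (t - 1) R)) 1))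
      = (\<Sum>i\<in>I. line_value t L (I - {i}) (insert i R))"
    using I R by (intro sum.cong refl line_value_insert) auto
  ultimately show ?thesis by simp
qed

lemma sum_line_poly_eq_sum_defect:
  assumes I: "card I = 3" and v: "v \<noteq> {}"
  shows "(\<Sum>i\<in>I \<inter> v. L (word [I - {i}] (line_poly t v))) = (\<Sum>m\<in>- v. line_defect t L I m)"
proof -
  let ?E = "\<lambda>R. \<Sum>i\<in>I. line_value t L (I - {i}) (insert i R)"
  have "(\<Sum>i\<in>I \<inter> v. L (word [I - {i}] (line_poly t v)))
      = (\<Sum>i\<in>I. of_bool (i \<in> v) * L (word [I - {i}] (line_poly t v)))"
    by (rule sum.mono_neutral_cong_left) auto
  also have "\<dots> = (\<Sum>i\<in>I. \<Sum>R\<in>{v..UNIV}. line_value t L (I - {i}) (insert i R))"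
    by (intro sum.cong refl) (simp only: sum_supersets_insert[OF UNIV_I] sum_line_value)
  also have "\<dots> = (\<Sum>R\<in>{v..UNIV}. ?E R)" by (rule sum.swap)
  also have "\<dots> = (\<Sum>R\<in>(\<lambda>m. - {m}) ` (- v). ?E R)"
  proof (rule sum.mono_neutral_right)
    show "\<forall>R\<in>{v..UNIV} - (\<lambda>m. - {m}) ` (- v). ?E R = 0"
    proof
      fix R assume R: "R \<in> {v..UNIV} - (\<lambda>m. - {m}) ` (- v)"
      have "card R \<noteq> 4"
      proof
        assume "card R = 4"
        then obtain m where "R = - {m}" by (rule card_4_eq_Compl)
        then show False using R by auto
      qed
      moreover have "R = UNIV" if "card R = 5"
        using that CARD_5[where 'a = 'i] by (metis card_subset_eq finite subset_UNIV)
      moreover have "card R \<le> 5" using card_mono[of UNIV R] by (simp add: CARD_5)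
      ultimately consider (small) "card R \<le> 3" | (all) "R = UNIV" by linarith
      then show "?E R = 0"
      proof cases
        case small
        then show ?thesis using R v by (intro sum_line_value_exchange[OF I]) auto
      qed (simp add: line_value_def)
    qed
  qed auto
  also have "\<dots> = (\<Sum>m\<in>- v. line_defect t L I m)"
    by (subst sum.reindex) (auto simp: inj_on_def line_defect_def)
  finally show ?thesis .
qed

lemma sum_line_defect:
  assumes I: "card I = 3"
  shows "(\<Sum>m\<in>I. line_defect t L I m) = 0"
proof -
  have "card (- I) = 2" using I by (simp add: card_Compl_finite CARD_5)
  then have "- I \<noteq> {}" by auto
  then show ?thesis using sum_line_poly_eq_sum_defect[OF I, of "- I"] by simp
qed

lemma line_defect_outside:
  assumes I: "card I = 3" and m: "m \<notin> I"
  shows "line_defect t L I m = 0"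
proof -
  have "card (- I - {m}) = 1" using I m by (simp add: card_Compl_finite CARD_5)
  then have "- I - {m} \<noteq> {}" by (metis card.empty zero_neq_one)
  moreover have "I \<inter> (- I - {m}) = {}" "- (- I - {m}) = insert m I" by auto
  ultimately have "line_defect t L I m + (\<Sum>m\<in>I. line_defect t L I m) = 0"
    using sum_line_poly_eq_sum_defect[OF I, of "- I - {m}"] m by simp
  then show ?thesis by (simp add: sum_line_defect[OF I])
qed

lemma sum_line_poly_eq_sum_defect_Int:
  assumes I: "card I = 3" and v: "v \<noteq> {}"
  shows "(\<Sum>i\<in>I \<inter> v. L (word [I - {i}] (line_poly t v))) = (\<Sum>m\<in>I \<inter> v. line_defect t L I m)"
proof -
  have "(\<Sum>m\<in>- v. line_defect t L I m) = (\<Sum>m\<in>I - v. line_defect t L I m)"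
    by (rule sum.mono_neutral_right) (auto intro: line_defect_outside[OF I])
  moreover have "(\<Sum>m\<in>I \<inter> v. line_defect t L I m) + (\<Sum>m\<in>I - v. line_defect t L I m) = 0"
    using sum_line_defect[OF I] sum.Int_Diff[of I "line_defect t L I" v] by simp
  ultimately show ?thesis
    unfolding sum_line_poly_eq_sum_defect[OF assms] by (metis bit_add_eq_0_iff)
qed

lemma line_poly_eq_defect:
  assumes J: "card J = 2" and v: "v \<inter> insert m J = {m}" and m: "m \<notin> J"
  shows "L (word [J] (line_poly t v)) = line_defect t L (insert m J) m"
proof -
  have "insert m J \<inter> v = {m}" "v \<noteq> {}" "card (insert m J) = 3" using assms by auto
  then show ?thesis using sum_line_poly_eq_sum_defect_Int[of "insert m J" v] m by simp
qed

lemma line_poly_singleton_eq: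
  assumes J: "card J = 2" and m: "m \<notin> J" "m' \<notin> J"
  shows "L (word [J] (line_poly t {m})) = L (word [J] (line_poly t {m'}))"
proof -
  have "L (word [J] (line_poly t {m})) = L (word [J] (line_poly t {m, m'}))"
    if "m \<notin> J" "m' \<notin> J" for m m'
    using line_poly_eq_defect[OF J, of "{m}" m] line_poly_eq_defect[OF J, of "{m, m'}" m] that
    by (cases "m = m'") auto
  from this[OF m] this[OF m(2,1)] show ?thesis by (simp add: insert_commute)
qed

lemma line_tail_eq:
  assumes J: "card J = 2" and m: "m \<notin> J"
  shows "L (word [J] (line_tail t J v)) = L (word [J] (line_poly t v + line_poly t {m}))"
proof -
  have "J \<noteq> UNIV" using m by auto
  note add = additive.add[OF additive_word[OF minimal_weight_additive[OF L]]]
  have "L (word [J] (line_poly t {missing J})) = L (word [J] (line_poly t {m}))"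
    by (rule line_poly_singleton_eq[OF J missing_notin[OF \<open>J \<noteq> UNIV\<close>] m])
  then show ?thesis by (simp only: line_tail_def add)
qed

lemma koszul_rel_line_tail:
  assumes v: "v \<noteq> {}"
  shows "koszul_rel 2 v (\<lambda>J. L (word [J] (line_tail t J v)))"
  unfolding koszul_rel_def
proof (intro allI impI)
  fix I :: "'i set" assume "card I = Suc 2"
  then have I: "card I = 3" by simp
  note add = additive.add[OF additive_word[OF minimal_weight_additive[OF L]]]
  have "L (word [I - {i}] (line_tail t (I - {i}) v))
      = L (word [I - {i}] (line_poly t v)) + line_defect t L I i" if "i \<in> I" for i
  proof -
    have J: "card (I - {i}) = 2" "i \<notin> I - {i}" "insert i (I - {i}) = I" using I that by auto
    have "L (word [I - {i}] (line_poly t {i})) = line_defect t L I i"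
      using line_poly_eq_defect[OF J(1), of "{i}" i] J(3) by simp
    then show ?thesis using line_tail_eq[OF J(1,2)] by (simp only: add)
  qed
  then have "(\<Sum>i\<in>I \<inter> v. L (word [I - {i}] (line_tail t (I - {i}) v)))
      = (\<Sum>i\<in>I \<inter> v. L (word [I - {i}] (line_poly t v))) + (\<Sum>i\<in>I \<inter> v. line_defect t L I i)"
    by (simp add: sum.distrib)
  then show "(\<Sum>i\<in>I \<inter> v. L (word [I - {i}] (line_tail t (I - {i}) v))) = 0"
    using sum_line_poly_eq_sum_defect_Int[OF I v] by simp
qed

end

subsection \<open>Separating the plane of a flag\<close>

definition line_word :: "nat \<Rightarrow> 'i::finite set list \<Rightarrow> 'i set \<Rightarrow> 'i pol" where
  "line_word t ws v = word ws (line_tail t (last ws) v)"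

definition plane_poly :: "nat \<Rightarrow> nat \<Rightarrow> 'i::finite \<Rightarrow> 'i set \<Rightarrow> 'i set \<Rightarrow> 'i pol" where
  "plane_poly s t i z v = (\<Sum>S\<in>{z..- {i}}. line_word t (star {i} (listing s S)) v)"

lemma line_word_append: "w \<noteq> [] \<Longrightarrow> line_word t (u @ w) v = word u (line_word t w v)"
  by (simp add: line_word_def word_append)

abbreviation plane_weight :: "nat \<Rightarrow> nat \<Rightarrow> nat list" where
  "plane_weight d s \<equiv> replicate d 3 @ replicate s 2"

context
  fixes d s t :: nat and L :: "'i::CARD_5 pol \<Rightarrow> bit"
  assumes s: "4 \<le> s" and t: "4 \<le> t" and L: "minimal_weight (flag_weight d s t) L"
begin

lemma minimal_weight_after_last_two:
  assumes "map card u @ [a] = plane_weight d s"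
  shows "a = 2" and "minimal_weight (2 # replicate t 1) (\<lambda>g. L (word u g))"
proof -
  obtain s' where "s = Suc s'" using s by (cases s) auto
  then have eq: "plane_weight d s = (replicate d 3 @ replicate s' 2) @ [2]"
    by (simp add: replicate_append_same)
  then show "a = 2" using assms by simp
  then have "flag_weight d s t = map card u @ 2 # replicate t 1"
    using assms[symmetric] by (simp add: flag_weight_def)
  then show "minimal_weight (2 # replicate t 1) (\<lambda>g. L (word u g))"
    using L by (intro minimal_weight_word) simp
qed

lemma line_word_eq:
  assumes ws: "map card ws = plane_weight d s" and m: "m \<notin> last ws"
  shows "L (line_word t ws v) = L (word ws (line_poly t v + line_poly t {m}))"
proof -
  have "ws \<noteq> []" using ws s by auto
  then obtain u J where u: "ws = u @ [J]" by (metis rev_exhaust)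
  then have "map card u @ [card J] = plane_weight d s" using ws by simp
  note M = minimal_weight_after_last_two[OF this]
  show ?thesis
    using line_tail_eq[OF t M(2,1), of m] m by (simp add: u line_word_def word_append)
qed

lemma exchange_words_line_word: "exchange_words (plane_weight d s) (\<lambda>ws. L (line_word t ws v))"
  unfolding exchange_words_def
proof (intro allI impI)
  fix u w :: "'i set list" and a b assume weights: "map card u @ a # b # map card w = plane_weight d s"
  have words: "exchange_rel a b (\<lambda>A B. L (word (u @ A # B # w) h))" for h
    using L by (intro exchange_wordsD[OF exchange_words_word weights]) (simp add: flag_weight_def)
  show "exchange_rel a b (\<lambda>A B. L (line_word t (u @ A # B # w) v))"
  proof (cases "w = []")
    case False
    then show ?thesis using words[of "line_tail t (last w) v"] by (simp add: line_word_def)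
  next
    case True
    have "a = 2" "b = 2"
    proof -
      have "plane_weight d s = (replicate d 3 @ replicate (s - 2) 2) @ [2, 2]"
        using s by (intro nth_equalityI) (auto simp: nth_append nth_Cons' less_diff_conv2)
      then show "a = 2" "b = 2" using weights True by simp_all
    qed
    show ?thesis
      unfolding exchange_rel_def
    proof (intro allI impI)
      fix I J :: "'i set" assume I: "card I = Suc a" and J: "Suc (card J) = b"
      have "card (I \<union> J) + length [] < CARD('i)"
        using card_Un_le[of I J] I J \<open>a = 2\<close> \<open>b = 2\<close> by (simp add: CARD_5)
      then obtain m where m: "m \<notin> I \<union> J" by (rule ex_notin)
      have "(\<Sum>i\<in>I - J. L (line_word t (u @ (I - {i}) # insert i J # w) v))
          = (\<Sum>i\<in>I - J. L (word (u @ (I - {i}) # insert i J # w) (line_poly t v + line_poly t {m})))"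
        using m I J True weights by (intro sum.cong refl line_word_eq) auto
      also have "\<dots> = 0" by (rule exchange_relD[OF words I J])
      finally show "(\<Sum>i\<in>I - J. L (line_word t (u @ (I - {i}) # insert i J # w) v)) = 0" .
    qed
  qed
qed

lemma koszul_words_line_word:
  assumes v: "v \<noteq> {}"
  shows "koszul_words (plane_weight d s) v (\<lambda>ws. L (line_word t ws v))"
proof (rule koszul_wordsI[OF exchange_words_line_word])
  fix u :: "'i set list" and a assume "map card u @ [a] = plane_weight d s"
  note M = minimal_weight_after_last_two[OF this]
  show "koszul_rel a v (\<lambda>A. L (line_word t (u @ [A]) v))"
    using koszul_rel_line_tail[OF t M(2) v] M(1) by (simp add: line_word_def word_append)
qed

lemma line_word_star_cong:
  assumes P: "map card P = replicate d 3"
    and us: "set us = set us'" "length us = s" "length us' = s" "i \<notin> set us"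
  shows "L (word P (line_word t (star {i} us) v)) = L (word P (line_word t (star {i} us') v))"
proof -
  have ne: "us \<noteq> []" "us' \<noteq> []" using us(2,3) s by auto
  obtain m where m: "m \<notin> {i, last us, last us'}"
    using ex_notin[of "{}" "[i, last us, last us']"] by (auto simp: CARD_5)
  have eq: "L (word P (line_word t (star {i} us) v))
      = L (word P (word (star {i} us) (line_poly t v + line_poly t {m})))"
    if "us \<noteq> []" "length us = s" "i \<notin> set us" "m \<notin> {i, last us}" for us
  proof -
    have "star {i} us \<noteq> []" using that by (simp add: star_def)
    then show ?thesis
      using line_word_eq[of "P @ star {i} us" m v] P that
      by (auto simp: map_card_star last_star line_word_append word_append)
  qed
  have "minimal_weight (map card P @ replicate s 2 @ replicate t 1) L"
    using L P by (simp add: flag_weight_def)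
  then have "minimal_weight (replicate (length us) (Suc (card {i})) @ replicate t 1) (\<lambda>g. L (word P g))"
    using us(2) by (intro minimal_weight_word) (simp add: numeral_2_eq_2)
  then have "L (word P (word (star {i} us) (line_poly t v + line_poly t {m})))
      = L (word P (word (star {i} us') (line_poly t v + line_poly t {m})))"
    by (rule star_word_cong) (use us in auto)
  moreover have "i \<notin> set us'" using us by simp
  ultimately show ?thesis using eq[OF ne(1)] eq[OF ne(2)] us m by auto
qed

lemma sum_line_word_eq_plane_poly:
  "(\<Sum>S\<in>{z..- {i}}. L (word P (line_word t (star {i} (listing s S)) v))) = L (word P (plane_poly s t i z v))"
  unfolding plane_poly_def
  by (rule additive.sum[OF additive_word[OF minimal_weight_additive[OF L]], symmetric])

lemma line_word_star_insert:
  assumes P: "map card P = replicate d 3" and R: "R \<noteq> {}" "R \<subset> - {i}" and x: "x \<noteq> i"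
  shows "L (word P (line_word t (star {i} (x # listing (s - 1) R)) v))
    = L (word P (line_word t (star {i} (listing s (insert x R))) v))"
proof -
  have "card R \<le> 3" using card_subset_Compl_singleton(2)[of R i] R by auto
  then have "set (listing (s - 1) R) = R" "length (listing (s - 1) R) = s - 1"
    using listing[of R "s - 1"] R s by auto
  moreover have "card (insert x R) \<le> 4" using \<open>card R \<le> 3\<close> by (simp add: card_insert_if)
  then have "set (listing s (insert x R)) = insert x R" "length (listing s (insert x R)) = s"
    using listing[of "insert x R" s] s by auto
  ultimately show ?thesis using R x s by (intro line_word_star_cong[OF P]) auto
qed

lemma sum_line_word_star_exchange:
  assumes P: "map card P @ [3] = replicate d 3" and I: "card I = 4" and R: "R \<noteq> {}" "R \<subset> - {i}"
  shows "(\<Sum>a\<in>I - {i}. L (word (P @ [I - {a}]) (line_word t (star {i} (listing s (insert a R))) v))) = 0"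
proof -
  let ?w = "star {i} (listing (s - 1) R)"
  have "card R \<le> 3" using card_subset_Compl_singleton(2)[of R i] R by auto
  then have listing: "set (listing (s - 1) R) = R" "length (listing (s - 1) R) = s - 1"
    using listing[of R "s - 1"] R s by auto
  then have w: "map card ?w = replicate (s - 1) 2" using R by (subst map_card_star) auto
  have "replicate s (2::nat) = 2 # replicate (s - 1) 2" using s by (cases s) auto
  then have "map card P @ 3 # 2 # map card ?w = plane_weight d s" unfolding w P[symmetric] by simp
  note exchange_wordsD[OF exchange_words_line_word this]
  from exchange_relD[OF this, of I "{i}"] I
  have "0 = (\<Sum>a\<in>I - {i}. L (line_word t (P @ (I - {a}) # {a, i} # ?w) v))" by simp
  also have "\<dots> = (\<Sum>a\<in>I - {i}. L (word (P @ [I - {a}]) (line_word t (star {i} (listing s (insert a R))) v)))"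
  proof (rule sum.cong[OF refl])
    fix a assume a: "a \<in> I - {i}"
    have "L (line_word t (P @ (I - {a}) # {a, i} # ?w) v)
        = L (word (P @ [I - {a}]) (line_word t (star {i} (a # listing (s - 1) R)) v))"
      using line_word_append[of "{a, i} # ?w" t "P @ [I - {a}]" v] by (simp add: star_Cons)
    also have "\<dots> = L (word (P @ [I - {a}]) (line_word t (star {i} (listing s (insert a R))) v))"
      using a I R P by (intro line_word_star_insert) auto
    finally show "L (line_word t (P @ (I - {a}) # {a, i} # ?w) v)
        = L (word (P @ [I - {a}]) (line_word t (star {i} (listing s (insert a R))) v))" .
  qed
  finally show ?thesis ..
qed

definition plane_defect :: "'i \<Rightarrow> 'i set \<Rightarrow> 'i set list \<Rightarrow> 'i set \<Rightarrow> bit" where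
  "plane_defect i v P I =
     (\<Sum>a\<in>I - {i}. L (word (P @ [I - {a}]) (line_word t (star {i} (listing s (- {i}))) v)))"

lemma sum_plane_poly_eq_defect:
  assumes P: "map card P @ [3] = replicate d 3" and I: "card I = 4" and z: "z \<noteq> {}" "i \<notin> z"
  shows "(\<Sum>a\<in>I \<inter> z. L (word (P @ [I - {a}]) (plane_poly s t i z v))) = plane_defect i v P I"
proof -
  let ?f = "\<lambda>a S. L (word (P @ [I - {a}]) (line_word t (star {i} (listing s S)) v))"
  have "(\<Sum>a\<in>I \<inter> z. L (word (P @ [I - {a}]) (plane_poly s t i z v)))
      = (\<Sum>a\<in>I - {i}. of_bool (a \<in> z) * (\<Sum>S\<in>{z..- {i}}. ?f a S))"
    using z(2) unfolding sum_line_word_eq_plane_poly[symmetric]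
    by (intro sum.mono_neutral_cong_left) auto
  also have "\<dots> = (\<Sum>a\<in>I - {i}. \<Sum>R\<in>{z..- {i}}. ?f a (insert a R))"
    by (intro sum.cong refl sum_supersets_insert[symmetric]) simp
  also have "\<dots> = (\<Sum>R\<in>{z..- {i}}. \<Sum>a\<in>I - {i}. ?f a (insert a R))" by (rule sum.swap)
  also have "\<dots> = (\<Sum>R\<in>{- {i}}. \<Sum>a\<in>I - {i}. ?f a (insert a R))"
  proof (rule sum.mono_neutral_right)
    show "\<forall>R\<in>{z..- {i}} - {- {i}}. (\<Sum>a\<in>I - {i}. ?f a (insert a R)) = 0"
      using z by (intro ballI sum_line_word_star_exchange[OF P I]) auto
  qed (use z in auto)
  also have "\<dots> = plane_defect i v P I"
    unfolding plane_defect_def by (auto intro!: sum.cong simp: insert_absorb)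
  finally show ?thesis .
qed

lemma koszul_words_plane_poly:
  assumes "v \<noteq> {}" "z \<noteq> {}"
  shows "koszul_words (replicate d 3) v (\<lambda>P. L (word P (plane_poly s t i z v)))"
  unfolding koszul_words_def sum_line_word_eq_plane_poly[symmetric]
proof (intro allI impI koszul_rel_sum)
  fix u w :: "'i set list" and a S
  assume u: "map card u @ a # map card w = replicate d 3" and "S \<in> {z..- {i}}"
  then have S: "S \<noteq> {}" "S \<subseteq> - {i}" using assms(2) by auto
  let ?w = "star {i} (listing s S)"
  have "card S \<le> s" using card_subset_Compl_singleton(1)[OF S(2)] s by simp
  note listing = listing[OF finite S(1) this]
  then have "map card ?w = replicate s 2" using S by (subst map_card_star) auto
  moreover have "?w \<noteq> []" using listing s by (auto simp: star_def)
  ultimately have w: "map card ?w = replicate s 2" "?w \<noteq> []" .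
  have "map card u @ a # map card (w @ ?w) = plane_weight d s" using u w(1) by simp
  from koszul_wordsD[OF koszul_words_line_word[OF assms(1)] this]
  have "koszul_rel a v (\<lambda>A. L (line_word t ((u @ A # w) @ ?w) v))" by simp
  then show "koszul_rel a v (\<lambda>A. L (word (u @ A # w) (line_word t ?w v)))"
    unfolding line_word_append[OF w(2)] .
qed

text \<open>The sum equals the defect for every \<open>z\<close>; singletons \<open>z\<close> outside \<open>I\<close> give zero, except for
  \<open>I = - {i}\<close>, which is reached by contracting with \<open>v\<close>.\<close>
lemma plane_defect_eq_0:
  assumes P: "map card P @ [3] = replicate d 3" and I: "card I = 4" and i: "i \<in> v"
  shows "plane_defect i v P I = 0"
proof -
  let ?g = "\<lambda>m x. L (word (P @ [- {m} - {x}]) (plane_poly s t i {x} v))"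
  have defect_0: "plane_defect i v P (- {m}) = 0" if "m \<noteq> i" for m
    using sum_plane_poly_eq_defect[OF P, of "- {m}" "{m}" i v] that by simp
  have defect: "?g m x = plane_defect i v P (- {m})" if "m \<noteq> x" "x \<noteq> i" for m x
    using sum_plane_poly_eq_defect[OF P, of "- {m}" "{x}" i v] that by simp
  obtain m where m: "I = - {m}" using card_4_eq_Compl[OF I] .
  show ?thesis
  proof (cases "m = i")
    case False
    then show ?thesis using defect_0 m by simp
  next
    case True
    obtain x where x: "x \<noteq> i" using ex_notin[of "{}" "[i]"] by (auto simp: CARD_5)
    have "koszul_rel 3 v (\<lambda>T. L (word (P @ [T]) (plane_poly s t i {x} v)))"
      by (rule koszul_wordsD[OF koszul_words_plane_poly, where w = "[]"]) (use i P in auto)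
    then have "0 = (\<Sum>y\<in>- {x} \<inter> v. L (word (P @ [- {x} - {y}]) (plane_poly s t i {x} v)))"
      by (simp add: koszul_rel_def)
    also have "\<dots> = (\<Sum>y\<in>- {x} \<inter> v. ?g y x)"
      by (intro sum.cong refl) (simp add: Diff_eq Int_commute)
    also have "\<dots> = (\<Sum>y\<in>{i}. ?g y x)"
    proof (rule sum.mono_neutral_right)
      show "\<forall>y\<in>- {x} \<inter> v - {i}. ?g y x = 0" using defect defect_0 x by auto
    qed (use x i in auto)
    finally show ?thesis using defect[of i x] x m True by simp
  qed
qed

lemma koszul_words_plane_poly_second:
  assumes i: "i \<in> v" and z: "z \<noteq> {}" "i \<notin> z"
  shows "koszul_words (replicate d 3) z (\<lambda>P. L (word P (plane_poly s t i z v)))"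
proof (rule koszul_wordsI)
  show "exchange_words (replicate d 3) (\<lambda>P. L (word P (plane_poly s t i z v)))"
    using L by (intro exchange_words_word) (simp add: flag_weight_def)
  fix u :: "'i set list" and a assume u: "map card u @ [a] = replicate d 3"
  have "a \<in> set (map card u @ [a])" by simp
  then have a: "a = 3" unfolding u by simp
  show "koszul_rel a z (\<lambda>A. L (word (u @ [A]) (plane_poly s t i z v)))"
    unfolding koszul_rel_def a
    using u a sum_plane_poly_eq_defect[of u _ z i v] plane_defect_eq_0[of u _ i v] i z by auto
qed

end

subsection \<open>Flags determine the functional\<close>

definition pivot :: "'a set \<Rightarrow> 'a" where
  "pivot v = (SOME i. i \<in> v)"

lemma pivot_in: "v \<noteq> {} \<Longrightarrow> pivot v \<in> v"
  unfolding pivot_def by (rule someI_ex) auto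

text \<open>With \<open>v\<close>, \<open>z\<close>, \<open>u\<close> read as vectors over the field of two elements, \<open>(v, z, u)\<close> is the normal form
  of the flag \<open>\<langle>v\<rangle> \<subset> \<langle>v, z\<rangle> \<subset> \<langle>v, z, u\<rangle>\<close>.\<close>
definition flags :: "('i set \<times> 'i set \<times> 'i set) set" where
  "flags = {(v, z, u). v \<noteq> {} \<and> z \<noteq> {} \<and> pivot v \<notin> z \<and> u \<noteq> {} \<and> pivot v \<notin> u \<and> pivot z \<notin> u}"

definition flag_poly :: "nat \<Rightarrow> nat \<Rightarrow> nat \<Rightarrow> 'i::finite set \<times> 'i set \<times> 'i set \<Rightarrow> 'i pol" where
  "flag_poly d s t = (\<lambda>(v, z, u). \<Sum>K\<in>{u..- {pivot v, pivot z}}.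
     word (star {pivot v, pivot z} (listing d K)) (plane_poly s t (pivot v) z v))"

context
  fixes d s t :: nat and L :: "'i::CARD_5 pol \<Rightarrow> bit"
  assumes d: "3 \<le> d" and s: "4 \<le> s" and t: "4 \<le> t"
    and L: "minimal_weight (flag_weight d s t) L"
    and flag_poly_0: "\<And>F. F \<in> flags \<Longrightarrow> L (flag_poly d s t F) = 0"
begin

lemma plane_poly_vanish:
  assumes v: "v \<noteq> {}" and z: "z \<noteq> {}" "pivot v \<notin> z" and P: "map card P = replicate d 3"
  shows "L (word P (plane_poly s t (pivot v) z v)) = 0"
proof -
  let ?i = "pivot v" and ?i' = "pivot z" and ?\<Theta> = "\<lambda>P. L (word P (plane_poly s t (pivot v) z v))"
  have i: "?i \<in> v" "?i' \<in> z" using pivot_in[OF v] pivot_in[OF z(1)] .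
  then have card: "card {?i, ?i'} = 2" using z(2) by (auto simp: card_insert_if)
  have listing_0: "?\<Theta> (star {?i, ?i'} (listing d K)) = 0" if "K \<noteq> {}" "K \<subseteq> - {?i, ?i'}" for K
    using _ that
  proof (rule superset_sums_eq_0_imp)
    fix u assume "u \<noteq> {}" "u \<subseteq> - {?i, ?i'}"
    then have "(v, z, u) \<in> flags" using v z by (auto simp: flags_def)
    from flag_poly_0[OF this] show "(\<Sum>K\<in>{u..- {?i, ?i'}}. ?\<Theta> (star {?i, ?i'} (listing d K))) = 0"
      by (simp add: flag_poly_def additive.sum[OF minimal_weight_additive[OF L]])
  qed
  have star: "?\<Theta> w = 0" if w: "map card w = replicate d 3" "\<forall>A\<in>set w. insert ?i' {?i} \<subseteq> A" for w
  proof -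
    obtain ks where ks: "w = star {?i, ?i'} ks" "length ks = d" "set ks \<inter> {?i, ?i'} = {}"
      using eq_starI[of w d "{?i, ?i'}"] w card by auto
    have "minimal_weight (replicate (length ks) (Suc (card {?i, ?i'})) @ replicate s 2 @ replicate t 1) L"
      using L ks(2) by (simp only: card flag_weight_def) simp
    moreover have ne: "ks \<noteq> []" using ks(2) d by auto
    ultimately have "?\<Theta> w = ?\<Theta> (star {?i, ?i'} (listing d (set ks)))"
      using star_word_listing[of ks "{?i, ?i'}"] ks by simp
    then show ?thesis using listing_0[of "set ks"] ks(3) ne by auto
  qed
  have with_i: "?\<Theta> w = 0" if "map card w = replicate d 3" "\<forall>A\<in>set w. insert ?i {} \<subseteq> A" for w
    by (rule koszul_words_vanish[OF koszul_words_plane_poly_second[OF s t L i(1) z] i(2), where F = "{?i}"])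
      (use that z(2) star in auto)
  show ?thesis
    by (rule koszul_words_vanish[OF koszul_words_plane_poly[OF s t L v z(1)] i(1), where F = "{}"])
      (use P with_i in auto)
qed

lemma line_word_vanish:
  assumes v: "v \<noteq> {}" and P: "map card P = replicate d 3" and w: "map card w = replicate s 2"
  shows "L (word P (line_word t w v)) = 0"
proof -
  let ?i = "pivot v" and ?\<Theta> = "\<lambda>w. L (word P (line_word t w v))"
  have koszul: "koszul_words (replicate s 2) v ?\<Theta>"
    unfolding koszul_words_def
  proof (intro allI impI)
    fix u w :: "'i set list" and a assume "map card u @ a # map card w = replicate s 2"
    then have "map card (P @ u) @ a # map card w = plane_weight d s" using P by simp
    from koszul_wordsD[OF koszul_words_line_word[OF s t L v] this]
    show "koszul_rel a v (\<lambda>A. ?\<Theta> (u @ A # w))" by (simp add: line_word_append)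
  qed
  have listing_0: "?\<Theta> (star {?i} (listing s S)) = 0" if "S \<noteq> {}" "S \<subseteq> - {?i}" for S
    using _ that
  proof (rule superset_sums_eq_0_imp)
    fix z assume "z \<noteq> {}" "z \<subseteq> - {?i}"
    then show "(\<Sum>S\<in>{z..- {?i}}. ?\<Theta> (star {?i} (listing s S))) = 0"
      unfolding sum_line_word_eq_plane_poly[OF s t L] by (intro plane_poly_vanish[OF v _ _ P]) auto
  qed
  show ?thesis
  proof (rule koszul_words_vanish[OF koszul pivot_in[OF v] _ _ w])
    fix w assume "map card w = replicate s 2" "\<forall>A\<in>set w. insert ?i {} \<subseteq> A"
    then obtain us where us: "w = star {?i} us" "length us = s" "?i \<notin> set us"
      using eq_starI[of w s "{?i}"] by (auto simp: numeral_2_eq_2)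
    then have ne: "us \<noteq> []" using s by auto
    then have "set (listing s (set us)) = set us" "length (listing s (set us)) = s"
      using listing[of "set us" s] us(2) by (auto simp: card_length)
    then have "?\<Theta> w = ?\<Theta> (star {?i} (listing s (set us)))"
      unfolding us(1) using us by (intro line_word_star_cong[OF s t L P]) auto
    then show "?\<Theta> w = 0" using listing_0[of "set us"] us(3) ne by auto
  qed auto
qed

lemma line_poly_vanish:
  assumes v: "v \<noteq> {}" and ws: "map card ws = plane_weight d s"
  shows "L (word ws (line_poly t v)) = 0"
proof -
  obtain P w where P: "ws = P @ w" "map card P = replicate d 3" and w: "map card w = replicate s 2"
    using ws by (auto simp: map_eq_append_conv)
  have "w \<noteq> []" using w s by auto
  have sum: "L (word ws (line_poly t v)) + L (word ws (line_poly t {missing (last ws)})) = 0"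
    if "v \<noteq> {}" for v
    using line_word_vanish[OF that P(2) w] \<open>w \<noteq> []\<close>
      additive.add[OF additive_word[OF minimal_weight_additive[OF L]], of ws]
    by (simp add: P(1) word_append line_word_def line_tail_def)
  have "line_poly t UNIV = (0 :: 'i pol)" by (simp add: line_poly_def)
  then have "L (word ws (line_poly t {missing (last ws)})) = 0"
    using sum[of UNIV] additive.zero[OF additive_word[OF minimal_weight_additive[OF L]], of ws] by simp
  then show ?thesis using sum[OF v] by simp
qed

lemma singleton_words_vanish:
  assumes ws: "map card ws = plane_weight d s" and rs: "length rs = t" "set rs \<noteq> UNIV"
  shows "L (word ws (word (star {} rs) 1)) = 0"
proof -
  obtain u J where u: "ws = u @ [J]" using ws s by (cases ws rule: rev_cases) auto
  have "map card u @ [card J] = plane_weight d s" using ws u by simp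
  note M = minimal_weight_after_last_two(2)[OF s t L this]
  have "minimal_weight (flag_weight d s t) L" by (rule L)
  then have "minimal_weight (replicate (length rs) (Suc (card ({} :: 'i set))) @ []) (\<lambda>g. L (word ws g))"
    using ws rs by (intro minimal_weight_word) (simp add: flag_weight_def)
  moreover have ne: "rs \<noteq> []" using rs t by auto
  ultimately have "L (word ws (word (star {} rs) 1)) = L (word ws (word (star {} (listing t (set rs))) 1))"
    using rs star_word_listing[of rs "{}" "[]" "\<lambda>g. L (word ws g)" 1] by simp
  also have "\<dots> = line_value t (\<lambda>g. L (word u g)) J (set rs)"
    using rs by (simp add: line_value_def u word_append)
  also have "\<dots> = 0"
  proof (rule superset_sums_eq_0_imp[of UNIV])
    fix v :: "'i set" assume "v \<noteq> {}"
    then show "(\<Sum>S\<in>{v..UNIV}. line_value t (\<lambda>g. L (word u g)) J S) = 0"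
      unfolding sum_line_value[OF t M] using line_poly_vanish[OF _ ws] by (simp add: u word_append)
  qed (use ne in auto)
  finally show ?thesis .
qed

lemma singleton_words_vanish_UNIV:
  assumes ws: "map card ws = plane_weight d s" and rs: "length rs = t" "set rs = UNIV"
  shows "L (word ws (word (star {} rs) 1)) = 0"
proof -
  obtain u J where u: "ws = u @ [J]" using ws s by (cases ws rule: rev_cases) auto
  have uJ: "map card u @ [card J] = plane_weight d s" using ws u by simp
  note M = minimal_weight_after_last_two[OF s t L uJ]
  obtain i where i: "i \<notin> J" using ex_notin[of J "[]"] M(1) by (auto simp: CARD_5)
  have "5 \<le> t" using card_length[of rs] rs by (simp add: CARD_5)
  then have "card (- {i}) \<le> t - 1" by simp
  moreover have "- {i} \<noteq> {}" using card_Compl_singleton[of i] by (metis card.empty zero_neq_numeral)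
  ultimately have listing: "set (listing (t - 1) (- {i})) = - {i}" "length (listing (t - 1) (- {i})) = t - 1"
    using listing[of "- {i}" "t - 1"] by auto
  let ?h = "word (star {} (listing (t - 1) (- {i}))) 1"
  have "minimal_weight (2 # 1 # replicate (t - 1) 1) (\<lambda>g. L (word u g))"
    using M(2) t by (cases t) auto
  note rel = exchange_rel_word[OF this, of ?h]
  have "L (word u (word [J, {i}] ?h)) = 0"
  proof (rule exchange_rel_single[OF rel])
    fix j assume "j \<in> J"
    let ?ws = "u @ [insert i J - {j}]" and ?rs = "j # listing (t - 1) (- {i})"
    have "map card ?ws = plane_weight d s" using uJ i \<open>j \<in> J\<close> by (auto simp: card_insert_if)
    moreover have "set ?rs \<noteq> UNIV" using listing i \<open>j \<in> J\<close> by auto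
    ultimately have "L (word ?ws (word (star {} ?rs) 1)) = 0"
      using listing t by (intro singleton_words_vanish) auto
    then show "L (word u (word [insert i J - {j}, {j}] ?h)) = 0"
      by (simp add: word_append star_Cons)
  qed (use M(1) i in auto)
  then have "L (word ws (word (star {} (i # listing (t - 1) (- {i}))) 1)) = 0"
    by (simp add: u word_append star_Cons)
  moreover have "minimal_weight (replicate (length rs) (Suc (card ({} :: 'i set))) @ []) (\<lambda>g. L (word ws g))"
    using L ws rs by (intro minimal_weight_word) (simp add: flag_weight_def)
  then have "L (word ws (word (star {} rs) 1)) = L (word ws (word (star {} (i # listing (t - 1) (- {i}))) 1))"
    by (rule star_word_cong) (use listing rs t in auto)
  ultimately show ?thesis by simp
qed

lemma minimal_words_vanish:
  assumes "map card ws = flag_weight d s t"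
  shows "L (word ws 1) = 0"
proof -
  have "map card ws = plane_weight d s @ replicate t 1"
    using assms by (simp add: flag_weight_def)
  from this[unfolded map_eq_append_conv] obtain w r where w: "ws = w @ r" "plane_weight d s = map card w"
      and r: "replicate t 1 = map card r" by blast
  obtain rs where "r = star {} rs" "length rs = t" using eq_starI[of r t "{}"] r by auto
  then show ?thesis
    using singleton_words_vanish[OF w(2)[symmetric]] singleton_words_vanish_UNIV[OF w(2)[symmetric]]
    by (cases "set rs = UNIV") (simp_all add: w(1) word_append)
qed

lemma vanish_below_UNIV:
  assumes J: "J \<noteq> UNIV"
  shows "L (X J * g\<^sup>2) = 0"
proof -
  have weight: "flag_weight d s t = 3 # flag_weight (d - 1) s t"
    using d by (cases d) (auto simp: flag_weight_def)
  have "card J < 5" using psubset_card_mono[of UNIV J] J by (simp add: CARD_5 psubset_eq)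
  then consider (small) "card J < 3" | (three) "card J = 3" | (four) "card J = 4" by linarith
  then show ?thesis
  proof cases
    case small
    then show ?thesis using L unfolding weight by (intro minimal_weight_low)
  next
    case three
    have "L (word [J] g) = 0"
    proof (rule minimal_words_determine[OF _ _ _ _ L minimal_words_vanish])
      show "[3] @ flag_weight (d - 1) s t = flag_weight d s t" by (simp add: weight)
    qed (use three d s in auto)
    then show ?thesis by simp
  next
    case four
    have "A_annihilated (weight_degree (flag_weight d s t)) L"
      by (rule minimal_weight_A_annihilated[OF L])
    then show ?thesis using four by (intro A_annihilated_parity) (auto simp: weight)
  qed
qed

end

subsection \<open>Functionals attached to flags\<close>

lemma even_choose_odd:
  fixes m c :: nat
  assumes "even m" "odd c"
  shows "even (m choose c)"
proof (cases m)
  case 0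
  then show ?thesis using assms(2) by (cases c) auto
next
  case (Suc m')
  obtain c' where c': "c = Suc c'" using assms(2) by (cases c) auto
  have "even (Suc m' * (m' choose c'))" using assms(1) Suc by simp
  then have "even (Suc c' * (Suc m' choose Suc c'))" unfolding Suc_times_binomial .
  then show ?thesis using assms(2) unfolding c' Suc even_mult_iff by blast
qed

lemma even_choose_double: "even (2 * m choose 2 * c) = even (m choose c)"
proof (induction m arbitrary: c)
  case 0
  then show ?case by (cases c) auto
next
  case (Suc m)
  show ?case
  proof (cases c)
    case (Suc c')
    have "2 * Suc m choose 2 * c
        = (2 * m choose 2 * c') + 2 * (2 * m choose Suc (2 * c')) + (2 * m choose 2 * c)"
      using Suc by simp
    moreover have "Suc m choose c = (m choose c') + (m choose c)" using Suc by simp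
    ultimately show ?thesis by (simp only: even_add Suc.IH) simp
  qed simp
qed

lemma even_Suc_double_choose_double: "even (Suc (2 * m) choose 2 * c) = even (m choose c)"
proof (cases c)
  case (Suc c')
  then have "Suc (2 * m) choose (2 * c) = (2 * m choose Suc (2 * c')) + (2 * m choose 2 * c)" by simp
  then show ?thesis using even_choose_odd[of "2 * m" "Suc (2 * c')"] by (simp add: even_choose_double)
qed simp

lemma odd_choose_complement:
  assumes "m + c + 1 = 2 ^ a" "odd (m choose c)"
  shows "c = 0"
  using assms
proof (induction a arbitrary: m c)
  case (Suc a)
  have "odd (m + c)" using Suc.prems(1) by (metis even_Suc even_power Suc_eq_plus1 dvd_refl zero_less_Suc)
  show ?case
  proof (cases "odd m")
    case False
    then show ?thesis using \<open>odd (m + c)\<close> even_choose_odd[of m c] Suc.prems(2) by simp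
  next
    case True
    then obtain m' where m: "m = Suc (2 * m')" by (auto elim: oddE)
    obtain c' where c: "c = 2 * c'" using True \<open>odd (m + c)\<close> by (auto elim: evenE)
    have "odd (m' choose c')" using Suc.prems(2) unfolding m c even_Suc_double_choose_double .
    then have "c' = 0" using Suc.prems(1) m c by (intro Suc.IH[of m' c']) auto
    then show ?thesis using c by simp
  qed
qed simp

definition spike :: "('j \<Rightarrow> nat) \<Rightarrow> 'j \<Rightarrow> nat" where
  "spike e = (\<lambda>i. 2 ^ e i - 1)"

definition ind :: "'j set \<Rightarrow> 'j \<Rightarrow> nat" where
  "ind P = (\<lambda>i. of_bool (i \<in> P))"

lemma lookup_St_spike: "lookup (St q) (spike e) = lookup q (spike e)"
proof (rule additive_pol_eqI[where p = q])
  fix f :: "'a \<Rightarrow> nat"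
  have "f i = spike e i" if le: "f i \<le> spike e i" and odd: "odd (f i choose (spike e i - f i))" for i
  proof -
    have "f i + (spike e i - f i) + 1 = 2 ^ e i" using le one_le_power[of "2::nat" "e i"] unfolding spike_def by linarith
    then show ?thesis using odd_choose_complement odd le by fastforce
  qed
  then have "(\<forall>i. f i \<le> spike e i \<and> odd (f i choose (spike e i - f i))) \<longleftrightarrow> f = spike e"
    by (auto simp: fun_eq_iff)
  then show "lookup (St (mon f)) (spike e) = lookup (mon f) (spike e)"
    by (simp add: lookup_St_mon lookup_single when_def)
qed (auto intro!: additive.intro simp: St_add lookup_add)

lemma two_power_minus_1: "of_bool (0 < n) + 2 * (2 ^ (n - 1) - 1) = (2::nat) ^ n - 1"
proof (cases n)
  case (Suc k)
  then show ?thesis by (cases "2 ^ k :: nat") auto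
qed simp

lemma add_double_eq_spike_iff:
  assumes "deg f = card {i. 0 < e i}"
  shows "(\<lambda>i. f i + 2 * h i) = spike e \<longleftrightarrow> f = ind {i. 0 < e i} \<and> h = spike (\<lambda>i. e i - 1)"
proof
  let ?P = "{i. 0 < e i}"
  assume "(\<lambda>i. f i + 2 * h i) = spike e"
  then have sp: "f i + 2 * h i = of_bool (0 < e i) + 2 * (2 ^ (e i - 1) - 1)" for i
    unfolding two_power_minus_1 by (auto simp: spike_def fun_eq_iff)
  have "ind ?P i \<le> f i" for i
  proof (cases "0 < e i")
    case True
    then have "odd (f i + 2 * h i)" unfolding sp by simp
    then have "0 < f i" by (auto intro: odd_pos)
    then show ?thesis by (simp add: ind_def)
  qed (simp add: ind_def)
  then have f: "f = ind ?P"
    using deg_strict_mono[of "ind ?P" f] deg_of_bool[of ?P] assms by (fastforce simp: ind_def)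
  have "h i = 2 ^ (e i - 1) - 1" for i using sp[of i] by (simp add: f ind_def)
  then show "f = ind ?P \<and> h = spike (\<lambda>i. e i - 1)" using f by (simp add: spike_def fun_eq_iff)
next
  assume "f = ind {i. 0 < e i} \<and> h = spike (\<lambda>i. e i - 1)"
  then show "(\<lambda>i. f i + 2 * h i) = spike e"
    using two_power_minus_1 by (auto simp: ind_def spike_def)
qed

lemma lookup_mult_square_spike:
  assumes "homogeneous (card {i. 0 < e i}) p"
  shows "lookup (p * q\<^sup>2) (spike e) = lookup p (ind {i. 0 < e i}) * lookup q (spike (\<lambda>i. e i - 1))"
proof -
  let ?P = "{i. 0 < e i}"
  have mon: "lookup (mon f * q\<^sup>2) (spike e) = lookup (mon f) (ind ?P) * lookup q (spike (\<lambda>i. e i - 1))"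
    if "deg f = card ?P" for f
  proof (rule additive_pol_eqI[where p = q])
    fix h :: "'a \<Rightarrow> nat"
    have "mon f * (mon h)\<^sup>2 = mon (\<lambda>i. f i + 2 * h i)"
      by (auto simp: mon_square mon_mult fun_eq_iff intro!: arg_cong[where f = mon])
    then show "lookup (mon f * (mon h)\<^sup>2) (spike e) = lookup (mon f) (ind ?P) * lookup (mon h) (spike (\<lambda>i. e i - 1))"
      using add_double_eq_spike_iff[OF that, of h] by (auto simp: lookup_single when_def)
  qed (auto intro!: additive.intro simp: pol_square_add distrib_left lookup_add)
  have "lookup (p * q\<^sup>2) (spike e) = (\<Sum>f\<in>keys p. lookup (mon f * q\<^sup>2) (spike e))"
    by (subst (1) sum_mon_keys[of p, symmetric]) (simp add: sum_distrib_right lookup_sum)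
  also have "\<dots> = (\<Sum>f\<in>keys p. lookup (mon f) (ind ?P)) * lookup q (spike (\<lambda>i. e i - 1))"
    using assms mon by (simp add: homogeneous_def sum_distrib_right)
  also have "(\<Sum>f\<in>keys p. lookup (mon f) (ind ?P)) = lookup p (ind ?P)"
    by (simp add: sum_mon_keys flip: lookup_sum)
  finally show ?thesis .
qed

lemma lookup_var_mult_ind: "lookup (X {c} * p) (ind P) = of_bool (c \<in> P) * lookup p (ind (P - {c}))"
proof (rule additive_pol_eqI[where p = p])
  fix f
  have "(\<lambda>i. of_bool (i = c)) + f = ind P \<longleftrightarrow> c \<in> P \<and> f = ind (P - {c})"
  proof
    assume "(\<lambda>i. of_bool (i = c)) + f = ind P"
    then have eq: "of_bool (i = c) + f i = of_bool (i \<in> P)" for i by (auto simp: ind_def fun_eq_iff)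
    have "c \<in> P" using eq[of c] by (cases "c \<in> P") auto
    moreover have "f i = ind (P - {c}) i" for i
      using eq[of i] \<open>c \<in> P\<close> by (cases "i = c") (auto simp: ind_def)
    ultimately show "c \<in> P \<and> f = ind (P - {c})" by auto
  qed (auto simp: ind_def fun_eq_iff)
  then show "lookup (X {c} * mon f) (ind P) = of_bool (c \<in> P) * lookup (mon f) (ind (P - {c}))"
    by (auto simp: X_def mon_mult lookup_single when_def)
qed (auto intro!: additive.intro simp: distrib_left lookup_add)

definition linear_form :: "('j::finite \<Rightarrow> 'i set) \<Rightarrow> 'i \<Rightarrow> 'j pol" where
  "linear_form V i = (\<Sum>c | i \<in> V c. X {c})"

definition spike_functional :: "('j::finite \<Rightarrow> 'i::finite set) \<Rightarrow> ('j \<Rightarrow> nat) \<Rightarrow> 'i pol \<Rightarrow> bit" where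
  "spike_functional V e p = lookup (subst (linear_form V) p) (spike e)"

lemma St_linear_form: "St (linear_form V i) = linear_form V i + (linear_form V i)\<^sup>2"
  by (simp add: linear_form_def additive.sum[OF additive_St] St_var pol_square_sum sum.distrib)

lemma homogeneous_linear_form: "homogeneous 1 (linear_form V i)"
  unfolding linear_form_def by (intro homogeneous_sum homogeneous_var)

lemma A_annihilated_spike_functional:
  "A_annihilated (deg (spike e)) (spike_functional (V :: 'j::finite \<Rightarrow> 'i::finite set) e)"
  unfolding A_annihilated_def
proof (intro conjI allI impI)
  show "additive (spike_functional V e)"
    by standard (simp add: spike_functional_def subst_add lookup_add)
  fix f
  have "subst (linear_form V) (St f) = St (subst (linear_form V) f)"
    unfolding St_def subst_subst unfolding St_def[symmetric] St_linear_form
    by (simp add: subst_add subst_power subst_var)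
  then show "spike_functional V e (St f) = spike_functional V e f"
    by (simp add: spike_functional_def lookup_St_spike)
next
  fix f :: "'i \<Rightarrow> nat" assume f: "deg f \<noteq> deg (spike e)"
  have "homogeneous (\<Sum>i\<in>UNIV. f i * 1) (subst (linear_form V) (mon f))"
    unfolding subst_mon by (intro homogeneous_prod homogeneous_power homogeneous_linear_form)
  then have "spike e \<notin> keys (subst (linear_form V) (mon f))"
    using f by (auto simp: homogeneous_def deg_def)
  then show "spike_functional V e (mon f) = 0" by (simp add: spike_functional_def in_keys_iff)
qed

lemma spike_functional_0_1: "spike_functional V (\<lambda>c. 0) 1 = 1"
  by (simp add: spike_functional_def subst_1 spike_def lookup_one zero_fun_def)

text \<open>The permanent modulo \<open>2\<close> of the incidence matrix of \<open>V\<close> with rows \<open>P\<close> and columns \<open>T\<close>.\<close>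
definition minor :: "('j::finite \<Rightarrow> 'i set) \<Rightarrow> 'j set \<Rightarrow> 'i set \<Rightarrow> bit" where
  "minor V P T = lookup (\<Prod>i\<in>T. linear_form V i) (ind P)"

lemma minor_empty: "minor V P {} = of_bool (P = {})"
  by (auto simp: minor_def lookup_one when_def ind_def fun_eq_iff zero_fun_def)

lemma minor_insert:
  assumes "finite T" "i \<notin> T"
  shows "minor V P (insert i T) = (\<Sum>c\<in>P. of_bool (i \<in> V c) * minor V (P - {c}) T)"
proof -
  have "minor V P (insert i T) = (\<Sum>c | i \<in> V c. of_bool (c \<in> P) * minor V (P - {c}) T)"
    using assms
    by (simp add: minor_def linear_form_def sum_distrib_right lookup_sum lookup_var_mult_ind)
  also have "\<dots> = (\<Sum>c\<in>{c. i \<in> V c} \<inter> P. minor V (P - {c}) T)"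
    by (rule sum.mono_neutral_cong_right) auto
  also have "\<dots> = (\<Sum>c\<in>P. of_bool (i \<in> V c) * minor V (P - {c}) T)"
    by (rule sum.mono_neutral_cong_left) auto
  finally show ?thesis .
qed

lemma spike_functional_X_square:
  assumes "card T = card {i. 0 < e i}"
  shows "spike_functional V e (X T * g\<^sup>2) = minor V {i. 0 < e i} T * spike_functional V (\<lambda>i. e i - 1) g"
proof -
  have "homogeneous (\<Sum>i\<in>T. 1) (\<Prod>i\<in>T. linear_form V i)"
    by (intro homogeneous_prod homogeneous_linear_form)
  then have "homogeneous (card {i. 0 < e i}) (\<Prod>i\<in>T. linear_form V i)" using assms by simp
  then show ?thesis
    by (simp add: spike_functional_def minor_def subst_mult subst_power subst_X lookup_mult_square_spike)
qed

lemma spike_functional_word: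
  assumes "map card ws = replicate (length ws) (card P)"
    and "\<And>i. i \<in> P \<Longrightarrow> length ws \<le> e i" "\<And>i. i \<notin> P \<Longrightarrow> e i = 0"
  shows "spike_functional V e (word ws g)
    = prod_list (map (minor V P) ws) * spike_functional V (\<lambda>i. e i - length ws) g"
  using assms
proof (induction ws arbitrary: e)
  case (Cons T ws)
  have P: "{i. 0 < e i} = P" using Cons.prems(2,3) by fastforce
  have "spike_functional V e (word (T # ws) g)
      = minor V P T * spike_functional V (\<lambda>i. e i - 1) (word ws g)"
    using spike_functional_X_square[of T e V "word ws g"] Cons.prems(1) P by simp
  also have "spike_functional V (\<lambda>i. e i - 1) (word ws g)
      = prod_list (map (minor V P) ws) * spike_functional V (\<lambda>i. e i - 1 - length ws) g"
    using Cons.prems by (intro Cons.IH) (auto, fastforce)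
  finally show ?case by (simp add: mult.assoc)
qed simp

lemma prod_list_of_bool: "prod_list (map (\<lambda>x. of_bool (Q x)) xs) = (of_bool (\<forall>x\<in>set xs. Q x) :: bit)"
  by (induction xs) auto

lemma prod_list_minor_star:
  assumes "\<And>a. a \<in> set us \<Longrightarrow> minor V P (insert a F) = of_bool (a \<in> W)"
  shows "prod_list (map (minor V P) (star F us)) = of_bool (set us \<subseteq> W)"
proof -
  have "map (minor V P) (star F us) = map (\<lambda>a. of_bool (a \<in> W)) us"
    using assms by (simp add: star_def)
  then show ?thesis by (auto simp: prod_list_of_bool)
qed

context
  fixes c\<^sub>0 c\<^sub>1 c\<^sub>2 :: "'j::finite" and V :: "'j \<Rightarrow> 'i::CARD_5 set"
  assumes c: "distinct [c\<^sub>0, c\<^sub>1, c\<^sub>2]"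
begin

definition flag_exponents :: "nat \<Rightarrow> nat \<Rightarrow> nat \<Rightarrow> 'j \<Rightarrow> nat" where
  "flag_exponents a b k c = (if c = c\<^sub>0 then a else if c = c\<^sub>1 then b else if c = c\<^sub>2 then k else 0)"

lemma flag_indices_ne: "c\<^sub>0 \<noteq> c\<^sub>1" "c\<^sub>0 \<noteq> c\<^sub>2" "c\<^sub>1 \<noteq> c\<^sub>0" "c\<^sub>1 \<noteq> c\<^sub>2" "c\<^sub>2 \<noteq> c\<^sub>0" "c\<^sub>2 \<noteq> c\<^sub>1"
  using c by auto

lemma minor_1: "minor V {c\<^sub>0} {a} = of_bool (a \<in> V c\<^sub>0)"
  by (simp add: minor_insert minor_empty)

lemma minor_2:
  "a \<noteq> b \<Longrightarrow> minor V {c\<^sub>0, c\<^sub>1} {a, b} = of_bool (a \<in> V c\<^sub>0 \<and> b \<in> V c\<^sub>1) + of_bool (a \<in> V c\<^sub>1 \<and> b \<in> V c\<^sub>0)"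
  by (simp add: minor_insert minor_empty insert_Diff_if flag_indices_ne of_bool_conj)

lemma minor_3:
  assumes "a \<noteq> b" "k \<notin> {a, b}"
    and "a \<in> V c\<^sub>0" "a \<notin> V c\<^sub>1" "a \<notin> V c\<^sub>2" "b \<in> V c\<^sub>1" "b \<notin> V c\<^sub>2"
  shows "minor V {c\<^sub>0, c\<^sub>1, c\<^sub>2} {k, a, b} = of_bool (k \<in> V c\<^sub>2)"
proof -
  have "minor V {c\<^sub>0, c\<^sub>1, c\<^sub>2} {a, b, k} = of_bool (k \<in> V c\<^sub>2)"
    using assms by (auto simp add: minor_insert minor_empty insert_Diff_if flag_indices_ne)
  then show ?thesis by (simp add: insert_commute)
qed

lemma additive_spike_functional: "additive (spike_functional V e)"
  by (rule A_annihilatedD(1)[OF A_annihilated_spike_functional])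

lemma spike_functional_line_poly:
  assumes t: "4 \<le> t" and w: "w \<noteq> {}"
  shows "spike_functional V (flag_exponents t 0 0) (line_poly t w)
    = of_bool (w = V c\<^sub>0) + of_bool (V c\<^sub>0 = UNIV)"
proof -
  let ?E = "flag_exponents t 0 0"
  have "spike_functional V ?E (word (star {} (listing t S)) 1) = of_bool (S \<subseteq> V c\<^sub>0)"
    if S: "S \<in> {w..<UNIV}" for S
  proof -
    have "card S < 5" using S psubset_card_mono[of UNIV S] by (auto simp: CARD_5)
    then have listing: "set (listing t S) = S" "length (listing t S) = t"
      using listing[of S t] S w t by auto
    have "(\<lambda>c. ?E c - t) = (\<lambda>c. 0)" by (auto simp: flag_exponents_def)
    then have "spike_functional V ?E (word (star {} (listing t S)) 1)
        = prod_list (map (minor V {c\<^sub>0}) (star {} (listing t S)))"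
      using spike_functional_word[of "star {} (listing t S)" "{c\<^sub>0}" ?E V 1] listing
      by (simp add: map_card_star flag_exponents_def spike_functional_0_1)
    then show ?thesis by (simp add: prod_list_minor_star minor_1 listing)
  qed
  then have "spike_functional V ?E (line_poly t w) = (\<Sum>S\<in>{w..<UNIV}. of_bool (S \<subseteq> V c\<^sub>0))"
    by (simp add: line_poly_def additive.sum[OF additive_spike_functional])
  also have "\<dots> + of_bool (V c\<^sub>0 = UNIV) = (\<Sum>S\<in>{w..UNIV}. of_bool (S \<subseteq> V c\<^sub>0))"
  proof -
    have "{w..UNIV} - {UNIV} = {w..<UNIV}" by auto
    moreover have "UNIV \<subseteq> V c\<^sub>0 \<longleftrightarrow> V c\<^sub>0 = UNIV" by auto
    ultimately show ?thesis
      using sum.remove[of "{w..UNIV}" UNIV "\<lambda>S. of_bool (S \<subseteq> V c\<^sub>0) :: bit"] by (simp add: add.commute)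
  qed
  also have "\<dots> = of_bool (w = V c\<^sub>0)" using sum_supersets_of_bool_subset[of w UNIV "V c\<^sub>0"] by simp
  finally show ?thesis by (metis add.assoc add_0_right bit_add_self)
qed

lemma spike_functional_line_word:
  assumes s: "0 < s" and t: "4 \<le> t" and v: "v \<noteq> {}" and w: "map card w = replicate s 2"
  shows "spike_functional V (flag_exponents (s + t) s 0) (line_word t w v)
    = of_bool (v = V c\<^sub>0) * prod_list (map (minor V {c\<^sub>0, c\<^sub>1}) w)"
proof -
  let ?E = "flag_exponents (s + t) s 0" and ?m = "missing (last w)"
  have len: "length w = s" using arg_cong[OF w, of length] by simp
  then have "w \<noteq> []" using s by auto
  then have last: "last w \<in> set w" by simp
  then have "card (last w) \<in> set (map card w)" by simp
  then have last2: "card (last w) = 2" unfolding w by simp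
  then have "last w \<noteq> UNIV" by (auto simp: CARD_5)
  note m = missing_notin[OF this]
  have "spike_functional V ?E (line_word t w v)
      = prod_list (map (minor V {c\<^sub>0, c\<^sub>1}) w) * spike_functional V (\<lambda>c. ?E c - length w) (line_tail t (last w) v)"
    unfolding line_word_def
    by (rule spike_functional_word) (use w len c in \<open>auto simp: flag_exponents_def\<close>)
  also have "(\<lambda>c. ?E c - length w) = flag_exponents t 0 0" using len by (auto simp: flag_exponents_def)
  also have "spike_functional V (flag_exponents t 0 0) (line_tail t (last w) v)
      = of_bool (v = V c\<^sub>0) + of_bool ({?m} = V c\<^sub>0)"
    using spike_functional_line_poly[OF t v] spike_functional_line_poly[OF t, of "{?m}"]
    by (auto simp: line_tail_def additive.add[OF additive_spike_functional])
  also have "prod_list (map (minor V {c\<^sub>0, c\<^sub>1}) w) * (of_bool (v = V c\<^sub>0) + of_bool ({?m} = V c\<^sub>0))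
      = of_bool (v = V c\<^sub>0) * prod_list (map (minor V {c\<^sub>0, c\<^sub>1}) w)"
  proof (cases "{?m} = V c\<^sub>0")
    case True
    obtain a b where ab: "last w = {a, b}" "a \<noteq> b" using last2 by (auto simp: card_2_iff)
    have "a \<notin> V c\<^sub>0" "b \<notin> V c\<^sub>0" using m ab(1) unfolding True[symmetric] by (metis insertCI singletonD)+
    then have "minor V {c\<^sub>0, c\<^sub>1} (last w) = 0" unfolding ab(1) minor_2[OF ab(2)] by simp
    then have "prod_list (map (minor V {c\<^sub>0, c\<^sub>1}) w) = 0"
      using imageI[OF last, of "minor V {c\<^sub>0, c\<^sub>1}"] by (simp add: prod_list_zero_iff)
    then show ?thesis by simp
  qed (simp add: mult.commute)
  finally show ?thesis .
qed

context
  fixes v z u :: "'i set"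
  assumes flag: "(v, z, u) \<in> flags" and flag_V: "(V c\<^sub>0, V c\<^sub>1, V c\<^sub>2) \<in> flags"
begin

lemma pivots:
  shows "v \<noteq> {}" "z \<noteq> {}" "u \<noteq> {}" "pivot v \<in> v" "pivot z \<in> z" "pivot v \<notin> z" "pivot v \<notin> u" "pivot z \<notin> u"
    and "pivot (V c\<^sub>0) \<in> V c\<^sub>0" "pivot (V c\<^sub>1) \<in> V c\<^sub>1"
      "pivot (V c\<^sub>0) \<notin> V c\<^sub>1" "pivot (V c\<^sub>0) \<notin> V c\<^sub>2" "pivot (V c\<^sub>1) \<notin> V c\<^sub>2"
  using flag flag_V pivot_in[of v] pivot_in[of z] pivot_in[of "V c\<^sub>0"] pivot_in[of "V c\<^sub>1"]
  by (auto simp: flags_def)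

lemma spike_functional_plane_poly:
  assumes s: "4 \<le> s" and t: "4 \<le> t"
  shows "spike_functional V (flag_exponents (s + t) s 0) (plane_poly s t (pivot v) z v)
    = of_bool (v = V c\<^sub>0 \<and> z = V c\<^sub>1)"
proof -
  let ?E = "flag_exponents (s + t) s 0" and ?i = "pivot v"
  have "spike_functional V ?E (line_word t (star {?i} (listing s S)) v)
      = of_bool (v = V c\<^sub>0) * of_bool (S \<subseteq> V c\<^sub>1)" if "S \<in> {z..- {?i}}" for S
  proof -
    have S: "S \<noteq> {}" "S \<subseteq> - {?i}" using that pivots(2) by auto
    then have "card S \<le> s" using card_subset_Compl_singleton(1) s by (meson le_trans)
    note listing = listing[OF finite S(1) this]
    have "map card (star {?i} (listing s S)) = replicate s 2"
      using S listing by (subst map_card_star) auto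
    then have "spike_functional V ?E (line_word t (star {?i} (listing s S)) v)
        = of_bool (v = V c\<^sub>0) * prod_list (map (minor V {c\<^sub>0, c\<^sub>1}) (star {?i} (listing s S)))"
      using s t pivots(1) by (intro spike_functional_line_word) auto
    moreover have "prod_list (map (minor V {c\<^sub>0, c\<^sub>1}) (star {?i} (listing s S))) = of_bool (set (listing s S) \<subseteq> V c\<^sub>1)"
      if "v = V c\<^sub>0"
    proof (rule prod_list_minor_star)
      show "minor V {c\<^sub>0, c\<^sub>1} {a, ?i} = of_bool (a \<in> V c\<^sub>1)" if "a \<in> set (listing s S)" for a
      proof -
        have "a \<noteq> ?i" using that S listing by blast
        then show ?thesis using pivots \<open>v = V c\<^sub>0\<close> by (simp add: minor_2)
      qed
    qed
    ultimately show ?thesis unfolding listing(1) by (cases "v = V c\<^sub>0") simp_all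
  qed
  then have "spike_functional V ?E (plane_poly s t ?i z v)
      = of_bool (v = V c\<^sub>0) * (\<Sum>S\<in>{z..- {?i}}. of_bool (S \<subseteq> V c\<^sub>1))"
    by (simp add: plane_poly_def additive.sum[OF additive_spike_functional] sum_distrib_left)
  also have "\<dots> = of_bool (v = V c\<^sub>0) * of_bool (z = V c\<^sub>1 \<inter> - {?i})"
    using pivots by (subst sum_supersets_of_bool_subset) auto
  also have "\<dots> = of_bool (v = V c\<^sub>0 \<and> z = V c\<^sub>1)"
    using pivots by (auto simp: Int_absorb2)
  finally show ?thesis .
qed

context
  fixes d s t :: nat
  assumes d: "3 \<le> d" and s: "4 \<le> s" and t: "4 \<le> t"
begin

lemma spike_functional_flag_word:
  assumes K: "K \<noteq> {}" "K \<subseteq> - {pivot v, pivot z}"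
  shows "spike_functional V (flag_exponents (d + s + t) (d + s) d)
      (word (star {pivot v, pivot z} (listing d K)) (plane_poly s t (pivot v) z v))
    = of_bool (v = V c\<^sub>0 \<and> z = V c\<^sub>1) * of_bool (K \<subseteq> V c\<^sub>2)"
proof -
  let ?E = "flag_exponents (d + s + t) (d + s) d" and ?F = "{pivot v, pivot z}"
  let ?plane = "plane_poly s t (pivot v) z v" and ?ws = "star {pivot v, pivot z} (listing d K)"
  have ne: "pivot v \<noteq> pivot z" using pivots by auto
  then have "card K \<le> d" using card_mono[OF finite K(2)] d by simp
  note listing = listing[OF finite K(1) this]
  have "map card ?ws = replicate d 3" using K listing ne by (subst map_card_star) auto
  then have "spike_functional V ?E (word ?ws ?plane)
      = prod_list (map (minor V {c\<^sub>0, c\<^sub>1, c\<^sub>2}) ?ws) * spike_functional V (\<lambda>c. ?E c - length ?ws) ?plane"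
    using c listing by (intro spike_functional_word) (auto simp: flag_exponents_def)
  also have "(\<lambda>c. ?E c - length ?ws) = flag_exponents (s + t) s 0"
    using listing by (auto simp: flag_exponents_def)
  also have "spike_functional V (flag_exponents (s + t) s 0) ?plane = of_bool (v = V c\<^sub>0 \<and> z = V c\<^sub>1)"
    by (rule spike_functional_plane_poly[OF s t])
  finally have eval_word: "spike_functional V ?E (word ?ws ?plane)
      = prod_list (map (minor V {c\<^sub>0, c\<^sub>1, c\<^sub>2}) ?ws) * of_bool (v = V c\<^sub>0 \<and> z = V c\<^sub>1)" .
  have "prod_list (map (minor V {c\<^sub>0, c\<^sub>1, c\<^sub>2}) ?ws) = of_bool (set (listing d K) \<subseteq> V c\<^sub>2)"
    if "v = V c\<^sub>0" "z = V c\<^sub>1"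
  proof (rule prod_list_minor_star)
    show "minor V {c\<^sub>0, c\<^sub>1, c\<^sub>2} (insert k ?F) = of_bool (k \<in> V c\<^sub>2)" if "k \<in> set (listing d K)" for k
    proof (rule minor_3)
      show "k \<notin> ?F" using that K listing by blast
    qed (use pivots ne \<open>v = V c\<^sub>0\<close> \<open>z = V c\<^sub>1\<close> in simp_all)
  qed
  then show ?thesis unfolding eval_word listing(1) by (cases "v = V c\<^sub>0 \<and> z = V c\<^sub>1") simp_all
qed

lemma spike_functional_flag_poly:
  "spike_functional V (flag_exponents (d + s + t) (d + s) d) (flag_poly d s t (v, z, u))
    = of_bool (v = V c\<^sub>0 \<and> z = V c\<^sub>1 \<and> u = V c\<^sub>2)"
proof -
  let ?E = "flag_exponents (d + s + t) (d + s) d" and ?F = "{pivot v, pivot z}"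
  have "spike_functional V ?E (word (star ?F (listing d K)) (plane_poly s t (pivot v) z v))
      = of_bool (v = V c\<^sub>0 \<and> z = V c\<^sub>1) * of_bool (K \<subseteq> V c\<^sub>2)" if "K \<in> {u..- ?F}" for K
    by (rule spike_functional_flag_word) (use that pivots(3) in auto)
  then have "spike_functional V ?E (flag_poly d s t (v, z, u))
      = of_bool (v = V c\<^sub>0 \<and> z = V c\<^sub>1) * (\<Sum>K\<in>{u..- ?F}. of_bool (K \<subseteq> V c\<^sub>2))"
    by (simp add: flag_poly_def additive.sum[OF additive_spike_functional] sum_distrib_left)
  also have "\<dots> = of_bool (v = V c\<^sub>0 \<and> z = V c\<^sub>1) * of_bool (u = V c\<^sub>2 \<inter> - ?F)"
    using pivots by (subst sum_supersets_of_bool_subset) auto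
  also have "\<dots> = of_bool (v = V c\<^sub>0 \<and> z = V c\<^sub>1 \<and> u = V c\<^sub>2)"
    using pivots by (auto simp: Int_absorb2)
  finally show ?thesis .
qed

end

end

lemma deg_spike_flag_exponents:
  "deg (spike (flag_exponents a b k)) + 3 = 2 ^ a + 2 ^ b + 2 ^ k"
proof -
  have "deg (spike (flag_exponents a b k)) = (\<Sum>c\<in>{c\<^sub>0, c\<^sub>1, c\<^sub>2}. spike (flag_exponents a b k) c)"
    unfolding deg_def by (rule sum.mono_neutral_right) (auto simp: spike_def flag_exponents_def)
  also have "\<dots> = (2 ^ a - 1) + ((2 ^ b - 1) + (2 ^ k - 1))"
    by (simp add: spike_def flag_exponents_def flag_indices_ne)
  finally show ?thesis
    using one_le_power[of "2::nat" a] one_le_power[of "2::nat" b] one_le_power[of "2::nat" k] by linarith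
qed

end

lemma card_flags: "card (flags :: ('i::CARD_5 set \<times> 'i set \<times> 'i set) set) = 31 * (15 * 7)"
proof -
  define subsets where "subsets A = {S. S \<noteq> {} \<and> S \<subseteq> A}" for A :: "'i set"
  have card: "card (subsets A) = 2 ^ card A - 1" for A
  proof -
    have "subsets A = Pow A - {{}}" by (auto simp: subsets_def)
    then show ?thesis by (simp add: card_Pow)
  qed
  let ?planes = "\<lambda>v. SIGMA z:subsets (- {pivot v}). subsets (- {pivot v, pivot z})"
  have planes: "card (?planes v) = 15 * 7" for v
  proof -
    have "card (subsets (- {pivot v, pivot z})) = 7" if "z \<in> subsets (- {pivot v})" for z
      using that pivot_in[of z] unfolding card by (subst card_Compl_doubleton) (auto simp: subsets_def)
    then show ?thesis by (simp add: card)
  qed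
  have flags: "flags = (SIGMA v:subsets UNIV. ?planes v)" by (auto simp: flags_def subsets_def)
  have "card (flags :: ('i set \<times> 'i set \<times> 'i set) set) = (\<Sum>v\<in>subsets UNIV. card (?planes v))"
    unfolding flags by (rule card_SigmaI) auto
  then show ?thesis unfolding planes by (simp add: card CARD_5)
qed

definition flag_functional ::
    "nat \<Rightarrow> nat \<Rightarrow> nat \<Rightarrow> 'i set \<times> 'i set \<times> 'i set \<Rightarrow> 'i::CARD_5 pol \<Rightarrow> bit" where
  "flag_functional d s t = (\<lambda>(v, z, u).
     spike_functional ((\<lambda>c :: Enum.finite_3. u)(finite_3.a\<^sub>1 := v, finite_3.a\<^sub>2 := z))
       (flag_exponents finite_3.a\<^sub>1 finite_3.a\<^sub>2 finite_3.a\<^sub>3 (d + s + t) (d + s) d))"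

lemma A_annihilated_flag_functional:
  "A_annihilated (weight_degree (flag_weight d s t)) (flag_functional d s t F)"
proof -
  have "deg (spike (flag_exponents finite_3.a\<^sub>1 finite_3.a\<^sub>2 finite_3.a\<^sub>3 (d + s + t) (d + s) d))
      = weight_degree (flag_weight d s t)"
    using deg_spike_flag_exponents[of finite_3.a\<^sub>1 finite_3.a\<^sub>2 finite_3.a\<^sub>3 "d + s + t" "d + s" d]
      weight_degree_flag_weight[of d s t] by simp
  then show ?thesis
    using A_annihilated_spike_functional by (cases F) (simp add: flag_functional_def flip: \<open>deg _ = _\<close>)
qed

lemma flag_functional_flag_poly:
  assumes "3 \<le> d" "4 \<le> s" "4 \<le> t" "F \<in> flags" "F' \<in> flags"
  shows "flag_functional d s t F (flag_poly d s t F') = of_bool (F = F')"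
proof -
  obtain v z u v' z' u' where F: "F = (v, z, u)" "F' = (v', z', u')" by (cases F; cases F')
  have distinct: "distinct [finite_3.a\<^sub>1, finite_3.a\<^sub>2, finite_3.a\<^sub>3]" by simp
  have "flag_functional d s t F (flag_poly d s t F') = of_bool (v' = v \<and> z' = z \<and> u' = u)"
    using spike_functional_flag_poly[OF distinct, of v' z' u' "(\<lambda>c. u)(finite_3.a\<^sub>1 := v, finite_3.a\<^sub>2 := z)" d s t] assms
    by (simp add: F flag_functional_def)
  then show ?thesis by (auto simp: F)
qed

subsection \<open>Linear functionals and dimension\<close>

lemma vector_space_times: "vector_space ((*) :: 'a::field \<Rightarrow> 'a \<Rightarrow> 'a)"
  by standard (auto simp: distrib_left distrib_right mult.assoc)

context vector_space
begin

lemma linear_functional_vanish_span: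
  assumes "Vector_Spaces.linear scale (*) \<Lambda>" "\<And>y. y \<in> S \<Longrightarrow> \<Lambda> y = 0" "x \<in> span S"
  shows "\<Lambda> x = 0"
proof -
  interpret \<Lambda>: Vector_Spaces.linear scale "(*)" \<Lambda> by (rule assms(1))
  show ?thesis by (rule \<Lambda>.eq_0_on_span[OF assms(2,3)])
qed

lemma separating_linear_functional:
  assumes "x \<notin> span S"
  obtains \<Lambda> where "Vector_Spaces.linear scale (*) \<Lambda>" "\<And>y. y \<in> S \<Longrightarrow> \<Lambda> y = 0" "\<Lambda> x = 1"
proof -
  interpret vector_space_pair scale "(*)"
    using vector_space_axioms vector_space_times by (rule vector_space_pair.intro)
  obtain B where B: "B \<subseteq> S" "independent B" "S \<subseteq> span B"
    using maximal_independent_subset[of S] .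
  then have "span B = span S" using span_superset[of S] unfolding span_eq by blast
  then have x: "x \<notin> span B" using assms by simp
  then have "independent (insert x B)" using B(2) by (rule independent_insertI)
  then obtain \<Lambda> where \<Lambda>: "Vector_Spaces.linear scale (*) \<Lambda>" "\<forall>y\<in>insert x B. \<Lambda> y = of_bool (y = x)"
    using linear_independent_extend[of "insert x B" "\<lambda>y. of_bool (y = x)"] by blast
  have "x \<notin> B" using x span_base[of x B] by blast
  have "\<Lambda> y = 0" if "y \<in> S" for y
  proof (rule linear_functional_vanish_span[OF \<Lambda>(1)])
    show "y \<in> span B" using that B(3) by blast
    show "\<Lambda> y = 0" if "y \<in> B" for y using that \<Lambda>(2) \<open>x \<notin> B\<close> by (cases "y = x") simp_all
  qed
  then show ?thesis using \<Lambda> by (intro that[of \<Lambda>]) simp_all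
qed

lemma independent_Un_dual_family:
  assumes C: "independent C" "finite C" and I: "finite I"
    and \<phi>: "\<And>i. i \<in> I \<Longrightarrow> Vector_Spaces.linear scale (*) (\<phi> i)"
    and C_0: "\<And>i y. i \<in> I \<Longrightarrow> y \<in> C \<Longrightarrow> \<phi> i y = 0"
    and dual: "\<And>i j. i \<in> I \<Longrightarrow> j \<in> I \<Longrightarrow> \<phi> i (b j) = of_bool (i = j)"
  shows "independent (b ` I \<union> C) \<and> card (b ` I \<union> C) = card I + card C"
  using I \<phi> C_0 dual
proof (induction I rule: finite_induct)
  case empty
  then show ?case using C by simp
next
  case (insert i I)
  have "\<phi> i y = 0" if "y \<in> span (b ` I \<union> C)" for y
  proof (rule linear_functional_vanish_span[OF _ _ that])
    fix y assume "y \<in> b ` I \<union> C"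
    then show "\<phi> i y = 0"
    proof
      assume "y \<in> b ` I"
      then obtain j where "j \<in> I" "y = b j" by blast
      then show ?thesis using insert.prems(3)[OF insertI1 insertI2, of j] insert.hyps(2) by force
    qed (rule insert.prems(2)[OF insertI1])
  qed (rule insert.prems(1)[OF insertI1])
  moreover have "\<phi> i (b i) = 1" using insert.prems(3)[of i i] by simp
  ultimately have b_i: "b i \<notin> span (b ` I \<union> C)" by (metis zero_neq_one)
  have IH: "independent (b ` I \<union> C) \<and> card (b ` I \<union> C) = card I + card C"
    by (rule insert.IH) (blast intro: insert.prems)+
  have "independent (insert (b i) (b ` I \<union> C))" using IH by (intro independent_insertI[OF b_i]) simp
  moreover have "b i \<notin> b ` I \<union> C" by (rule contrapos_nn[OF b_i span_base])
  ultimately show ?case using IH insert.hyps(1,2) C(2) by simp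
qed

lemma dim_Un_dual_family:
  assumes H: "H \<subseteq> span F" "finite F" and I: "finite I"
    and \<phi>: "\<And>i. i \<in> I \<Longrightarrow> Vector_Spaces.linear scale (*) (\<phi> i)"
    and H_0: "\<And>i y. i \<in> I \<Longrightarrow> y \<in> H \<Longrightarrow> \<phi> i y = 0"
    and dual: "\<And>i j. i \<in> I \<Longrightarrow> j \<in> I \<Longrightarrow> \<phi> i (b j) = of_bool (i = j)"
  shows "dim (b ` I \<union> H) = card I + dim H"
proof -
  obtain C where C: "C \<subseteq> H" "independent C" "H \<subseteq> span C" "card C = dim H" by (rule basis_exists)
  have "finite C" using independent_span_bound[OF H(2) C(2)] C(1) H(1) by auto
  then have ind: "independent (b ` I \<union> C)" "card (b ` I \<union> C) = card I + card C"
    using independent_Un_dual_family[OF C(2) _ I \<phi> _ dual] H_0 C(1) by auto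
  have "b ` I \<union> H \<subseteq> span (b ` I \<union> C)"
    using span_superset[of "b ` I \<union> C"] span_mono[of C "b ` I \<union> C"] C(3) by auto
  moreover have "b ` I \<union> C \<subseteq> span (b ` I \<union> H)"
    using span_superset[of "b ` I \<union> H"] C(1) by auto
  ultimately have "span (b ` I \<union> C) = span (b ` I \<union> H)" by (simp add: span_eq)
  then show ?thesis using ind C(4) dim_eq_card[of "b ` I \<union> C" "b ` I \<union> H"] by simp
qed

end

interpretation F2: vector_space scaleF2
  by standard (auto simp: scaleF2_def fun_eq_iff distrib_left distrib_right mult.assoc)

lemma spanF2_eq_span: "spanF2 = F2.span"
  by (simp add: fun_eq_iff spanF2_def)

lemma dimF2_eq_dim: "dimF2 = F2.dim"
  by (simp add: fun_eq_iff dimF2_def)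

lemma linear_functional_F2:
  assumes "additive \<Lambda>"
  shows "Vector_Spaces.linear scaleF2 (*) (\<Lambda> :: (nat list \<Rightarrow> bit) \<Rightarrow> bit)"
proof -
  interpret bit: vector_space "(*) :: bit \<Rightarrow> bit \<Rightarrow> bit" by (rule vector_space_times)
  show ?thesis
  proof unfold_locales
    fix c f
    show "\<Lambda> (scaleF2 c f) = c * \<Lambda> f"
      using additive.zero[OF assms] by (cases c) (auto simp: scaleF2_def zero_fun_def)
  qed (rule additive.add[OF assms])
qed

subsection \<open>Exponent lists\<close>

definition exps :: "('i::enum \<Rightarrow> nat) \<Rightarrow> nat list" where
  "exps e = map e Enum.enum"

lemma length_exps: "length (exps (e :: 'i::enum \<Rightarrow> nat)) = CARD('i)"
  by (simp add: exps_def card_UNIV_length_enum)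

lemma inj_exps: "inj exps"
  by (rule injI) (auto simp: exps_def map_eq_conv fun_eq_iff enum_UNIV)

lemma ex_exps:
  assumes "length l = CARD('i::enum)"
  obtains e :: "'i::enum \<Rightarrow> nat" where "l = exps e"
proof -
  have "l = exps (\<lambda>i :: 'i. the (map_of (zip Enum.enum l) i))"
    using assms enum_distinct[where 'a = 'i]
    by (intro nth_equalityI) (auto simp: exps_def map_of_zip_nth card_UNIV_length_enum)
  then show ?thesis by (rule that)
qed

lemma sum_list_exps: "sum_list (exps e) = deg e"
  unfolding exps_def deg_def UNIV_enum by (rule sum_list_distinct_conv_sum_set[OF enum_distinct])

lemma exps_in_mons_iff: "exps (e :: 'i::enum \<Rightarrow> nat) \<in> mons CARD('i) n \<longleftrightarrow> deg e = n"
  by (simp add: mons_def length_exps sum_list_exps)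

lemma mons_eq_exps: "mons CARD('i) n = exps ` {e :: 'i::enum \<Rightarrow> nat. deg e = n}"
proof (intro equalityI subsetI)
  fix l assume l: "l \<in> mons CARD('i) n"
  then obtain e :: "'i \<Rightarrow> nat" where "l = exps e" using ex_exps[of l] by (auto simp: mons_def)
  then show "l \<in> exps ` {e :: 'i \<Rightarrow> nat. deg e = n}" using l by (simp add: exps_in_mons_iff)
qed (auto simp: exps_in_mons_iff)

lemma finite_mons: "finite (mons k n)"
proof (rule finite_subset)
  show "mons k n \<subseteq> {e. set e \<subseteq> {..n} \<and> length e = k}"
    using member_le_sum_list by (fastforce simp: mons_def)
qed (simp add: finite_lists_length_eq)

lemma finite_deg: "finite {e :: 'i::enum \<Rightarrow> nat. deg e = n}"
  using finite_mons[of "CARD('i)" n] unfolding mons_eq_exps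
  by (rule finite_imageD) (rule inj_on_subset[OF inj_exps subset_UNIV])

lemma Pdeg_iff: "f \<in> Pdeg k n \<longleftrightarrow> (\<forall>l. l \<notin> mons k n \<longrightarrow> f l = 0)"
  unfolding Pdeg_def by blast

definition pol_of :: "nat \<Rightarrow> (nat list \<Rightarrow> bit) \<Rightarrow> 'i::enum pol" where
  "pol_of n f = (\<Sum>e | deg e = n \<and> f (exps e) = 1. mon e)"

definition list_part :: "nat \<Rightarrow> 'i::enum pol \<Rightarrow> nat list \<Rightarrow> bit" where
  "list_part n p l = (if l \<in> mons CARD('i) n then lookup p (inv exps l) else 0)"

lemma lookup_pol_of: "lookup (pol_of n f) e = of_bool (deg e = n) * f (exps e)"
proof -
  have "lookup (pol_of n f) e = (\<Sum>e' | deg e' = n \<and> f (exps e') = 1. of_bool (e' = e))"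
    by (simp add: pol_of_def lookup_sum lookup_single when_def of_bool_def)
  also have "\<dots> = of_bool (deg e = n \<and> f (exps e) = 1)"
    using finite_deg[where 'i = 'a] by (simp add: of_bool_def sum.delta)
  finally show ?thesis by (cases "f (exps e)") auto
qed

lemma list_part_exps: "list_part n p (exps e) = of_bool (deg e = n) * lookup p e"
  by (simp add: list_part_def exps_in_mons_iff inv_f_f[OF inj_exps])

lemma list_part_in_Pdeg: "list_part n (p :: 'i::enum pol) \<in> Pdeg CARD('i) n"
  by (simp add: Pdeg_iff list_part_def)

lemma Pdeg_eqI:
  assumes "f \<in> Pdeg CARD('i::enum) n" "g \<in> Pdeg CARD('i::enum) n"
    and "\<And>e :: 'i \<Rightarrow> nat. deg e = n \<Longrightarrow> f (exps e) = g (exps e)"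
  shows "f = g"
proof
  fix l
  show "f l = g l"
  proof (cases "l \<in> mons CARD('i) n")
    case True
    then show ?thesis using assms(3) by (auto simp: mons_eq_exps)
  next
    case False
    then show ?thesis using assms(1,2) by (simp add: Pdeg_iff)
  qed
qed

lemma list_part_pol_of:
  assumes "f \<in> Pdeg CARD('i::enum) n"
  shows "list_part n (pol_of n f :: 'i::enum pol) = f"
  by (rule Pdeg_eqI[OF list_part_in_Pdeg assms]) (simp add: list_part_exps lookup_pol_of)

lemma additive_pol_of: "additive (pol_of n)"
  by standard (auto intro!: poly_mapping_eqI simp: lookup_add lookup_pol_of distrib_left)

lemma additive_list_part: "additive (list_part n)"
  by standard (auto simp: list_part_def fun_eq_iff lookup_add)

lemma pol_of_list_part_mon: "pol_of n (list_part n (mon e)) = of_bool (deg e = n) * mon e"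
  by (rule poly_mapping_eqI) (auto simp: lookup_pol_of list_part_exps lookup_single when_def)

lemma A_annihilated_list_part:
  assumes "A_annihilated n L"
  shows "L (pol_of n (list_part n p)) = L p"
proof (rule additive_pol_eqI[OF _ A_annihilatedD(1)[OF assms], where p = p])
  show "additive (\<lambda>p. L (pol_of n (list_part n p)))"
    by standard (simp add: additive.add[OF additive_list_part] additive.add[OF additive_pol_of]
        additive.add[OF A_annihilatedD(1)[OF assms]])
  show "L (pol_of n (list_part n (mon e))) = L (mon e)" for e
    using A_annihilatedD(3)[OF assms, of e] additive.zero[OF A_annihilatedD(1)[OF assms]]
    by (simp add: pol_of_list_part_mon)
qed

lemma exps_in_sqmon_iff:
  "exps f \<in> sqmon i (exps e) \<longleftrightarrow> deg f = deg e + i \<and> lookup (St (mon e)) f = 1"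
proof -
  let ?Q = "\<lambda>x. e x \<le> f x \<and> odd (e x choose (f x - e x))"
  have "(\<forall>j<length (exps e). exps e ! j \<le> exps f ! j \<and> odd (exps e ! j choose (exps f ! j - exps e ! j)))
    \<longleftrightarrow> (\<forall>x. ?Q x)"
    using all_set_conv_all_nth[of Enum.enum ?Q] by (simp add: exps_def enum_UNIV)
  then show ?thesis by (simp add: sqmon_def length_exps sum_list_exps lookup_St_mon)
qed

lemma Sq_in_Pdeg:
  assumes "f \<in> Pdeg k d"
  shows "Sq i f \<in> Pdeg k (d + i)"
  unfolding Pdeg_def
proof (intro CollectI allI impI)
  fix m assume "Sq i f m \<noteq> 0"
  then obtain l where "(if m \<in> sqmon i l then f l else 0) \<noteq> 0"
    unfolding Sq_def by (rule sum.not_neutral_contains_not_neutral)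
  then have "m \<in> sqmon i l" "f l \<noteq> 0" by (auto split: if_splits)
  then show "m \<in> mons k (d + i)" using assms by (auto simp: Pdeg_def mons_def sqmon_def)
qed

lemma Sq_eq_list_part:
  assumes "f \<in> Pdeg CARD('i::enum) d"
  shows "Sq i f = list_part (d + i) (St (pol_of d f :: 'i::enum pol))"
proof (rule Pdeg_eqI[OF Sq_in_Pdeg[OF assms] list_part_in_Pdeg])
  fix e :: "'i \<Rightarrow> nat" assume e: "deg e = d + i"
  have "Sq i f (exps e) = (\<Sum>l\<in>mons CARD('i) d. if exps e \<in> sqmon i l then f l else 0)"
    using e by (simp add: Sq_def mons_def length_exps sum_list_exps)
  also have "\<dots> = (\<Sum>e' :: 'i \<Rightarrow> nat | deg e' = d. if exps e \<in> sqmon i (exps e') then f (exps e') else 0)"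
    unfolding mons_eq_exps by (subst sum.reindex) (auto intro: inj_on_subset[OF inj_exps])
  also have "\<dots> = (\<Sum>e' | deg e' = d \<and> f (exps e') = 1. lookup (St (mon e')) e)"
    using e finite_deg by (intro sum.mono_neutral_cong_right) (auto simp: exps_in_sqmon_iff)
  also have "\<dots> = lookup (St (pol_of d f)) e"
    by (simp add: pol_of_def additive.sum[OF additive_St] lookup_sum)
  finally show "Sq i f (exps e) = list_part (d + i) (St (pol_of d f :: 'i pol)) (exps e)"
    using e by (simp add: list_part_exps)
qed

lemma hit_subset_Pdeg: "hit k n \<subseteq> Pdeg k n"
  unfolding hit_def spanF2_eq_span
proof (rule F2.span_minimal)
  show "F2.subspace (Pdeg k n)"
    by (rule F2.subspaceI) (auto simp: Pdeg_iff scaleF2_def)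
qed (auto simp: Sq_in_Pdeg)

lemma Pdeg_subset_span: "Pdeg k n \<subseteq> F2.span ((\<lambda>l m. of_bool (m = l)) ` mons k n)"
proof
  fix f assume f: "f \<in> Pdeg k n"
  have "f = (\<Sum>l\<in>mons k n. scaleF2 (f l) (\<lambda>m. of_bool (m = l)))"
  proof
    fix m
    have sum_apply: "(\<Sum>l\<in>A. g l) m = (\<Sum>l\<in>A. g l m)" for A and g :: "nat list \<Rightarrow> nat list \<Rightarrow> bit"
      by (induction A rule: infinite_finite_induct) auto
    have "(\<Sum>l\<in>mons k n. scaleF2 (f l) (\<lambda>m. of_bool (m = l))) m = (\<Sum>l\<in>mons k n. if m = l then f l else 0)"
      unfolding sum_apply by (rule sum.cong) (auto simp: scaleF2_def)
    also have "\<dots> = f m" using f finite_mons[of k n] by (simp add: Pdeg_iff)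
    finally show "f m = (\<Sum>l\<in>mons k n. scaleF2 (f l) (\<lambda>m. of_bool (m = l))) m" ..
  qed
  also have "\<dots> \<in> F2.span ((\<lambda>l m. of_bool (m = l)) ` mons k n)"
    by (intro F2.span_sum F2.span_scale F2.span_base) auto
  finally show "f \<in> F2.span ((\<lambda>l m. of_bool (m = l)) ` mons k n)" .
qed

lemma A_annihilated_hit:
  assumes L: "A_annihilated n (L :: 'i::enum pol \<Rightarrow> bit)" and f: "f \<in> hit CARD('i::enum) n"
  shows "L (pol_of n f) = 0"
proof -
  have "additive (\<lambda>f. L (pol_of n f))"
    by standard (simp add: additive.add[OF additive_pol_of] additive.add[OF A_annihilatedD(1)[OF L]])
  then have linear: "Vector_Spaces.linear scaleF2 (*) (\<lambda>f. L (pol_of n f))" by (rule linear_functional_F2)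
  show ?thesis
  proof (rule F2.linear_functional_vanish_span[OF linear])
    show "f \<in> F2.span {Sq i f |i f d. 0 < i \<and> d + i = n \<and> f \<in> Pdeg CARD('i) d}"
      using f by (simp add: hit_def spanF2_eq_span)
    fix y assume "y \<in> {Sq i f |i f d. 0 < i \<and> d + i = n \<and> f \<in> Pdeg CARD('i) d}"
    then obtain i d g where i: "0 < i" "d + i = n" and g: "g \<in> Pdeg CARD('i) d" and y: "y = Sq i g" by blast
    have "L (pol_of n y) = L (St (pol_of d g))"
      using A_annihilated_list_part[OF L] i(2) by (simp add: y Sq_eq_list_part[OF g])
    also have "\<dots> = L (\<Sum>e | deg e = d \<and> g (exps e) = 1. mon e)"
      by (simp only: A_annihilatedD(2)[OF L] pol_of_def)
    also have "\<dots> = 0"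
      using A_annihilatedD(3)[OF L] i by (auto simp: additive.sum[OF A_annihilatedD(1)[OF L]] intro!: sum.neutral)
    finally show "L (pol_of n y) = 0" .
  qed
qed

lemma A_annihilated_of_vanish_hit:
  assumes \<Lambda>: "additive \<Lambda>" and hit: "\<And>f. f \<in> hit CARD('i::enum) n \<Longrightarrow> \<Lambda> f = 0"
  shows "A_annihilated n (\<lambda>p :: 'i::enum pol. \<Lambda> (list_part n p))"
  unfolding A_annihilated_def
proof (intro conjI allI impI)
  show additive: "additive (\<lambda>p :: 'i pol. \<Lambda> (list_part n p))"
    by standard (simp add: additive.add[OF additive_list_part] additive.add[OF \<Lambda>])
  show other_degree: "\<Lambda> (list_part n (mon e)) = 0" if "deg e \<noteq> n" for e :: "'i \<Rightarrow> nat"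
  proof -
    have "list_part n (mon e) = 0"
      using that by (intro Pdeg_eqI[OF list_part_in_Pdeg])
        (auto simp: Pdeg_def list_part_exps lookup_single when_def)
    then show ?thesis using additive.zero[OF \<Lambda>] by simp
  qed
  fix p :: "'i pol"
  show "\<Lambda> (list_part n (St p)) = \<Lambda> (list_part n p)"
  proof (rule additive_pol_eqI[OF _ additive, where p = p])
    show "additive (\<lambda>p :: 'i pol. \<Lambda> (list_part n (St p)))"
      by standard (simp add: St_add additive.add[OF additive])
    fix e :: "'i \<Rightarrow> nat"
    show "\<Lambda> (list_part n (St (mon e))) = \<Lambda> (list_part n (mon e))"
    proof (cases "deg e < n")
      case False
      then show ?thesis using other_degree by (intro additive_St_mon_lowest[OF additive]) auto
    next
      case True
      have "Sq (n - deg e) (list_part (deg e) (mon e)) = list_part n (St (mon e))"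
        using True by (simp add: Sq_eq_list_part[OF list_part_in_Pdeg] pol_of_list_part_mon)
      moreover have "Sq (n - deg e) (list_part (deg e) (mon e)) \<in> hit CARD('i) n"
        unfolding hit_def spanF2_eq_span using True list_part_in_Pdeg[of "deg e" "mon e"]
        by (intro F2.span_base) force
      ultimately show ?thesis using hit other_degree[of e] True by simp
    qed
  qed
qed

lemma in_span_Un_hitI:
  assumes f: "f \<in> Pdeg CARD('i::enum) n" and S: "S \<subseteq> Pdeg CARD('i::enum) n"
    and vanish: "\<And>L :: 'i::enum pol \<Rightarrow> bit. A_annihilated n L \<Longrightarrow> (\<And>g. g \<in> S \<Longrightarrow> L (pol_of n g) = 0) \<Longrightarrow> L (pol_of n f) = 0"
  shows "f \<in> F2.span (S \<union> hit CARD('i::enum) n)"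
proof (rule ccontr)
  assume "f \<notin> F2.span (S \<union> hit CARD('i) n)"
  then obtain \<Lambda> where linear: "Vector_Spaces.linear scaleF2 (*) \<Lambda>"
    and \<Lambda>: "\<And>y. y \<in> S \<union> hit CARD('i) n \<Longrightarrow> \<Lambda> y = 0" "\<Lambda> f = 1"
    by (rule F2.separating_linear_functional) blast
  interpret \<Lambda>: Vector_Spaces.linear scaleF2 "(*)" \<Lambda> by (rule linear)
  have "A_annihilated n (\<lambda>p :: 'i pol. \<Lambda> (list_part n p))"
  proof (rule A_annihilated_of_vanish_hit)
    show "additive \<Lambda>" by standard (rule \<Lambda>.add)
  qed (simp add: \<Lambda>(1))
  moreover have "\<Lambda> (list_part n (pol_of n g :: 'i pol)) = 0" if "g \<in> S" for g
    using that S \<Lambda>(1) by (auto simp: list_part_pol_of)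
  ultimately have "\<Lambda> (list_part n (pol_of n f :: 'i pol)) = 0" by (rule vanish)
  then show False using \<Lambda>(2) f by (simp add: list_part_pol_of)
qed

subsection \<open>The kernel of Kameko's homomorphism\<close>

lemma functional_pol_of_kphi:
  fixes L :: "'i::enum pol \<Rightarrow> bit"
  assumes L: "additive L" and vanish: "\<And>J g. J \<noteq> UNIV \<Longrightarrow> L (X J * g\<^sup>2) = 0"
  shows "L (pol_of (CARD('i) + 2 * M) f) = L (X UNIV * (pol_of M (kphi CARD('i) f))\<^sup>2)"
proof -
  let ?h = "\<lambda>(y :: 'i \<Rightarrow> nat) i. of_bool (i \<in> UNIV) + 2 * y i"
  let ?A = "{e :: 'i \<Rightarrow> nat. deg e = CARD('i) + 2 * M \<and> f (exps e) = 1}"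
  let ?B = "{y :: 'i \<Rightarrow> nat. deg y = M \<and> kphi CARD('i) f (exps y) = 1}"
  have "kphi CARD('i) f (exps y) = f (exps (?h y))" for y
    unfolding kphi_def length_exps by (simp add: exps_def comp_def)
  then have mem: "?h y \<in> ?A \<longleftrightarrow> y \<in> ?B" for y
    using deg_X_mult_square[of UNIV y] by simp
  have even_vanish: "L (mon e) = 0" if e: "e \<in> ?A - ?h ` ?B" for e
  proof -
    have "{i. odd (e i)} \<noteq> UNIV"
    proof
      let ?y = "\<lambda>i. e i div 2"
      assume odd: "{i. odd (e i)} = UNIV"
      have e_eq: "?h ?y = e"
      proof
        fix i
        have "odd (e i)" using odd by blast
        then show "?h ?y i = e i" by simp
      qed
      then have "?y \<in> ?B" using e mem[of ?y] by simp
      then show False using e e_eq image_eqI[of e ?h ?y ?B] by simp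
    qed
    then show ?thesis by (subst mon_eq_X_mult_square) (rule vanish)
  qed
  have "L (pol_of (CARD('i) + 2 * M) f) = (\<Sum>e\<in>?A. L (mon e))"
    by (simp add: pol_of_def additive.sum[OF L])
  also have "\<dots> = (\<Sum>e\<in>?h ` ?B. L (mon e))"
    using finite_deg[of "CARD('i) + 2 * M", where 'i = 'i] mem even_vanish
    by (intro sum.mono_neutral_right) auto
  also have "\<dots> = (\<Sum>y\<in>?B. L (mon (?h y)))"
    by (subst sum.reindex) (auto simp: inj_on_def fun_eq_iff)
  also have "\<dots> = L (X UNIV * (\<Sum>y\<in>?B. mon y)\<^sup>2)"
    by (simp only: X_mult_square_mon additive.sum[OF additive_square[OF L]])
  finally show ?thesis by (simp only: pol_of_def)
qed

lemma kphi_list_part_eq_0: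
  fixes p :: "'i::enum pol"
  assumes "\<And>e. (\<And>i. odd (e i)) \<Longrightarrow> lookup p e = 0"
  shows "kphi CARD('i) (list_part n p) = 0"
proof
  fix l
  show "kphi CARD('i) (list_part n p) l = 0 l"
  proof (cases "length l = CARD('i)")
    case True
    then obtain y :: "'i \<Rightarrow> nat" where y: "l = exps y" by (rule ex_exps)
    have "kphi CARD('i) (list_part n p) l = list_part n p (exps (\<lambda>i. 2 * y i + 1))"
      using True by (simp add: kphi_def y) (simp add: exps_def comp_def)
    then show ?thesis using assms[of "\<lambda>i. 2 * y i + 1"] by (simp add: list_part_exps)
  qed (simp add: kphi_def)
qed

lemma lookup_flag_poly_odd:
  fixes e :: "'i::CARD_5 \<Rightarrow> nat"
  assumes d: "3 \<le> d" and F: "(v, z, u) \<in> flags" and odd: "\<And>i. odd (e i)"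
  shows "lookup (flag_poly d s t (v, z, u)) e = 0"
proof -
  let ?F = "{pivot v, pivot z}"
  have "lookup (word (star ?F (listing d K)) g) e = 0" if K: "K \<in> {u..- ?F}" for K g
  proof -
    have "pivot v \<noteq> pivot z" "K \<noteq> {}" using F K pivot_in[of z] by (auto simp: flags_def)
    then have "length (listing d K) = d"
      using card_mono[OF finite, of K "- ?F"] K d by (intro length_listing) auto
    then obtain k w where w: "listing d K = k # w" using d by (cases "listing d K") auto
    have "card (insert k ?F) \<le> 3" by (simp add: card_insert_if)
    then have "{i. odd (e i)} \<noteq> insert k ?F" using odd by (force simp: CARD_5)
    then have "e \<notin> keys (X (insert k ?F) * q\<^sup>2)" for q using odd_keys_X_mult_square by blast
    then show ?thesis by (simp add: w star_Cons in_keys_iff)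
  qed
  then show ?thesis by (simp add: flag_poly_def lookup_sum)
qed

context
  fixes d s t n :: nat
  assumes d: "3 \<le> d" and s: "4 \<le> s" and t: "4 \<le> t"
    and n: "n = weight_degree (flag_weight d s t)"
begin

lemma flag_degree: "n = 5 + 2 * ((n - 5) div 2)"
proof -
  have n3: "n + 3 = 2 ^ (d + s + t) + 2 ^ (d + s) + 2 ^ d"
    unfolding n by (rule weight_degree_flag_weight)
  then have "even (n + 3)" using d by simp
  moreover have "2 ^ 3 \<le> (2::nat) ^ d" using d by (intro power_increasing) auto
  then have "5 \<le> n" using n3 by simp
  ultimately show ?thesis by presburger
qed

lemma kameko_kernel_subset_span:
  assumes f: "f \<in> Pdeg 5 n" and kphi: "kphi 5 f \<in> hit 5 ((n - 5) div 2)"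
  shows "f \<in> F2.span ((\<lambda>F. list_part n (flag_poly d s t F :: 'i::{enum, CARD_5} pol)) ` flags \<union> hit 5 n)"
proof -
  let ?M = "(n - 5) div 2"
  have "L (pol_of n f) = 0"
    if L: "A_annihilated n L"
      and flags: "\<And>g. g \<in> (\<lambda>F. list_part n (flag_poly d s t F :: 'i pol)) ` flags \<Longrightarrow> L (pol_of n g) = 0"
    for L :: "'i pol \<Rightarrow> bit"
  proof -
    have minimal: "minimal_weight (flag_weight d s t) L"
      using L s t by (intro minimal_weight_flag_weight) (auto simp: n)
    have flag_poly_0: "L (flag_poly d s t F) = 0" if "F \<in> flags" for F
      using flags[OF imageI[OF that]] by (simp add: A_annihilated_list_part[OF L])
    have vanish: "L (X J * g\<^sup>2) = 0" if "J \<noteq> UNIV" for J g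
      by (rule vanish_below_UNIV[OF d s t minimal flag_poly_0 that])
    have "L (X J * g\<^sup>2) = 0" if "card J < CARD('i)" for J g
      by (rule vanish) (use that in auto)
    moreover have "A_annihilated (card (UNIV :: 'i set) + 2 * ?M) L"
      using L flag_degree by (simp add: CARD_5)
    ultimately have "A_annihilated ?M (\<lambda>g. L (X UNIV * g\<^sup>2))" by (intro A_annihilated_quotient)
    then have "L (X UNIV * (pol_of ?M (kphi CARD('i) f))\<^sup>2) = 0"
      using kphi by (intro A_annihilated_hit[of ?M "\<lambda>g. L (X UNIV * g\<^sup>2)"]) (simp_all add: CARD_5)
    then show ?thesis
      using functional_pol_of_kphi[OF A_annihilatedD(1)[OF L] vanish, of ?M f] flag_degree
      by (simp add: CARD_5)
  qed
  then show ?thesis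
    using in_span_Un_hitI[where 'i = 'i, of f n "(\<lambda>F. list_part n (flag_poly d s t F :: 'i pol)) ` flags"]
      f list_part_in_Pdeg[where 'i = 'i, of n]
    by (auto simp: CARD_5)
qed

lemma flag_poly_in_kameko_kernel:
  assumes "F \<in> (flags :: ('i::{enum, CARD_5} set \<times> 'i set \<times> 'i set) set)"
  shows "list_part n (flag_poly d s t F) \<in> {f \<in> Pdeg 5 n. kphi 5 f \<in> hit 5 m}"
proof -
  obtain v z u where F: "F = (v, z, u)" by (cases F)
  have "kphi CARD('i) (list_part n (flag_poly d s t F)) = 0"
    using assms unfolding F by (intro kphi_list_part_eq_0 lookup_flag_poly_odd[OF d]) auto
  then show ?thesis
    using list_part_in_Pdeg[of n "flag_poly d s t F"]
    by (simp add: CARD_5 hit_def spanF2_eq_span F2.span_zero)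
qed

lemma dim_flag_polys_Un_hit:
  "F2.dim ((\<lambda>F. list_part n (flag_poly d s t F :: 'i::{enum, CARD_5} pol)) ` flags \<union> hit 5 n)
    = card (flags :: ('i set \<times> 'i set \<times> 'i set) set) + F2.dim (hit 5 n)"
proof (rule F2.dim_Un_dual_family)
  let ?\<phi> = "\<lambda>(F :: 'i set \<times> 'i set \<times> 'i set) f. flag_functional d s t F (pol_of n f)"
  have annihilated: "A_annihilated n (flag_functional d s t F)" for F :: "'i set \<times> 'i set \<times> 'i set"
    unfolding n by (rule A_annihilated_flag_functional)
  show "hit 5 n \<subseteq> F2.span ((\<lambda>l m. of_bool (m = l)) ` mons 5 n)"
    using hit_subset_Pdeg Pdeg_subset_span by (rule subset_trans)
  show "Vector_Spaces.linear scaleF2 (*) (?\<phi> F)" for F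
    by (intro linear_functional_F2 additive.intro)
      (simp add: additive.add[OF additive_pol_of] additive.add[OF A_annihilatedD(1)[OF annihilated]])
  show "?\<phi> F f = 0" if "f \<in> hit 5 n" for F f
    using A_annihilated_hit[OF annihilated] that by (simp add: CARD_5)
  show "?\<phi> F (list_part n (flag_poly d s t F')) = of_bool (F = F')" if "F \<in> flags" "F' \<in> flags" for F F'
    using that by (simp add: A_annihilated_list_part[OF annihilated] flag_functional_flag_poly[OF d s t])
qed (auto simp: finite_mons)

lemma kameko_ker_dim_eq_card_flags:
  "kameko_ker_dim 5 n = card (flags :: ('i::{enum, CARD_5} set \<times> 'i set \<times> 'i set) set)"
proof -
  let ?K = "{f \<in> Pdeg 5 n. kphi 5 f \<in> hit 5 ((n - 5) div 2)}"
  let ?B = "(\<lambda>F. list_part n (flag_poly d s t F :: 'i pol)) ` flags"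
  have "?K \<subseteq> F2.span (?B \<union> hit 5 n)" using kameko_kernel_subset_span by blast
  then have "?K \<union> hit 5 n \<subseteq> F2.span (?B \<union> hit 5 n)"
    using F2.span_superset[of "?B \<union> hit 5 n"] by blast
  moreover have "?B \<subseteq> ?K" using flag_poly_in_kameko_kernel by blast
  then have "?B \<union> hit 5 n \<subseteq> F2.span (?K \<union> hit 5 n)"
    using F2.span_superset[of "?K \<union> hit 5 n"] by blast
  ultimately have "F2.span (?K \<union> hit 5 n) = F2.span (?B \<union> hit 5 n)" by (simp add: F2.span_eq)
  then have "F2.dim (F2.span (?K \<union> hit 5 n)) = F2.dim (?B \<union> hit 5 n)" by (simp only: F2.dim_span)
  then show ?thesis
    by (simp add: kameko_ker_dim_def spanF2_eq_span dimF2_eq_dim dim_flag_polys_Un_hit)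
qed

end

instance Enum.finite_5 :: CARD_5
  by standard (simp add: UNIV_finite_5)

theorem theorem1p2:
  fixes d s t n :: nat
  assumes "n = 2 ^ (d + s + t) + 2 ^ (d + s) + 2 ^ d - 3"
    and "d \<ge> 6" and "s \<ge> 4" and "t \<ge> 4"
  shows "kameko_ker_dim 5 n = (2 ^ 3 - 1) * (2 ^ 4 - 1) * (2 ^ 5 - 1)
         \<and> (2 ^ 3 - 1) * (2 ^ 4 - 1) * (2 ^ 5 - 1) = (3255::nat)"
proof -
  have "n = weight_degree (flag_weight d s t)"
    using assms(1) weight_degree_flag_weight[of d s t] by linarith
  then have "kameko_ker_dim 5 n = card (flags :: (Enum.finite_5 set \<times> Enum.finite_5 set \<times> Enum.finite_5 set) set)"
    using assms(2-4) by (intro kameko_ker_dim_eq_card_flags) auto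
  then show ?thesis by (simp add: card_flags)
qed

end
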